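(* Let $M\in M_2(\mathbb{Z})$ be an expanding matrix and let $D=\{(0,0)^t,(\alpha_1,\alpha_2)^t,(\beta_1,\beta_2)^t\}\subset\mathbb{Z}^2$ be an integer digit set with $\alpha_1\beta_2-\alpha_2\beta_1\notin3\mathbb{Z}$. Then the following statements are equivalent: (i) $\mu_{M,D}$ is a spectral measure; (ii) $(M,D)$ is admissible; (iii) $(AMB)^*(1,-1)^t\in3\mathbb{Z}^2$, where $B=\begin{bmatrix}\alpha_1&\beta_1\\ \alpha_2&\beta_2\end{bmatrix}$ and $A\in GL_2(3)$ is an integer matrix satisfying $AB=I\pmod3$.
   Context: A matrix is expanding if all its eigenvalues have modulus $>1$. For an expanding $M\in M_2(\mathbb{R})$ and a finite $D\subset\mathbb{R}^2$, the self-affine measure $\mu_{M,D}$ is the unique Borel probability measure $\mu$ with $\mu=\frac{1}{|D|}\sum_{d\in D}\mu\circ\phi_d^{-1}$, where $\phi_d(x)=M^{-1}(x+d)$. A compactly supported Borel probability measure $\mu$ on $\mathbb{R}^n$ is a spectral measure if there is a countable set $\Lambda\subset\mathbb{R}^n$ such that $\{e^{2\pi i\langle\lambda,x\rangle}:\lambda\in\Lambda\}$ is an orthonormal basis of $L^2(\mu)$. For an expanding $M\in M_n(\mathbb{Z})$ and a finite $D\subset\mathbb{Z}^n$, $(M,D)$ is admissible if there is a finite set $S\subset\mathbb{Z}^n$ with $|S|=|D|$ such that the matrix $\frac{1}{\sqrt{|S|}}\left[e^{2\pi i\langle M^{-1}d,s\rangle}\right]_{d\in D,s\in S}$ is unitary.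 An integer matrix $A$ is said to be in $GL_2(3)$ if its reduction mod $3$ is invertible. $X^*$ denotes the conjugate transpose (here, transpose) of $X$. *)

theory Defs
  imports "HOL-Probability.Probability"
begin

section \<open>Matrices\<close>

definition real_vec :: "int ^ 'n \<Rightarrow> real ^ 'n" where
  "real_vec v = (\<chi> i. real_of_int (v $ i))"

definition expanding :: "real ^ 'n ^ 'n \<Rightarrow> bool" where
  "expanding M \<longleftrightarrow>
     (\<forall>(z::complex) v. v \<noteq> 0 \<and> map_matrix complex_of_real M *v v = z *s v \<longrightarrow> cmod z > 1)"

text \<open>The type \<open>3\<close> is the ring of integers modulo 3.\<close>

definition mod3 :: "int ^ 'n ^ 'm \<Rightarrow> 3 ^ 'n ^ 'm" where
  "mod3 A = map_matrix of_int A"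

definition GL2_3 :: "(int ^ 2 ^ 2) set" where
  "GL2_3 = {A. invertible (mod3 A)}"


section \<open>Self-affine measures\<close>

definition affine_branch :: "real ^ 'n ^ 'n \<Rightarrow> real ^ 'n \<Rightarrow> real ^ 'n \<Rightarrow> real ^ 'n" where
  "affine_branch M d x = matrix_inv M *v (x + d)"

definition is_self_affine_measure ::
    "real ^ 'n ^ 'n \<Rightarrow> (real ^ 'n) set \<Rightarrow> (real ^ 'n) measure \<Rightarrow> bool" where
  "is_self_affine_measure M D \<mu> \<longleftrightarrow>
     prob_space \<mu> \<and> sets \<mu> = sets borel \<and>
     (\<forall>X \<in> sets borel.
        measure \<mu> X = 1 / real (card D) * (\<Sum>d\<in>D. measure \<mu> (affine_branch M d -` X)))"

definition self_affine_measure ::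
    "real ^ 'n ^ 'n \<Rightarrow> (real ^ 'n) set \<Rightarrow> (real ^ 'n) measure" where
  "self_affine_measure M D = (THE \<mu>. is_self_affine_measure M D \<mu>)"


section \<open>Spectral measures\<close>

text \<open>
  Elements of \<open>L\<^sup>2(\<mu>)\<close> are represented by square-integrable functions. An orthonormal basis is
  an orthonormal family whose finite linear combinations are dense.
\<close>

definition square_integrable :: "'a measure \<Rightarrow> ('a \<Rightarrow> complex) \<Rightarrow> bool" where
  "square_integrable \<mu> f \<longleftrightarrow>
     f \<in> borel_measurable \<mu> \<and> integrable \<mu> (\<lambda>x. (cmod (f x))\<^sup>2)"

definition L2_inner :: "'a measure \<Rightarrow> ('a \<Rightarrow> complex) \<Rightarrow> ('a \<Rightarrow> complex) \<Rightarrow> complex" where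
  "L2_inner \<mu> f g = (LINT x|\<mu>. f x * cnj (g x))"

definition L2_norm :: "'a measure \<Rightarrow> ('a \<Rightarrow> complex) \<Rightarrow> real" where
  "L2_norm \<mu> f = sqrt (LINT x|\<mu>. (cmod (f x))\<^sup>2)"

definition L2_orthonormal_basis ::
    "'a measure \<Rightarrow> 'i set \<Rightarrow> ('i \<Rightarrow> 'a \<Rightarrow> complex) \<Rightarrow> bool" where
  "L2_orthonormal_basis \<mu> I e \<longleftrightarrow>
     (\<forall>i\<in>I. square_integrable \<mu> (e i)) \<and>
     (\<forall>i\<in>I. \<forall>j\<in>I. L2_inner \<mu> (e i) (e j) = (if i = j then 1 else 0)) \<and>
     (\<forall>f. square_integrable \<mu> f \<longrightarrow>
        (\<forall>\<epsilon>>0. \<exists>F c. finite F \<and> F \<subseteq> I \<and>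
           L2_norm \<mu> (\<lambda>x. f x - (\<Sum>i\<in>F. c i * e i x)) < \<epsilon>))"

definition spectral_measure :: "(real ^ 'n) measure \<Rightarrow> bool" where
  "spectral_measure \<mu> \<longleftrightarrow>
     prob_space \<mu> \<and> sets \<mu> = sets borel \<and> (\<exists>K. compact K \<and> (AE x in \<mu>. x \<in> K)) \<and>
     (\<exists>\<Lambda>. countable \<Lambda> \<and>
        L2_orthonormal_basis \<mu> \<Lambda>
          (\<lambda>l x. exp (2 * complex_of_real pi * \<i> * complex_of_real (l \<bullet> x))))"


section \<open>Admissible pairs\<close>

definition unitary_on :: "'a set \<Rightarrow> 'b set \<Rightarrow> ('a \<Rightarrow> 'b \<Rightarrow> complex) \<Rightarrow> bool" where
  "unitary_on D S H \<longleftrightarrow>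
     (\<forall>d\<in>D. \<forall>d'\<in>D. (\<Sum>s\<in>S. H d s * cnj (H d' s)) = (if d = d' then 1 else 0)) \<and>
     (\<forall>s\<in>S. \<forall>s'\<in>S. (\<Sum>d\<in>D. cnj (H d s) * H d s') = (if s = s' then 1 else 0))"

definition admissible :: "int ^ 'n ^ 'n \<Rightarrow> (int ^ 'n) set \<Rightarrow> bool" where
  "admissible M D \<longleftrightarrow>
     (\<exists>S. finite S \<and> card S = card D \<and>
        unitary_on D S
          (\<lambda>d s. 1 / complex_of_real (sqrt (real (card S))) *
             exp (2 * complex_of_real pi * \<i> * complex_of_real
               ((matrix_inv (map_matrix real_of_int M) *v real_vec d) \<bullet> real_vec s))))"


section \<open>Inverses modulo 3\<close>

lemma mod3_mult: "mod3 (A ** B) = mod3 A ** mod3 B"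
  by (simp add: mod3_def map_matrix_def matrix_matrix_mult_def vec_eq_iff)

lemma of_int_mod3_eq_0_iff: "(of_int k :: 3) = 0 \<longleftrightarrow> 3 dvd k"
  using of_int_eq_0_iff_char_dvd [where 'a = 3, of k] by simp

text \<open>
  If 3 does not divide \<open>det B\<close>, then a matrix \<open>A\<close> with \<open>A B = I\<close> modulo 3 exists
  and is unique modulo 3, so conditions on \<open>A\<close> modulo 3 do not depend on its choice.
\<close>

lemma ex_inverse_mod3:
  fixes B :: "int ^ 2 ^ 2"
  assumes "\<not> 3 dvd det B"
  shows "\<exists>A \<in> GL2_3. mod3 (A ** B) = mat 1 \<and> mod3 (B ** A) = mat 1"
proof -
  define A where "A = (vector [vector [det B * B$2$2, - det B * B$1$2],
                               vector [- det B * B$2$1, det B * B$1$1]] :: int ^ 2 ^ 2)"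
  have "\<exists>k. d = 3 * k + 1 \<or> d = 3 * k + 2" if "\<not> 3 dvd d" for d :: int
    using that by presburger
  from this [OF assms] obtain k where "det B = 3 * k + 1 \<or> det B = 3 * k + 2"
    by blast
  then have "det B * det B - 1 = 3 * (3 * k * k + 2 * k) \<or>
      det B * det B - 1 = 3 * (3 * k * k + 4 * k + 1)"
    by (auto simp: algebra_simps)
  then have "3 dvd det B * det B - 1"
    by (metis dvd_triv_left)
  then have "of_int (det B * det B - 1) = (0::3)"
    by (simp only: of_int_mod3_eq_0_iff)
  then have d: "of_int (det B * det B) = (1::3)"
    by simp
  have AB: "A ** B = mat (det B * det B)" "B ** A = mat (det B * det B)"
    by (simp_all add: A_def matrix_matrix_mult_def mat_def vec_eq_iff forall_2 sum_2 vector_2 det_2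
        algebra_simps)
  have m: "mod3 (mat (det B * det B) :: int ^ 2 ^ 2) = mat 1"
    using d by (simp add: mod3_def mat_def vec_eq_iff)
  have 1: "mod3 (A ** B) = mat 1" "mod3 (B ** A) = mat 1"
    by (simp_all only: AB m)
  then have "A \<in> GL2_3"
    unfolding GL2_3_def invertible_def mod3_mult by blast
  with 1 show ?thesis by blast
qed

lemma inverse_mod3_unique:
  fixes B :: "int ^ 2 ^ 2"
  assumes "\<not> 3 dvd det B" "mod3 (A ** B) = mat 1" "mod3 (A' ** B) = mat 1"
  shows "mod3 A = mod3 A'"
  using ex_inverse_mod3 [OF assms(1)] assms(2,3)
  by (metis matrix_mul_assoc matrix_mul_lid matrix_mul_rid mod3_mult)

end

theory Submission
  imports Defs
begin

text \<open>
  Write \<open>R = M\<^sup>*\<close>, \<open>m(\<xi>) = (1/3) \<Sum>\<^bsub>d\<in>D\<^esub> e(d \<bullet> \<xi>)\<close> and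
  \<open>\<phi>(\<xi>) = \<Prod>\<^bsub>j\<ge>1\<^esub> m(R\<^sup>-\<^sup>j \<xi>)\<close>, the Fourier transform of the self-affine measure. A set
  \<open>\<Lambda>\<close> is a spectrum iff \<open>\<phi>\<close> vanishes on its nonzero differences and
  \<open>\<Sum>\<^bsub>\<lambda>\<in>\<Lambda>\<^esub> \<bar>\<phi>(\<xi> - \<lambda>)\<bar>\<^sup>2 = 1\<close> for all \<open>\<xi>\<close>. The zeros of \<open>m\<close> are the points with
  \<open>B\<^sup>*\<xi> \<in> \<plusminus>(1/3)(1, -1) + \<int>\<^sup>2\<close>. For such \<open>\<xi>\<close>, the vector
  \<open>3 (det B) \<xi>\<close> is integral and congruent modulo 3 to \<open>\<plusminus>u\<close>, where \<open>u\<close> is a multiple of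
  \<open>A\<^sup>*(1, -1)\<close> modulo 3; both (ii) and (iii) say \<open>R u \<equiv> 0 (mod 3)\<close>.

  If \<open>R u \<equiv> 0\<close>, there is an integer triple \<open>{0, s, -s}\<close> forming a Hadamard triple with \<open>D\<close>. All zeros of
  \<open>\<phi>\<close> lie in one lattice, so the points where \<open>\<phi>\<close> vanishes on a whole coset of the common periods are
  finite in number modulo periods; a counting argument shows that they would have \<open>\<bar>m\<bar> = 1\<close> along their
  whole \<open>R\<close>-orbit, hence be periods themselves, contradicting \<open>\<phi>(0) = 1\<close>. By compactness the digits of a
  spectrum can therefore be corrected by periods so that \<open>\<phi>\<close> stays bounded below on all tails.

  If \<open>R u \<noteq> 0\<close> modulo 3, either no \<open>R\<^sup>j u\<close> vanishes modulo 3, and orthogonal sets have at most 9 elements, or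
  \<open>R\<^sup>2 u \<equiv> 0\<close>. In all cases an orthogonal set is already orthogonal for a measure obtained by deleting some
  convolution factors, so that Bessel's inequality for that measure makes the Parseval sum too small.
\<close>

section \<open>Positive definite functions\<close>

text \<open>For sufficiency the obstacle is loss of mass in the limit. Finite sets of integer words
  are spectra of the partial products, but passing from a partial product to \<phi> multiplies each
  Parseval term by the squared modulus of a tail of the product, and tails at far away words may be
  arbitrarily small. What helps is that moving a word of length n by R^n times a period is invisible
  to the first n factors while it moves the tail. For necessity the number 2 comes from
  Cayley-Hamilton over the field with three elements: a vector killed by some power of R but not by
  R forces trace and determinant to vanish, so R^2 = 0. The reduced measures are never constructed.
  Bessel's inequality needs only a positive definite function, and deleting factors visibly
  preserves positive definiteness. Strictness is tested at the single point y with 3 b y = (1/2,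
  1/2): no \<open>R^-i y\<close> is a zero of m or a point with |m| = 1. The self-affine measure is
  specified by a definite description, so its existence and uniqueness are proved as well.\<close>

definition ee :: "real \<Rightarrow> complex" where
  "ee t = exp (2 * complex_of_real pi * \<i> * complex_of_real t)"

lemma ee_eq_cis: "ee t = cis (2 * pi * t)"
  by (simp add: ee_def cis_conv_exp mult_ac)

lemma ee_0 [simp]: "ee 0 = 1"
  and norm_ee [simp]: "cmod (ee t) = 1"
  and ee_add: "ee (s + t) = ee s * ee t"
  and ee_minus: "ee (- t) = cnj (ee t)"
  by (simp_all add: ee_eq_cis cis_mult ring_distribs cis_cnj)

lemma ee_diff: "ee (s - t) = ee s * cnj (ee t)"
  using ee_add [of s "- t"] by (simp add: ee_minus)

lemma ee_cnj_self [simp]: "ee t * cnj (ee t) = 1" "cnj (ee t) * ee t = 1"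
  using ee_diff [of t t] by (simp_all add: mult.commute)

lemma ee_eq_1_iff: "ee t = 1 \<longleftrightarrow> t \<in> \<int>"
proof -
  have "ee t = 1 \<longleftrightarrow> (\<exists>n::int. 2 * pi * t = of_int (2 * n) * pi)"
    by (simp add: ee_def exp_eq_1)
  also have "\<dots> \<longleftrightarrow> t \<in> \<int>"
    by (auto simp: Ints_def)
  finally show ?thesis .
qed

lemma continuous_on_ee [continuous_intros]:
  "continuous_on A f \<Longrightarrow> continuous_on A (\<lambda>x. ee (f x))"
  unfolding ee_def by (intro continuous_intros)

lemma measurable_ee [measurable]: "ee \<in> borel_measurable borel"
  by (intro borel_measurable_continuous_onI continuous_intros)

definition char_fun :: "'a::euclidean_space measure \<Rightarrow> 'a \<Rightarrow> complex" where
  "char_fun \<mu> x = (LINT y|\<mu>. ee (x \<bullet> y))"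

text \<open>Normalised and Hermitian, as for the Fourier transform of a probability measure. Working
  with such functions gives Bessel's inequality for modified products of masks without building
  measures for them.\<close>

definition positive_definite :: "('a::ab_group_add \<Rightarrow> complex) \<Rightarrow> bool" where
  "positive_definite \<psi> \<longleftrightarrow> \<psi> 0 = 1 \<and> (\<forall>x. \<psi> (- x) = cnj (\<psi> x)) \<and>
     (\<forall>F c. finite F \<longrightarrow> 0 \<le> Re (\<Sum>x\<in>F. \<Sum>y\<in>F. c x * cnj (c y) * \<psi> (x - y)))"

lemma positive_definite_nonneg:
  "positive_definite \<psi> \<Longrightarrow> finite F \<Longrightarrow> 0 \<le> Re (\<Sum>x\<in>F. \<Sum>y\<in>F. c x * cnj (c y) * \<psi> (x - y))"
  unfolding positive_definite_def by blast

definition orthogonal_under :: "('a::ab_group_add \<Rightarrow> complex) \<Rightarrow> 'a set \<Rightarrow> bool" where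
  "orthogonal_under \<psi> F \<longleftrightarrow> (\<forall>x\<in>F. \<forall>y\<in>F. x \<noteq> y \<longrightarrow> \<psi> (x - y) = 0)"

text \<open>For a Fourier transform \<psi> this is the squared distance between the exponential at
  \<xi> and a combination with coefficients \<open>d\<close>. Keeping \<open>d\<close> arbitrary
  serves both Bessel's inequality and the converse use of an orthonormal basis.\<close>

lemma quadratic_form_orthogonal:
  fixes \<psi> d :: "'a::ab_group_add \<Rightarrow> complex"
  assumes "\<psi> 0 = 1" "\<And>x. \<psi> (- x) = cnj (\<psi> x)" "finite F" "\<xi> \<notin> F" "orthogonal_under \<psi> F"
  defines "c \<equiv> \<lambda>x. if x = \<xi> then 1 else - d x"
  shows "(\<Sum>x\<in>insert \<xi> F. \<Sum>y\<in>insert \<xi> F. c x * cnj (c y) * \<psi> (x - y)) =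
     of_real (1 - (\<Sum>x\<in>F. (cmod (\<psi> (\<xi> - x)))\<^sup>2) + (\<Sum>x\<in>F. (cmod (d x - \<psi> (\<xi> - x)))\<^sup>2))"
proof -
  have c: "c \<xi> = 1" "x \<in> F \<Longrightarrow> c x = - d x" for x
    using assms(4) by (auto simp: c_def)
  have h: "\<psi> (x - \<xi>) = cnj (\<psi> (\<xi> - x))" for x
    using assms(2) [of "\<xi> - x"] by simp
  have dg: "(\<Sum>y\<in>F. d x * cnj (d y) * \<psi> (x - y)) = d x * cnj (d x)" if "x \<in> F" for x
  proof -
    have "(\<Sum>y\<in>F. d x * cnj (d y) * \<psi> (x - y)) = (\<Sum>y\<in>F. if y = x then d x * cnj (d x) else 0)"
      using assms(5) that by (intro sum.cong) (auto simp: orthogonal_under_def assms(1))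
    then show ?thesis using that assms(3) by simp
  qed
  have "(\<Sum>x\<in>insert \<xi> F. \<Sum>y\<in>insert \<xi> F. c x * cnj (c y) * \<psi> (x - y)) =
     (1 + (\<Sum>y\<in>F. c \<xi> * cnj (c y) * \<psi> (\<xi> - y))) +
     (\<Sum>x\<in>F. c x * cnj (c \<xi>) * \<psi> (x - \<xi>) + (\<Sum>y\<in>F. c x * cnj (c y) * \<psi> (x - y)))"
    using assms(3,4) by (simp add: c(1) assms(1))
  also have "\<dots> = (1 + (\<Sum>y\<in>F. - cnj (d y) * \<psi> (\<xi> - y))) +
     (\<Sum>x\<in>F. - d x * cnj (\<psi> (\<xi> - x)) + (\<Sum>y\<in>F. d x * cnj (d y) * \<psi> (x - y)))"
    unfolding h by (intro arg_cong2 [where f = "(+)"] sum.cong refl) (simp_all add: c)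
  also have "\<dots> = 1 + (\<Sum>x\<in>F. d x * cnj (d x) - cnj (d x) * \<psi> (\<xi> - x) - d x * cnj (\<psi> (\<xi> - x)))"
    by (simp add: dg sum.distrib sum_subtractf sum_negf)
  also have "\<dots> = 1 + (\<Sum>x\<in>F. of_real ((cmod (d x - \<psi> (\<xi> - x)))\<^sup>2) - of_real ((cmod (\<psi> (\<xi> - x)))\<^sup>2))"
    by (intro arg_cong2 [where f = "(+)"] sum.cong refl)
       (simp only: complex_norm_square, simp add: algebra_simps)
  finally show ?thesis
    by (simp add: sum_subtractf)
qed

lemma bessel:
  fixes \<psi> :: "'a::ab_group_add \<Rightarrow> complex"
  assumes "positive_definite \<psi>" "finite F" "orthogonal_under \<psi> F"
  shows "(\<Sum>x\<in>F. (cmod (\<psi> (\<xi> - x)))\<^sup>2) \<le> 1"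
proof (cases "\<xi> \<in> F")
  case True
  have "(\<Sum>x\<in>F. (cmod (\<psi> (\<xi> - x)))\<^sup>2) = (\<Sum>x\<in>F. if x = \<xi> then 1 else 0)"
    using assms True by (intro sum.cong) (auto simp: orthogonal_under_def positive_definite_def)
  then show ?thesis using True assms(2) by simp
next
  case False
  have p: "\<psi> 0 = 1" "\<And>x. \<psi> (- x) = cnj (\<psi> x)"
    using assms(1) by (auto simp: positive_definite_def)
  define c where "c = (\<lambda>x. if x = \<xi> then 1 else - \<psi> (\<xi> - x))"
  have "0 \<le> Re (\<Sum>x\<in>insert \<xi> F. \<Sum>y\<in>insert \<xi> F. c x * cnj (c y) * \<psi> (x - y))"
    using assms(1,2) unfolding positive_definite_def by blast
  then show ?thesis
    unfolding c_def quadratic_form_orthogonal [OF p assms(2) False assms(3)] by simp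
qed

lemma positive_definite_1: "positive_definite (\<lambda>x. 1)"
proof -
  have "(\<Sum>x\<in>F. \<Sum>y\<in>F. c x * cnj (c y)) = of_real ((cmod (sum c F))\<^sup>2)" for c :: "'a \<Rightarrow> complex" and F
    by (simp only: complex_norm_square sum_product cnj_sum)
  then show ?thesis
    by (simp add: positive_definite_def)
qed

lemma positive_definite_compose:
  fixes f :: "'b::ab_group_add \<Rightarrow> 'a::ab_group_add"
  assumes "positive_definite \<psi>" "inj f" "\<And>x y. f (x - y) = f x - f y"
  shows "positive_definite (\<lambda>x. \<psi> (f x))"
  unfolding positive_definite_def
proof (intro conjI allI impI)
  have f0: "f 0 = 0" using assms(3) [of 0 0] by simp
  then show "\<psi> (f 0) = 1" using assms(1) by (simp add: positive_definite_def)
  fix x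
  have "f (- x) = - f x" using assms(3) [of 0 x] f0 by simp
  then show "\<psi> (f (- x)) = cnj (\<psi> (f x))" using assms(1) by (simp add: positive_definite_def)
next
  fix F :: "'b set" and c assume "finite F"
  have "(\<Sum>x\<in>F. \<Sum>y\<in>F. c x * cnj (c y) * \<psi> (f (x - y))) =
    (\<Sum>x\<in>f ` F. \<Sum>y\<in>f ` F. c (inv f x) * cnj (c (inv f y)) * \<psi> (x - y))"
    using assms(2) by (simp add: sum.reindex inj_on_subset [OF assms(2)] assms(3))
  then show "0 \<le> Re (\<Sum>x\<in>F. \<Sum>y\<in>F. c x * cnj (c y) * \<psi> (f (x - y)))"
    using positive_definite_nonneg [OF assms(1) finite_imageI [OF \<open>finite F\<close>]] by simp
qed

definition mask :: "'a::real_inner set \<Rightarrow> 'a \<Rightarrow> complex" where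
  "mask D x = (\<Sum>d\<in>D. ee (d \<bullet> x)) / of_nat (card D)"

text \<open>Multiplying by the mask is convolving with the uniform measure on \<open>D\<close>. Each
  character of \<open>d\<close> is absorbed into the coefficients, which leaves an average of
  quadratic forms of \<psi>.\<close>

lemma positive_definite_mask_mult:
  assumes "positive_definite \<psi>" "finite D" "D \<noteq> {}"
  shows "positive_definite (\<lambda>x. mask D x * \<psi> x)"
  unfolding positive_definite_def
proof (intro conjI allI impI)
  show "mask D 0 * \<psi> 0 = 1" using assms by (simp add: positive_definite_def mask_def)
  show "mask D (- x) * \<psi> (- x) = cnj (mask D x * \<psi> x)" for x
    using assms(1) by (simp add: positive_definite_def mask_def ee_minus)
  fix F c assume F: "finite (F::'a set)"
  have "(\<Sum>x\<in>F. \<Sum>y\<in>F. c x * cnj (c y) * (mask D (x - y) * \<psi> (x - y))) =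
    (\<Sum>x\<in>F. \<Sum>y\<in>F. \<Sum>d\<in>D. (c x * ee (d \<bullet> x)) * cnj (c y * ee (d \<bullet> y)) * \<psi> (x - y)) / of_nat (card D)"
    unfolding mask_def sum_divide_distrib sum_distrib_left sum_distrib_right
    by (intro sum.cong refl) (simp add: inner_diff_right ee_diff mult_ac)
  also have "(\<Sum>x\<in>F. \<Sum>y\<in>F. \<Sum>d\<in>D. (c x * ee (d \<bullet> x)) * cnj (c y * ee (d \<bullet> y)) * \<psi> (x - y)) =
    (\<Sum>x\<in>F. \<Sum>d\<in>D. \<Sum>y\<in>F. (c x * ee (d \<bullet> x)) * cnj (c y * ee (d \<bullet> y)) * \<psi> (x - y))"
    by (intro sum.cong refl sum.swap)
  also have "\<dots> = (\<Sum>d\<in>D. \<Sum>x\<in>F. \<Sum>y\<in>F. (c x * ee (d \<bullet> x)) * cnj (c y * ee (d \<bullet> y)) * \<psi> (x - y))"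
    by (rule sum.swap)
  finally have *: "(\<Sum>x\<in>F. \<Sum>y\<in>F. c x * cnj (c y) * (mask D (x - y) * \<psi> (x - y))) =
    (\<Sum>d\<in>D. \<Sum>x\<in>F. \<Sum>y\<in>F. (c x * ee (d \<bullet> x)) * cnj (c y * ee (d \<bullet> y)) * \<psi> (x - y)) / of_nat (card D)" .
  have "0 \<le> Re (\<Sum>x\<in>F. \<Sum>y\<in>F. (c x * ee (d \<bullet> x)) * cnj (c y * ee (d \<bullet> y)) * \<psi> (x - y))" for d
    by (rule positive_definite_nonneg [OF assms(1) F])
  then show "0 \<le> Re (\<Sum>x\<in>F. \<Sum>y\<in>F. c x * cnj (c y) * (mask D (x - y) * \<psi> (x - y)))"
    unfolding * Re_divide_of_nat
    by (subst Re_sum) (intro divide_nonneg_nonneg sum_nonneg, simp_all only: of_nat_0_le_iff)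
qed

section \<open>Fourier transforms of Borel probability measures\<close>

locale borel_prob = prob_space \<mu> for \<mu> :: "'a::euclidean_space measure" +
  assumes sets_borel [simp, measurable_cong]: "sets \<mu> = sets borel"
begin

lemma space_UNIV [simp]: "space \<mu> = UNIV"
  using sets_eq_imp_space_eq [OF sets_borel] by simp

lemma prob_UNIV: "prob UNIV = 1"
  using prob_space by simp

lemma integrable_ee [simp]: "integrable \<mu> (\<lambda>y. ee (x \<bullet> y))"
  by (rule integrable_const_bound [where B = 1]) (auto intro!: measurable_compose [OF _ measurable_ee])

lemma L2_inner_ee: "L2_inner \<mu> (\<lambda>y. ee (k \<bullet> y)) (\<lambda>y. ee (l \<bullet> y)) = char_fun \<mu> (k - l)"
  unfolding L2_inner_def char_fun_def by (simp add: ee_diff inner_diff_left)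

lemma integral_trig_poly_square:
  assumes "finite F"
  shows "complex_of_real (LINT y|\<mu>. (cmod (\<Sum>x\<in>F. c x * ee (x \<bullet> y)))\<^sup>2) =
    (\<Sum>x\<in>F. \<Sum>x'\<in>F. c x * cnj (c x') * char_fun \<mu> (x - x'))"
proof -
  have "complex_of_real ((cmod (\<Sum>x\<in>F. c x * ee (x \<bullet> y)))\<^sup>2) =
     (\<Sum>x\<in>F. \<Sum>x'\<in>F. c x * cnj (c x') * ee ((x - x') \<bullet> y))" for y
    unfolding complex_norm_square cnj_sum sum_product
    by (intro sum.cong refl) (simp add: inner_diff_left ee_diff mult_ac)
  then have "complex_of_real (LINT y|\<mu>. (cmod (\<Sum>x\<in>F. c x * ee (x \<bullet> y)))\<^sup>2) =
     (LINT y|\<mu>. (\<Sum>x\<in>F. \<Sum>x'\<in>F. c x * cnj (c x') * ee ((x - x') \<bullet> y)))"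
    by (simp flip: integral_complex_of_real)
  also have "\<dots> = (\<Sum>x\<in>F. \<Sum>x'\<in>F. c x * cnj (c x') * char_fun \<mu> (x - x'))"
    unfolding char_fun_def by (subst Bochner_Integration.integral_sum; auto)+
  finally show ?thesis .
qed

lemma char_fun_0 [simp]: "char_fun \<mu> 0 = 1"
  by (simp add: char_fun_def prob_UNIV)

lemma char_fun_minus: "char_fun \<mu> (- x) = cnj (char_fun \<mu> x)"
  by (simp add: char_fun_def ee_minus)

lemma norm_char_fun_le_1: "cmod (char_fun \<mu> x) \<le> 1"
proof -
  have "cmod (char_fun \<mu> x) \<le> (LINT y|\<mu>. cmod (ee (x \<bullet> y)))"
    unfolding char_fun_def by (rule integral_norm_bound)
  then show ?thesis by (simp add: prob_UNIV)
qed

lemma continuous_on_char_fun: "continuous_on A (char_fun \<mu>)"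
proof -
  have "isCont (char_fun \<mu>) x" for x
    unfolding char_fun_def continuous_at_sequentially comp_def
  proof (intro allI impI integral_dominated_convergence [where w = "\<lambda>_. 1"])
    fix X assume X: "X \<longlonglongrightarrow> x"
    have "isCont ee t" for t
      using continuous_on_ee [of UNIV "\<lambda>x. x"] by (simp add: continuous_on_eq_continuous_at)
    then show "AE y in \<mu>. (\<lambda>i. ee (X i \<bullet> y)) \<longlonglongrightarrow> ee (x \<bullet> y)"
      by (intro AE_I2 isCont_tendsto_compose [of _ ee] tendsto_intros X)
  qed (auto intro!: measurable_compose [OF _ measurable_ee])
  then show ?thesis
    by (simp add: continuous_at_imp_continuous_on)
qed

lemma positive_definite_char_fun: "positive_definite (char_fun \<mu>)"
  unfolding positive_definite_def
  by (auto simp: char_fun_minus integral_trig_poly_square [symmetric])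

text \<open>The error is the Bessel defect plus the deviation of \<open>d\<close> from the Fourier
  coefficients. Equality of the two proves completeness from Parseval; dropping the second sum
  proves Parseval from completeness.\<close>

lemma L2_norm_ee_diff:
  assumes "finite F" "\<xi> \<notin> F" "orthogonal_under (char_fun \<mu>) F"
  shows "(L2_norm \<mu> (\<lambda>y. ee (\<xi> \<bullet> y) - (\<Sum>x\<in>F. d x * ee (x \<bullet> y))))\<^sup>2 =
    1 - (\<Sum>x\<in>F. (cmod (char_fun \<mu> (\<xi> - x)))\<^sup>2) + (\<Sum>x\<in>F. (cmod (d x - char_fun \<mu> (\<xi> - x)))\<^sup>2)"
proof -
  define c where "c = (\<lambda>x. if x = \<xi> then 1 else - d x)"
  have "ee (\<xi> \<bullet> y) - (\<Sum>x\<in>F. d x * ee (x \<bullet> y)) = (\<Sum>x\<in>insert \<xi> F. c x * ee (x \<bullet> y))" for y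
  proof -
    have "(\<Sum>x\<in>F. c x * ee (x \<bullet> y)) = (\<Sum>x\<in>F. - (d x * ee (x \<bullet> y)))"
      using assms(2) by (intro sum.cong) (auto simp: c_def)
    then show ?thesis using assms(1,2) by (simp add: sum_negf c_def)
  qed
  then have "complex_of_real ((L2_norm \<mu> (\<lambda>y. ee (\<xi> \<bullet> y) - (\<Sum>x\<in>F. d x * ee (x \<bullet> y))))\<^sup>2) =
     complex_of_real (LINT y|\<mu>. (cmod (\<Sum>x\<in>insert \<xi> F. c x * ee (x \<bullet> y)))\<^sup>2)"
    by (simp add: L2_norm_def)
  also have "\<dots> = of_real (1 - (\<Sum>x\<in>F. (cmod (char_fun \<mu> (\<xi> - x)))\<^sup>2) + (\<Sum>x\<in>F. (cmod (d x - char_fun \<mu> (\<xi> - x)))\<^sup>2))"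
    unfolding integral_trig_poly_square [OF finite.insertI [OF assms(1)]] c_def
    by (rule quadratic_form_orthogonal) (auto simp: char_fun_minus assms)
  finally show ?thesis
    by (simp only: of_real_eq_iff)
qed

end

section \<open>Trigonometric polynomials in \<open>L\<^sup>2\<close>\<close>

lemma power2_cmod_add_le: "(cmod (a + b))\<^sup>2 \<le> 2 * (cmod a)\<^sup>2 + 2 * (cmod b)\<^sup>2"
proof -
  have "(cmod (a + b))\<^sup>2 \<le> (cmod a + cmod b)\<^sup>2"
    by (intro power_mono norm_triangle_ineq) simp
  also have "\<dots> \<le> 2 * (cmod a)\<^sup>2 + 2 * (cmod b)\<^sup>2"
    using zero_le_power2 [of "cmod a - cmod b"] by (simp add: power2_eq_square algebra_simps)
  finally show ?thesis .
qed

lemma square_integrable_add: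
  assumes "square_integrable \<mu> f" "square_integrable \<mu> g"
  shows "square_integrable \<mu> (\<lambda>x. f x + g x)"
proof -
  have [measurable]: "f \<in> borel_measurable \<mu>" "g \<in> borel_measurable \<mu>"
    using assms by (auto simp: square_integrable_def)
  have "integrable \<mu> (\<lambda>x. 2 * (cmod (f x))\<^sup>2 + 2 * (cmod (g x))\<^sup>2)"
    using assms by (auto simp: square_integrable_def)
  then have "integrable \<mu> (\<lambda>x. (cmod (f x + g x))\<^sup>2)"
    by (rule Bochner_Integration.integrable_bound) (auto intro!: AE_I2 order_trans [OF power2_cmod_add_le])
  then show ?thesis by (simp add: square_integrable_def)
qed

lemma square_integrable_cmult:
  "square_integrable \<mu> f \<Longrightarrow> square_integrable \<mu> (\<lambda>x. c * f x)"
  by (auto simp: square_integrable_def norm_mult power_mult_distrib)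

lemma square_integrable_diff:
  "square_integrable \<mu> f \<Longrightarrow> square_integrable \<mu> g \<Longrightarrow> square_integrable \<mu> (\<lambda>x. f x - g x)"
  using square_integrable_add [OF _ square_integrable_cmult [of _ _ "-1"]] by fastforce

lemma square_integrable_sum:
  assumes "\<And>i. i \<in> I \<Longrightarrow> square_integrable \<mu> (f i)"
  shows "square_integrable \<mu> (\<lambda>x. \<Sum>i\<in>I. f i x)"
  using assms
proof (induction I rule: infinite_finite_induct)
  case (insert i I)
  then show ?case using square_integrable_add [of \<mu> "f i"] by simp
qed (auto simp: square_integrable_def)

lemma (in finite_measure) square_integrable_bounded:
  assumes "f \<in> borel_measurable M" "\<And>x. x \<in> space M \<Longrightarrow> cmod (f x) \<le> B"
  shows "square_integrable M f"
  unfolding square_integrable_def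
  using assms by (intro conjI integrable_const_bound [where B = "B\<^sup>2"]) (auto intro!: AE_I2 power_mono)

lemma cutoff_tendsto_indicator:
  assumes "closed C" "C \<noteq> {}"
  shows "(\<lambda>n. max 0 (1 - real n * infdist x C)) \<longlonglongrightarrow> indicator C x"
proof (cases "x \<in> C")
  case False
  then have "infdist x C > 0"
    using infdist_pos_not_in_closed assms by blast
  then obtain n0 where n0: "1 < real n0 * infdist x C"
    using reals_Archimedean3 by blast
  have "max 0 (1 - real n * infdist x C) = 0" if "n \<ge> n0" for n
  proof -
    have "real n0 * infdist x C \<le> real n * infdist x C"
      using that by (intro mult_right_mono) (auto simp: infdist_nonneg)
    then show ?thesis using n0 by simp
  qed
  then show ?thesis
    using False by (intro tendsto_eventually) (auto simp: eventually_sequentially)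
qed simp

lemma sin_eq_imp_eq:
  assumes "\<bar>x\<bar> \<le> pi / 2" "\<bar>y\<bar> \<le> pi / 2" "sin x = sin y"
  shows "x = y"
  using sin_inj_pi [of x y] assms by (auto simp: abs_le_iff)

lemma continuous_approx_trig_poly:
  fixes f :: "'a::euclidean_space \<Rightarrow> real"
  assumes "compact K" "continuous_on K f" "0 < \<epsilon>"
  shows "\<exists>F c. finite F \<and> (\<forall>x\<in>K. cmod (of_real (f x) - (\<Sum>l\<in>F. c l * ee (l \<bullet> x))) < \<epsilon>)"
proof -
  define T where "T = {g :: 'a \<Rightarrow> real. \<exists>F c. finite F \<and> (\<forall>x. of_real (g x) = (\<Sum>l\<in>F. c l * ee (l \<bullet> x)))}"
  \<comment> \<open>Frequencies may repeat here; equal ones are merged by summing over the fibres of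
    \<open>l\<close>. This allows sums and products to be indexed by disjoint unions and
    pairs.\<close>
  have T_I: "g \<in> T" if "finite I" "\<And>x. of_real (g x) = (\<Sum>i\<in>I. c i * ee (l i \<bullet> x))" for g c l and I :: "'i set"
  proof -
    have "of_real (g x) = (\<Sum>k\<in>l ` I. (\<Sum>i\<in>{i\<in>I. l i = k}. c i) * ee (k \<bullet> x))" for x
    proof -
      have "of_real (g x) = (\<Sum>k\<in>l ` I. \<Sum>i\<in>{i\<in>I. l i = k}. c i * ee (l i \<bullet> x))"
        unfolding that(2) using that(1) by (intro sum.group [symmetric]) auto
      then show ?thesis
        unfolding sum_distrib_right by (auto intro: sum.cong)
    qed
    then show ?thesis
      unfolding T_def mem_Collect_eq
      by (intro exI [of _ "l ` I"] exI [of _ "\<lambda>k. \<Sum>i\<in>{i\<in>I. l i = k}. c i"] conjI allI finite_imageI that(1))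
  qed
  obtain r where r: "r > 0" "\<And>x. x \<in> K \<Longrightarrow> norm x \<le> r"
    using compact_imp_bounded [OF assms(1)] by (auto simp: bounded_pos)
  have sin_T: "(\<lambda>x. sin (2 * pi * (l \<bullet> x))) \<in> T" for l :: 'a
  proof (rule T_I [of "{True, False}" _ "\<lambda>b. if b then - \<i> / 2 else \<i> / 2" "\<lambda>b. if b then l else - l"])
    fix x
    have "complex_of_real (Im z) = - \<i> / 2 * z + \<i> / 2 * cnj z" for z
      by (simp add: complex_eq_iff)
    moreover have "sin (2 * pi * (l \<bullet> x)) = Im (ee (l \<bullet> x))"
      by (simp add: ee_eq_cis)
    moreover have "ee (- l \<bullet> x) = cnj (ee (l \<bullet> x))"
      by (simp add: ee_minus)
    moreover have "(\<Sum>b\<in>{True, False}. h b) = h True + h False" for h :: "bool \<Rightarrow> complex"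
      by simp
    ultimately show "of_real (sin (2 * pi * (l \<bullet> x))) =
      (\<Sum>b\<in>{True, False}. (if b then - \<i> / 2 else \<i> / 2) * ee ((if b then l else - l) \<bullet> x))"
      by (simp only: if_True if_False)
  qed simp
  have "function_ring_on T K"
  proof
    fix f g assume fg: "f \<in> T" "g \<in> T"
    obtain F c where F: "finite F" "\<And>x. of_real (f x) = (\<Sum>l\<in>F. c l * ee (l \<bullet> x))"
      using fg unfolding T_def by blast
    obtain G d where G: "finite G" "\<And>x. of_real (g x) = (\<Sum>l\<in>G. d l * ee (l \<bullet> x))"
      using fg unfolding T_def by blast
    show "(\<lambda>x. f x + g x) \<in> T"
    proof (rule T_I)
      show "finite (F <+> G)" using F G by simp
      show "of_real (f x + g x) = (\<Sum>i\<in>F <+> G. case_sum c d i * ee (case_sum id id i \<bullet> x))" for x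
        by (simp add: F G sum.Plus)
    qed
    show "(\<lambda>x. f x * g x) \<in> T"
    proof (rule T_I)
      show "finite (F \<times> G)" using F G by simp
      show "of_real (f x * g x) = (\<Sum>i\<in>F \<times> G. (c (fst i) * d (snd i)) * ee ((fst i + snd i) \<bullet> x))" for x
        by (simp add: F G sum_product sum.cartesian_product case_prod_unfold inner_add_left ee_add mult_ac)
    qed
  next
    fix f assume "f \<in> T"
    then obtain F c where F: "finite F" "\<And>x. of_real (f x) = (\<Sum>l\<in>F. c l * ee (l \<bullet> x))"
      unfolding T_def by blast
    then have "f = (\<lambda>x. Re (\<Sum>l\<in>F. c l * ee (l \<bullet> x)))"
      by (metis Re_complex_of_real)
    then show "continuous_on K f"
      by (simp only:) (intro continuous_intros)
  next
    fix x y assume xy: "x \<in> K" "y \<in> K" "x \<noteq> y"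
    then obtain b :: 'a where b: "b \<in> Basis" "b \<bullet> x \<noteq> b \<bullet> y"
      by (metis euclidean_eqI inner_commute)
    \<comment> \<open>The factor 1/(4r) keeps 2 pi (l \<bullet> z) within [-pi/2, pi/2] on
      \<open>K\<close>, where the sine is injective and so separates points.\<close>
    define l where "l = (1 / (4 * r)) *\<^sub>R b"
    have bd: "\<bar>2 * pi * (l \<bullet> z)\<bar> \<le> pi / 2" if "z \<in> K" for z
    proof -
      have "\<bar>b \<bullet> z\<bar> \<le> r"
        using Basis_le_norm [OF b(1), of z] r(2) [OF that] by (simp add: inner_commute)
      then have "\<bar>b \<bullet> z\<bar> / r \<le> 1" using r(1) by simp
      then have "\<bar>b \<bullet> z\<bar> / r * (pi / 2) \<le> 1 * (pi / 2)" by (intro mult_right_mono) auto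
      then show ?thesis
        using r(1) by (simp add: l_def abs_mult field_simps)
    qed
    have "2 * pi * (l \<bullet> x) \<noteq> 2 * pi * (l \<bullet> y)"
      using b(2) r(1) by (simp add: l_def)
    then show "\<exists>f\<in>T. f x \<noteq> f y"
      using sin_T [of l] sin_eq_imp_eq [OF bd [OF xy(1)] bd [OF xy(2)]]
      by (intro bexI [of _ "\<lambda>x. sin (2 * pi * (l \<bullet> x))"]) auto
  next
    show "(\<lambda>_. c) \<in> T" for c
      by (rule T_I [of "{()}" _ "\<lambda>_. of_real c" "\<lambda>_. 0"]) auto
  qed fact
  then interpret function_ring_on T K .
  obtain g where g: "g \<in> T" "\<forall>x\<in>K. \<bar>f x - g x\<bar> < \<epsilon>"
    using Stone_Weierstrass_basic [OF assms(2,3)] by blast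
  obtain F c where F: "finite F" "\<And>x. of_real (g x) = (\<Sum>l\<in>F. c l * ee (l \<bullet> x))"
    using g(1) unfolding T_def by blast
  have "cmod (of_real (f x) - of_real (g x)) < \<epsilon>" if "x \<in> K" for x
    using g(2) that by (metis norm_of_real of_real_diff)
  then show ?thesis
    unfolding F(2) using F(1) by blast
qed

context borel_prob
begin

text \<open>Membership in the closed span of the exponentials of \<Lambda>. Squared distances avoid
  square roots; the price is the factor 2 in the triangle inequality, which explains the quarters of
  \<epsilon> below.\<close>

definition L2_approximable :: "'a set \<Rightarrow> ('a \<Rightarrow> complex) \<Rightarrow> bool" where
  "L2_approximable \<Lambda> f \<longleftrightarrow> square_integrable \<mu> f \<and>
     (\<forall>\<epsilon>>0. \<exists>F c. finite F \<and> F \<subseteq> \<Lambda> \<and> (LINT y|\<mu>. (cmod (f y - (\<Sum>l\<in>F. c l * ee (l \<bullet> y))))\<^sup>2) < \<epsilon>)"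

lemma L2_approximableE:
  assumes "L2_approximable \<Lambda> f" "\<epsilon> > 0"
  obtains F c where "finite F" "F \<subseteq> \<Lambda>" "(LINT y|\<mu>. (cmod (f y - (\<Sum>l\<in>F. c l * ee (l \<bullet> y))))\<^sup>2) < \<epsilon>"
  using assms unfolding L2_approximable_def by blast

lemma square_integrable_ee: "square_integrable \<mu> (\<lambda>y. ee (l \<bullet> y))"
  by (rule square_integrable_bounded [where B = 1]) (auto intro!: measurable_compose [OF _ measurable_ee])

lemma square_integrable_trig_poly: "square_integrable \<mu> (\<lambda>y. \<Sum>l\<in>F. c l * ee (l \<bullet> y))"
  by (intro square_integrable_sum square_integrable_cmult square_integrable_ee)

lemma integrable_L2: "square_integrable \<mu> f \<Longrightarrow> integrable \<mu> (\<lambda>x. (cmod (f x))\<^sup>2)"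
  by (simp add: square_integrable_def)

lemma L2_square_triangle:
  assumes "square_integrable \<mu> f" "square_integrable \<mu> g"
  shows "(LINT x|\<mu>. (cmod (f x + g x))\<^sup>2) \<le> 2 * (LINT x|\<mu>. (cmod (f x))\<^sup>2) + 2 * (LINT x|\<mu>. (cmod (g x))\<^sup>2)"
proof -
  have "(LINT x|\<mu>. (cmod (f x + g x))\<^sup>2) \<le> (LINT x|\<mu>. 2 * (cmod (f x))\<^sup>2 + 2 * (cmod (g x))\<^sup>2)"
    using assms by (intro integral_mono integrable_L2 square_integrable_add power2_cmod_add_le
        Bochner_Integration.integrable_add integrable_mult_right)
  then show ?thesis
    using assms by (simp add: integrable_L2)
qed

lemma L2_approximable_limit:
  assumes "square_integrable \<mu> f"
    and "\<And>\<epsilon>. \<epsilon> > 0 \<Longrightarrow> \<exists>g. L2_approximable \<Lambda> g \<and> (LINT y|\<mu>. (cmod (f y - g y))\<^sup>2) < \<epsilon>"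
  shows "L2_approximable \<Lambda> f"
  unfolding L2_approximable_def
proof (intro conjI allI impI assms(1))
  fix \<epsilon> :: real assume "\<epsilon> > 0"
  then obtain g where g: "L2_approximable \<Lambda> g" "(LINT y|\<mu>. (cmod (f y - g y))\<^sup>2) < \<epsilon> / 4"
    using assms(2) [of "\<epsilon> / 4"] by auto
  have e4: "\<epsilon> / 4 > 0" using \<open>\<epsilon> > 0\<close> by simp
  obtain F c where F: "finite F" "F \<subseteq> \<Lambda>"
    "(LINT y|\<mu>. (cmod (g y - (\<Sum>l\<in>F. c l * ee (l \<bullet> y))))\<^sup>2) < \<epsilon> / 4"
    by (rule L2_approximableE [OF g(1) e4])
  have sg: "square_integrable \<mu> g" using g by (simp add: L2_approximable_def)
  have "(LINT y|\<mu>. (cmod (f y - (\<Sum>l\<in>F. c l * ee (l \<bullet> y))))\<^sup>2) =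
    (LINT y|\<mu>. (cmod ((f y - g y) + (g y - (\<Sum>l\<in>F. c l * ee (l \<bullet> y)))))\<^sup>2)"
    by simp
  also have "\<dots> < \<epsilon>"
    using L2_square_triangle [OF square_integrable_diff [OF assms(1) sg]
        square_integrable_diff [OF sg square_integrable_trig_poly [of c F]]] g(2) F(3) by linarith
  finally show "\<exists>F c. finite F \<and> F \<subseteq> \<Lambda> \<and> (LINT y|\<mu>. (cmod (f y - (\<Sum>l\<in>F. c l * ee (l \<bullet> y))))\<^sup>2) < \<epsilon>"
    using F by blast
qed

text \<open>Dominated convergence: the differences are at most 2w in modulus, so 4w^2 dominates
  their squares.\<close>

lemma L2_approximable_lim:
  assumes f: "f \<in> borel_measurable \<mu>" and g: "\<And>n. L2_approximable \<Lambda> (g n)"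
    and lim: "\<And>x. (\<lambda>n. g n x) \<longlonglongrightarrow> f x" and bound: "\<And>n x. cmod (g n x) \<le> w x"
    and w: "integrable \<mu> (\<lambda>x. (w x)\<^sup>2)"
  shows "L2_approximable \<Lambda> f"
proof -
  have [measurable]: "g n \<in> borel_measurable \<mu>" for n
    using g by (simp add: L2_approximable_def square_integrable_def)
  note f [measurable]
  have fw: "cmod (f x) \<le> w x" for x
    using lim [of x] bound by (intro LIMSEQ_le_const2 [OF tendsto_norm]) auto
  have w0: "0 \<le> w x" for x using fw norm_ge_zero order_trans by blast
  have f2: "square_integrable \<mu> f"
    unfolding square_integrable_def
    using fw w0 by (intro conjI f Bochner_Integration.integrable_bound [OF w]) (auto intro!: AE_I2 power_mono)
  have "(\<lambda>n. LINT x|\<mu>. (cmod (f x - g n x))\<^sup>2) \<longlonglongrightarrow> (LINT x|\<mu>. 0)"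
  proof (rule integral_dominated_convergence [where w = "\<lambda>x. 4 * (w x)\<^sup>2"])
    have "(\<lambda>n. (cmod (f x - g n x))\<^sup>2) \<longlonglongrightarrow> (cmod (f x - f x))\<^sup>2" for x
      by (intro tendsto_intros lim)
    then show "AE x in \<mu>. (\<lambda>n. (cmod (f x - g n x))\<^sup>2) \<longlonglongrightarrow> 0"
      by simp
    show "AE x in \<mu>. norm ((cmod (f x - g n x))\<^sup>2) \<le> 4 * (w x)\<^sup>2" for n
    proof (rule AE_I2)
      fix x
      have "cmod (f x - g n x) \<le> 2 * w x"
        using norm_triangle_ineq4 [of "f x" "g n x"] fw [of x] bound [of n x] by linarith
      then have "(cmod (f x - g n x))\<^sup>2 \<le> (2 * w x)\<^sup>2" by (intro power_mono) auto
      then show "norm ((cmod (f x - g n x))\<^sup>2) \<le> 4 * (w x)\<^sup>2" by (simp add: power_mult_distrib)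
    qed
  qed (use w in auto)
  then have l0: "(\<lambda>n. LINT x|\<mu>. (cmod (f x - g n x))\<^sup>2) \<longlonglongrightarrow> 0" by simp
  show ?thesis
  proof (rule L2_approximable_limit [OF f2])
    fix \<epsilon> :: real assume "\<epsilon> > 0"
    then have "\<forall>\<^sub>F n in sequentially. (LINT x|\<mu>. (cmod (f x - g n x))\<^sup>2) < \<epsilon>"
      using l0 order_tendstoD(2) by blast
    then show "\<exists>g. L2_approximable \<Lambda> g \<and> (LINT y|\<mu>. (cmod (f y - g y))\<^sup>2) < \<epsilon>"
      using g by (auto simp: eventually_sequentially)
  qed
qed

lemma L2_approximable_cmult:
  assumes "L2_approximable \<Lambda> f"
  shows "L2_approximable \<Lambda> (\<lambda>x. a * f x)"
  unfolding L2_approximable_def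
proof (intro conjI allI impI)
  show "square_integrable \<mu> (\<lambda>x. a * f x)"
    using assms by (simp add: L2_approximable_def square_integrable_cmult)
  fix \<epsilon> :: real assume "\<epsilon> > 0"
  have p: "\<epsilon> / ((cmod a)\<^sup>2 + 1) > 0" using \<open>\<epsilon> > 0\<close> by (simp add: add_nonneg_pos)
  obtain F c where F: "finite F" "F \<subseteq> \<Lambda>"
    "(LINT y|\<mu>. (cmod (f y - (\<Sum>l\<in>F. c l * ee (l \<bullet> y))))\<^sup>2) < \<epsilon> / ((cmod a)\<^sup>2 + 1)" (is "?I < _")
    by (rule L2_approximableE [OF assms p])
  have "a * f y - (\<Sum>l\<in>F. (a * c l) * ee (l \<bullet> y)) = a * (f y - (\<Sum>l\<in>F. c l * ee (l \<bullet> y)))" for y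
    by (simp add: sum_distrib_left algebra_simps)
  then have "(LINT y|\<mu>. (cmod (a * f y - (\<Sum>l\<in>F. (a * c l) * ee (l \<bullet> y))))\<^sup>2) = (cmod a)\<^sup>2 * ?I"
    by (simp add: norm_mult power_mult_distrib)
  also have "\<dots> \<le> ((cmod a)\<^sup>2 + 1) * ?I"
    by (intro mult_right_mono) auto
  also have "\<dots> < \<epsilon>"
    using F(3) by (simp add: pos_less_divide_eq add_nonneg_pos mult.commute)
  finally show "\<exists>F c. finite F \<and> F \<subseteq> \<Lambda> \<and> (LINT y|\<mu>. (cmod (a * f y - (\<Sum>l\<in>F. c l * ee (l \<bullet> y))))\<^sup>2) < \<epsilon>"
    using F(1,2) by (intro exI [of _ F] exI [of _ "\<lambda>l. a * c l"]) auto
qed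

lemma L2_approximable_add:
  assumes "L2_approximable \<Lambda> f" "L2_approximable \<Lambda> g"
  shows "L2_approximable \<Lambda> (\<lambda>x. f x + g x)"
  unfolding L2_approximable_def
proof (intro conjI allI impI)
  have sq: "square_integrable \<mu> f" "square_integrable \<mu> g"
    using assms by (auto simp: L2_approximable_def)
  then show "square_integrable \<mu> (\<lambda>x. f x + g x)"
    by (rule square_integrable_add)
  fix \<epsilon> :: real assume "\<epsilon> > 0"
  then have e4: "\<epsilon> / 4 > 0" by simp
  obtain F c where F: "finite F" "F \<subseteq> \<Lambda>"
    "(LINT y|\<mu>. (cmod (f y - (\<Sum>l\<in>F. c l * ee (l \<bullet> y))))\<^sup>2) < \<epsilon> / 4"
    by (rule L2_approximableE [OF assms(1) e4])
  obtain G d where G: "finite G" "G \<subseteq> \<Lambda>"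
    "(LINT y|\<mu>. (cmod (g y - (\<Sum>l\<in>G. d l * ee (l \<bullet> y))))\<^sup>2) < \<epsilon> / 4"
    by (rule L2_approximableE [OF assms(2) e4])
  define c' where "c' l = (if l \<in> F then c l else 0) + (if l \<in> G then d l else 0)" for l
  have "(\<Sum>l\<in>F \<union> G. c' l * ee (l \<bullet> y)) = (\<Sum>l\<in>F. c l * ee (l \<bullet> y)) + (\<Sum>l\<in>G. d l * ee (l \<bullet> y))" for y
  proof -
    have "(\<Sum>l\<in>F \<union> G. c' l * ee (l \<bullet> y)) =
      (\<Sum>l\<in>F \<union> G. if l \<in> F then c l * ee (l \<bullet> y) else 0) + (\<Sum>l\<in>F \<union> G. if l \<in> G then d l * ee (l \<bullet> y) else 0)"
      unfolding c'_def sum.distrib [symmetric] by (intro sum.cong) (auto simp: algebra_simps)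
    also have "(\<Sum>l\<in>F \<union> G. if l \<in> F then c l * ee (l \<bullet> y) else 0) = (\<Sum>l\<in>F. c l * ee (l \<bullet> y))"
      using F G by (intro sum.mono_neutral_cong_right) auto
    also have "(\<Sum>l\<in>F \<union> G. if l \<in> G then d l * ee (l \<bullet> y) else 0) = (\<Sum>l\<in>G. d l * ee (l \<bullet> y))"
      using F G by (intro sum.mono_neutral_cong_right) auto
    finally show ?thesis .
  qed
  then have "(LINT y|\<mu>. (cmod (f y + g y - (\<Sum>l\<in>F \<union> G. c' l * ee (l \<bullet> y))))\<^sup>2) =
    (LINT y|\<mu>. (cmod ((f y - (\<Sum>l\<in>F. c l * ee (l \<bullet> y))) + (g y - (\<Sum>l\<in>G. d l * ee (l \<bullet> y)))))\<^sup>2)"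
    by (simp add: algebra_simps)
  also have "\<dots> < \<epsilon>"
    using L2_square_triangle [OF square_integrable_diff [OF sq(1) square_integrable_trig_poly [of c F]]
        square_integrable_diff [OF sq(2) square_integrable_trig_poly [of d G]]] F(3) G(3) by linarith
  finally show "\<exists>F c. finite F \<and> F \<subseteq> \<Lambda> \<and> (LINT y|\<mu>. (cmod (f y + g y - (\<Sum>l\<in>F. c l * ee (l \<bullet> y))))\<^sup>2) < \<epsilon>"
    using F(1,2) G(1,2) by (intro exI [of _ "F \<union> G"] exI [of _ c']) auto
qed

lemma L2_approximable_0: "L2_approximable \<Lambda> (\<lambda>x. 0)"
  unfolding L2_approximable_def
  by (auto simp: square_integrable_def intro!: exI [of _ "{}"])

lemma L2_approximable_sum:
  "(\<And>i. i \<in> I \<Longrightarrow> L2_approximable \<Lambda> (f i)) \<Longrightarrow> L2_approximable \<Lambda> (\<lambda>x. \<Sum>i\<in>I. f i x)"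
  by (induction I rule: infinite_finite_induct)
     (auto intro: L2_approximable_add simp: L2_approximable_0)

text \<open>The class grows from exponentials to bounded continuous functions (Weierstrass is needed
  only on \<open>K\<close>), to indicators of closed sets by cutoffs, to indicators of Borel sets by
  Dynkin's argument, and to all square integrable functions through simple functions.\<close>

lemma L2_approximable_all:
  assumes ee: "\<And>\<xi>. L2_approximable \<Lambda> (\<lambda>y. ee (\<xi> \<bullet> y))"
    and K: "compact K" "AE x in \<mu>. x \<in> K"
    and f: "square_integrable \<mu> f"
  shows "L2_approximable \<Lambda> f"
proof -
  have trig: "L2_approximable \<Lambda> (\<lambda>y. \<Sum>l\<in>F. c l * ee (l \<bullet> y))" for F c
    by (intro L2_approximable_sum L2_approximable_cmult ee)
  have cont: "L2_approximable \<Lambda> (\<lambda>x. of_real (g x))"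
    if g: "continuous_on UNIV g" "\<And>x. \<bar>g x\<bar> \<le> B" for g :: "'a \<Rightarrow> real" and B
  proof (rule L2_approximable_limit)
    have "(\<lambda>x. complex_of_real (g x)) \<in> borel_measurable borel"
      by (intro borel_measurable_continuous_onI continuous_intros g)
    then show sq: "square_integrable \<mu> (\<lambda>x. complex_of_real (g x))"
      using g(2) by (intro square_integrable_bounded [where B = B]) (simp_all cong: measurable_cong_sets)
    fix \<epsilon> :: real assume e: "\<epsilon> > 0"
    then have "sqrt (\<epsilon> / 2) > 0" by simp
    then obtain F c where F: "finite F" "\<forall>x\<in>K. cmod (of_real (g x) - (\<Sum>l\<in>F. c l * ee (l \<bullet> x))) < sqrt (\<epsilon> / 2)"
      using continuous_approx_trig_poly [OF K(1) continuous_on_subset [OF g(1)]] by blast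
    have "(LINT y|\<mu>. (cmod (of_real (g y) - (\<Sum>l\<in>F. c l * ee (l \<bullet> y))))\<^sup>2) \<le> (LINT y|\<mu>. \<epsilon> / 2)"
    proof (rule integral_mono_AE)
      show "AE y in \<mu>. (cmod (of_real (g y) - (\<Sum>l\<in>F. c l * ee (l \<bullet> y))))\<^sup>2 \<le> \<epsilon> / 2"
        using K(2)
      proof eventually_elim
        case (elim y)
        then have "(cmod (of_real (g y) - (\<Sum>l\<in>F. c l * ee (l \<bullet> y))))\<^sup>2 \<le> (sqrt (\<epsilon> / 2))\<^sup>2"
          using F(2) by (intro power_mono) (auto simp: less_imp_le)
        then show ?case using e by simp
      qed
    qed (auto intro!: integrable_L2 square_integrable_diff sq square_integrable_trig_poly)
    then have "(LINT y|\<mu>. (cmod (of_real (g y) - (\<Sum>l\<in>F. c l * ee (l \<bullet> y))))\<^sup>2) < \<epsilon>"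
      using e by (simp add: prob_UNIV)
    then show "\<exists>h. L2_approximable \<Lambda> h \<and> (LINT y|\<mu>. (cmod (of_real (g y) - h y))\<^sup>2) < \<epsilon>"
      using trig by blast
  qed
  have indicator_empty: "L2_approximable \<Lambda> (indicator {})"
    using L2_approximable_0 by (simp add: indicator_def [abs_def])
  have closed: "L2_approximable \<Lambda> (indicator C)" if C: "closed C" for C
  proof (cases "C = {}")
    case False
    show ?thesis
    proof (rule L2_approximable_lim [where g = "\<lambda>n x. complex_of_real (max 0 (1 - real n * infdist x C))" and w = "\<lambda>_. 1"])
      show "L2_approximable \<Lambda> (\<lambda>x. complex_of_real (max 0 (1 - real n * infdist x C)))" for n
        by (rule cont [of _ 1]) (auto intro!: continuous_intros simp: infdist_nonneg)
      show "(\<lambda>n. complex_of_real (max 0 (1 - real n * infdist x C))) \<longlonglongrightarrow> indicator C x" for x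
        using tendsto_of_real [OF cutoff_tendsto_indicator [OF C False, of x], where 'a = complex]
        by (simp add: of_real_indicator)
      show "(indicator C :: 'a \<Rightarrow> complex) \<in> borel_measurable \<mu>"
        using borel_closed [OF C] by (intro borel_measurable_indicator) simp
    qed (auto simp: infdist_nonneg)
  qed (use indicator_empty in simp)
  have borel: "L2_approximable \<Lambda> (indicator A)" if "A \<in> sets borel" for A
  proof -
    have "Int_stable (Collect closed :: 'a set set)" "Collect closed \<subseteq> Pow (UNIV :: 'a set)"
      by (auto simp: Int_stable_def)
    moreover have "A \<in> sigma_sets UNIV (Collect closed)"
      using that by (simp add: borel_eq_closed)
    ultimately show ?thesis
    proof (induction rule: sigma_sets_induct_disjoint)
      case (basic A)
      then show ?case using closed by simp
    next
      case empty
      then show ?case by (rule indicator_empty)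
    next
      case (compl A)
      have "L2_approximable \<Lambda> (\<lambda>x. indicator UNIV x + (-1) * indicator A x)"
        by (intro L2_approximable_add L2_approximable_cmult compl closed) simp
      moreover have "(\<lambda>x. indicator UNIV x + (-1) * indicator A x) = (indicator (UNIV - A) :: 'a \<Rightarrow> complex)"
        by (auto simp: indicator_def fun_eq_iff)
      ultimately show ?case by simp
    next
      case (union A)
      have m: "A i \<in> sets borel" for i
        using union(2) by (auto simp: borel_eq_closed)
      show ?case
      proof (rule L2_approximable_lim [where g = "\<lambda>n. indicator (\<Union>i<n. A i)" and w = "\<lambda>_. 1"])
        show "L2_approximable \<Lambda> (indicator (\<Union>i<n. A i))" for n
        proof -
          have "indicator (\<Union>i<n. A i) = (\<lambda>x. \<Sum>i<n. indicator (A i) x :: complex)"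
            using union(1) by (intro ext indicator_UN_disjoint) (auto simp: disjoint_family_on_def)
          then show ?thesis
            using L2_approximable_sum [of "{..<n}" \<Lambda> "\<lambda>i. indicator (A i)"] union(3) by simp
        qed
        show "(\<lambda>n. indicator (\<Union>i<n. A i) x :: complex) \<longlonglongrightarrow> indicator (\<Union> (range A)) x" for x
          by (rule LIMSEQ_indicator_UN)
        show "(indicator (\<Union> (range A)) :: 'a \<Rightarrow> complex) \<in> borel_measurable \<mu>"
          using m by (intro borel_measurable_indicator) auto
      qed (auto simp: indicator_def)
    qed
  qed
  have [measurable]: "f \<in> borel_measurable \<mu>"
    using f by (simp add: square_integrable_def)
  obtain s where s: "\<And>i. simple_function \<mu> (s i)" "\<And>x. (\<lambda>i. s i x) \<longlonglongrightarrow> f x"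
    "\<And>i x. cmod (s i x) \<le> 2 * cmod (f x)"
    using borel_measurable_implies_sequence_metric [of f \<mu> 0] by auto
  show ?thesis
  proof (rule L2_approximable_lim [OF _ _ s(2,3)])
    show "integrable \<mu> (\<lambda>x. (2 * cmod (f x))\<^sup>2)"
      using f by (simp add: power_mult_distrib square_integrable_def)
    show "L2_approximable \<Lambda> (s i)" for i
    proof -
      have "s i = (\<lambda>x. \<Sum>y\<in>range (s i). y * indicator (s i -` {y}) x)"
        using simple_functionD(1) [OF s(1) [of i]] by (auto simp: fun_eq_iff indicator_def)
      moreover have "L2_approximable \<Lambda> (\<lambda>x. \<Sum>y\<in>range (s i). y * indicator (s i -` {y}) x)"
        using simple_functionD(2) [OF s(1) [of i]]
        by (intro L2_approximable_sum L2_approximable_cmult borel) auto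
      ultimately show ?thesis by simp
    qed
  qed simp
qed

end

section \<open>Self-affine measures of contractive systems\<close>

lemma second_order_recurrence_bound:
  fixes x :: "nat \<Rightarrow> complex"
  assumes rec: "\<And>n. x (n + 2) = (a + b) * x (n + 1) - a * b * x n"
    and ab: "cmod a \<le> \<rho>" "cmod b \<le> \<rho>" and r: "\<rho> < r" "r \<le> 1"
  shows "cmod (x n) \<le> (cmod (x 0) + (cmod (x 1) + cmod (x 0)) / (r - \<rho>)) * r ^ n"
proof -
  have \<rho>: "0 \<le> \<rho>" using ab(1) norm_ge_zero order_trans by blast
  define U where "U = cmod (x 1) + cmod (x 0)"
  \<comment> \<open>For a = b the solutions can behave like n \<rho>^n, which the gap between \<rho>
    and r absorbs. \<open>K\<close> is chosen so that U \<le> K (r - \<rho>), exactly what closes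
    the second induction.\<close>
  define K where "K = cmod (x 0) + U / (r - \<rho>)"
  have U: "0 \<le> U" by (simp add: U_def)
  \<comment> \<open>Dividing out the root a leaves a first-order recurrence with ratio b.\<close>
  have y: "cmod (x (n + 1) - a * x n) \<le> \<rho> ^ n * U" for n
  proof (induction n)
    case 0
    have "cmod (x 1 - a * x 0) \<le> cmod (x 1) + cmod a * cmod (x 0)"
      by (metis norm_mult norm_triangle_ineq4)
    also have "\<dots> \<le> cmod (x 1) + 1 * cmod (x 0)"
      using ab(1) r by (intro add_left_mono mult_right_mono) auto
    finally show ?case by (simp add: U_def)
  next
    case (Suc n)
    have "x (Suc n + 1) - a * x (Suc n) = b * (x (n + 1) - a * x n)"
      using rec [of n] by (simp add: algebra_simps)
    then have "cmod (x (Suc n + 1) - a * x (Suc n)) \<le> \<rho> * (\<rho> ^ n * U)"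
      using Suc ab(2) \<rho> U by (simp only: norm_mult) (intro mult_mono, auto)
    then show ?case by simp
  qed
  have KU: "U \<le> K * (r - \<rho>)"
  proof -
    have "K * (r - \<rho>) = cmod (x 0) * (r - \<rho>) + U"
      using r by (simp add: K_def distrib_right)
    then show ?thesis using r by simp
  qed
  have K: "0 \<le> K" using U r by (simp add: K_def)
  have "cmod (x n) \<le> K * r ^ n"
  proof (induction n)
    case 0
    show ?case using U r by (simp add: K_def)
  next
    case (Suc n)
    have "cmod (x (n + 1)) \<le> cmod (x (n + 1) - a * x n) + cmod (a * x n)"
      by (metis diff_add_cancel norm_triangle_ineq)
    also have "\<dots> \<le> \<rho> ^ n * U + \<rho> * (K * r ^ n)"
      using y [of n] Suc ab(1) \<rho> by (intro add_mono) (auto simp: norm_mult intro!: mult_mono)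
    also have "\<dots> \<le> r ^ n * (K * (r - \<rho>)) + \<rho> * (K * r ^ n)"
      using KU K r \<rho> U by (intro add_mono mult_mono power_mono) auto
    also have "\<dots> = K * r ^ Suc n" by (simp add: algebra_simps)
    finally show ?case by simp
  qed
  then show ?thesis by (simp add: K_def U_def)
qed

lemma matrix_inv:
  assumes "invertible A"
  shows "A ** matrix_inv A = mat 1" "matrix_inv A ** A = mat 1"
  using assms unfolding invertible_def matrix_inv_def by (metis (mono_tags, lifting) someI_ex)+

lemma expanding_root:
  fixes A :: "real ^ 2 ^ 2"
  assumes "expanding A" "z\<^sup>2 - of_real (A$1$1 + A$2$2) * z + of_real (det A) = 0"
  shows "cmod z > 1"
proof -
  define E where "E = map_matrix complex_of_real A - mat z"
  have "det E = 0"
    using assms(2) by (simp add: E_def det_2 mat_def map_matrix_def power2_eq_square algebra_simps)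
  then have "\<not> invertible E"
    by (simp add: invertible_det_nz)
  then obtain v where v: "E *v v = 0" "v \<noteq> 0"
    using matrix_left_invertible_ker [of E] by (auto simp: invertible_left_inverse)
  have "map_matrix complex_of_real A *v v = z *s v"
  proof -
    have "mat z *v v = z *s v"
      by (simp add: matrix_vector_mult_def mat_def vec_eq_iff if_distrib [where f = "\<lambda>x. x * _"] cong: if_cong)
    then show ?thesis
      using v(1) by (simp add: E_def matrix_vector_mult_diff_rdistrib)
  qed
  then show ?thesis
    using assms(1) v(2) unfolding expanding_def by blast
qed

text \<open>Every component of the iterates satisfies a scalar recurrence by Cayley-Hamilton, so no
  Jordan form is needed, and a double eigenvalue is no special case.\<close>

lemma expanding_inverse_decay:
  fixes A :: "real ^ 2 ^ 2"
  assumes "expanding A"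
  shows "invertible A"
    and "\<exists>C r. 0 < C \<and> 0 < r \<and> r < 1 \<and> (\<forall>n x. norm (((*v) (matrix_inv A) ^^ n) x) \<le> C * r ^ n * norm x)"
proof -
  define t d where "t = A$1$1 + A$2$2" and "d = det A"
  define s where "s = csqrt (of_real t ^ 2 - 4 * of_real d)"
  define p q where "p = (of_real t + s) / 2" and "q = (of_real t - s) / 2"
  have s2: "s ^ 2 = of_real t ^ 2 - 4 * of_real d" by (simp add: s_def)
  have sum: "p + q = of_real t" and prod: "p * q = of_real d"
    using s2 by (simp_all add: p_def q_def field_simps power2_eq_square)
  have "p\<^sup>2 - (p + q) * p + p * q = 0" "q\<^sup>2 - (p + q) * q + p * q = 0"
    by (simp_all add: power2_eq_square algebra_simps)
  then have pq: "cmod p > 1" "cmod q > 1"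
    unfolding sum prod t_def d_def using expanding_root [OF assms] by blast+
  then have nz: "p \<noteq> 0" "q \<noteq> 0" by auto
  then have "d \<noteq> 0" using prod by auto
  then show inv: "invertible A" by (simp add: d_def invertible_det_nz)
  define N where "N = (*v) (matrix_inv A)"
  have AN: "A *v N x = x" for x
    by (simp add: N_def matrix_vector_mul_assoc matrix_inv(1) [OF inv])
  \<comment> \<open>Cayley-Hamilton for A. Applied to \<open>N (N x)\<close> it becomes a recurrence
    for the inverse, whose characteristic roots are 1/p and 1/q.\<close>
  have CH: "A *v (A *v y) = t *\<^sub>R (A *v y) - d *\<^sub>R y" for y
    by (simp add: vec_eq_iff forall_2 matrix_vector_mult_def sum_2 t_def d_def det_2 algebra_simps)
  have N2: "x = t *\<^sub>R N x - d *\<^sub>R N (N x)" for x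
    using CH [of "N (N x)"] by (simp add: AN)
  define \<rho> where "\<rho> = max (cmod (1 / p)) (cmod (1 / q))"
  have \<rho>: "0 \<le> \<rho>" "\<rho> < 1"
  proof -
    have "0 < cmod p" "0 < cmod q" using pq by linarith+
    then show "0 \<le> \<rho>" "\<rho> < 1"
      using pq by (simp_all add: \<rho>_def norm_divide le_max_iff_disj pos_divide_less_eq)
  qed
  define r where "r = (1 + \<rho>) / 2"
  have r: "\<rho> < r" "r < 1" "0 < r" using \<rho> by (auto simp: r_def)
  obtain L where L: "\<And>x. norm (N x) \<le> norm x * L" "L > 0"
    using bounded_linear.pos_bounded [OF matrix_vector_mul_bounded_linear [of "matrix_inv A"]]
    by (auto simp: N_def)
  define C where "C = real CARD(2) * (1 + (L + 1) / (r - \<rho>))"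
  have bound: "norm ((N ^^ n) x) \<le> C * r ^ n * norm x" for n x
  proof -
    have "\<bar>(N ^^ n) x $ i\<bar> \<le> (1 + (L + 1) / (r - \<rho>)) * r ^ n * norm x" for i
    proof -
      define u where "u n = complex_of_real ((N ^^ n) x $ i)" for n
      have "u (n + 2) = (1 / p + 1 / q) * u (n + 1) - 1 / p * (1 / q) * u n" for n
      proof -
        have "(N ^^ n) x $ i = t * (N ^^ (n + 1)) x $ i - d * (N ^^ (n + 2)) x $ i"
          using arg_cong [OF N2 [of "(N ^^ n) x"], of "\<lambda>v. v $ i"] by simp
        then have "u n = of_real t * u (n + 1) - of_real d * u (n + 2)"
          by (simp add: u_def flip: of_real_mult of_real_diff)
        then have "u (n + 2) = ((p + q) * u (n + 1) - u n) / (p * q)"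
          unfolding sum [symmetric] prod [symmetric] using nz by (simp add: eq_divide_eq algebra_simps)
        also have "\<dots> = (1 / p + 1 / q) * u (n + 1) - 1 / p * (1 / q) * u n"
          using nz by (simp add: divide_simps)
        finally show ?thesis .
      qed
      then have "cmod (u n) \<le> (cmod (u 0) + (cmod (u 1) + cmod (u 0)) / (r - \<rho>)) * r ^ n"
        by (rule second_order_recurrence_bound) (use r in \<open>auto simp: \<rho>_def\<close>)
      also have "\<dots> \<le> (norm x + (norm x * L + norm x) / (r - \<rho>)) * r ^ n"
      proof -
        have "cmod (u 0) \<le> norm x"
          using component_le_norm_cart [of x i] by (simp add: u_def)
        moreover have "cmod (u 1) \<le> norm x * L"
          using order_trans [OF component_le_norm_cart [of "N x" i] L(1)] by (simp add: u_def)
        ultimately show ?thesis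
          using r by (intro mult_right_mono add_mono divide_right_mono) auto
      qed
      also have "\<dots> = (1 + (L + 1) / (r - \<rho>)) * r ^ n * norm x"
        by (simp add: algebra_simps add_divide_distrib)
      finally show ?thesis by (simp add: u_def)
    qed
    then have "(\<Sum>i\<in>UNIV. \<bar>(N ^^ n) x $ i\<bar>) \<le> real CARD(2) * ((1 + (L + 1) / (r - \<rho>)) * r ^ n * norm x)"
      using sum_bounded_above [of "UNIV :: 2 set" "\<lambda>i. \<bar>(N ^^ n) x $ i\<bar>"] by simp
    then show ?thesis
      using order_trans [OF norm_le_l1_cart [of "(N ^^ n) x"]] by (simp only: C_def mult.assoc)
  qed
  have "C > 0" using L r by (simp add: C_def add_pos_pos)
  then show "\<exists>C r. 0 < C \<and> 0 < r \<and> r < 1 \<and> (\<forall>n x. norm (((*v) (matrix_inv A) ^^ n) x) \<le> C * r ^ n * norm x)"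
    using r bound unfolding N_def by blast
qed

text \<open>\<open>N\<close> itself may stretch some vectors in the Euclidean norm, so only the
  decay of its iterates is required, with a constant \<open>C\<close> that may exceed 1.\<close>

locale contractive_ifs =
  fixes N :: "'a::euclidean_space \<Rightarrow> 'a" and D :: "'a set" and C r :: real
  assumes linear_N: "linear N"
    and C_pos: "0 < C" and r_pos: "0 < r" and r_less_1: "r < 1"
    and decay: "\<And>n x. norm ((N ^^ n) x) \<le> C * r ^ n * norm x"
    and finite_D: "finite D" and D_nonempty: "D \<noteq> {}"
begin

lemma continuous_N: "continuous_on A N"
  using linear_N by (simp add: linear_continuous_on linear_linear)

lemma measurable_N [measurable]: "N \<in> borel_measurable borel"
  by (intro borel_measurable_continuous_onI continuous_N)

lemma N_add: "N (x + y) = N x + N y"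
  and N_diff: "N (x - y) = N x - N y"
  using linear_N by (simp_all add: linear_add linear_diff)

lemma funpow_tendsto_0: "(\<lambda>n. (N ^^ n) x) \<longlonglongrightarrow> 0"
proof (rule Lim_null_comparison)
  have "(\<lambda>n. C * r ^ n * norm x) \<longlonglongrightarrow> C * 0 * norm x"
    using r_pos r_less_1 by (intro tendsto_intros LIMSEQ_realpow_zero) auto
  then show "(\<lambda>n. C * r ^ n * norm x) \<longlonglongrightarrow> 0" by simp
qed (simp add: decay)

section \<open>Invariant measures as fixed points of an operator on measures\<close>

definition invariant :: "'a measure \<Rightarrow> bool" where
  "invariant \<mu> \<longleftrightarrow> prob_space \<mu> \<and> sets \<mu> = sets borel \<and>
     (\<forall>X \<in> sets borel. measure \<mu> X = 1 / real (card D) * (\<Sum>d\<in>D. measure \<mu> ((\<lambda>x. N (x + d)) -` X)))"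

definition digit_pmf :: "'a pmf" where
  "digit_pmf = pmf_of_set D"

text \<open>The Hutchinson operator, written as the law of a random branch with independent uniform
  digit, so that Fubini's theorem applies.\<close>

definition transfer :: "'a measure \<Rightarrow> 'a measure" where
  "transfer \<mu> = distr (measure_pmf digit_pmf \<Otimes>\<^sub>M \<mu>) borel (\<lambda>p. N (snd p + fst p))"

lemma set_digit_pmf [simp]: "set_pmf digit_pmf = D"
  using finite_D D_nonempty by (simp add: digit_pmf_def)

lemma branch_measurable:
  assumes "sets \<mu> = sets borel"
  shows "(\<lambda>p. N (snd p + fst p)) \<in> borel_measurable (measure_pmf digit_pmf \<Otimes>\<^sub>M \<mu>)"
proof -
  have [measurable]: "snd \<in> borel_measurable (measure_pmf digit_pmf \<Otimes>\<^sub>M \<mu>)"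
    using measurable_snd [of "measure_pmf digit_pmf" \<mu>] assms by (simp cong: measurable_cong_sets)
  have [measurable]: "fst \<in> borel_measurable (measure_pmf digit_pmf \<Otimes>\<^sub>M \<mu>)"
    by (rule measurable_compose [OF measurable_fst]) simp
  show ?thesis by measurable
qed

lemma borel_prob_transfer:
  assumes "borel_prob \<mu>"
  shows "borel_prob (transfer \<mu>)"
proof -
  interpret borel_prob \<mu> by fact
  interpret pair_prob_space "measure_pmf digit_pmf" \<mu> ..
  show ?thesis
    unfolding transfer_def
    by (intro borel_prob.intro prob_space_distr branch_measurable borel_prob_axioms.intro) simp_all
qed

lemma integral_transfer:
  fixes f :: "'a \<Rightarrow> 'b::{banach, second_countable_topology}"
  assumes "borel_prob \<mu>" and [measurable]: "f \<in> borel_measurable borel" and B: "\<And>x. norm (f x) \<le> B"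
  shows "(LINT x|transfer \<mu>. f x) = (1 / real (card D)) *\<^sub>R (\<Sum>d\<in>D. LINT x|\<mu>. f (N (x + d)))"
proof -
  interpret borel_prob \<mu> by fact
  interpret pair_prob_space "measure_pmf digit_pmf" \<mu> ..
  note branch_measurable [OF sets_borel, measurable]
  have "(LINT x|transfer \<mu>. f x) = (LINT p|(measure_pmf digit_pmf \<Otimes>\<^sub>M \<mu>). f (N (snd p + fst p)))"
    unfolding transfer_def by (intro integral_distr) simp_all
  also have "\<dots> = (LINT d|measure_pmf digit_pmf. LINT x|\<mu>. f (N (x + d)))"
  proof -
    have "integrable (measure_pmf digit_pmf \<Otimes>\<^sub>M \<mu>) (\<lambda>p. f (N (snd p + fst p)))"
      by (rule P.integrable_const_bound [where B = B]) (auto simp: B)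
    from integral_fst' [OF this] show ?thesis by simp
  qed
  also have "\<dots> = (\<Sum>d\<in>D. (1 / real (card D)) *\<^sub>R (LINT x|\<mu>. f (N (x + d))))"
    using finite_D D_nonempty
    by (subst integral_measure_pmf [of D]) (auto simp: digit_pmf_def divide_inverse intro!: sum.cong)
  finally show ?thesis by (simp add: scaleR_sum_right)
qed

lemma invariant_iff_transfer:
  "invariant \<mu> \<longleftrightarrow> borel_prob \<mu> \<and> transfer \<mu> = \<mu>"
proof -
  have "(\<forall>X \<in> sets borel. measure \<mu> X = 1 / real (card D) * (\<Sum>d\<in>D. measure \<mu> ((\<lambda>x. N (x + d)) -` X)))
    \<longleftrightarrow> transfer \<mu> = \<mu>" if \<mu>: "borel_prob \<mu>"
  proof -
    interpret borel_prob \<mu> by fact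
    interpret T: borel_prob "transfer \<mu>" using \<mu> by (rule borel_prob_transfer)
    have meas: "measure (transfer \<mu>) X = 1 / real (card D) * (\<Sum>d\<in>D. measure \<mu> ((\<lambda>x. N (x + d)) -` X))"
      if X: "X \<in> sets borel" for X
    proof -
      have "(\<lambda>x. N (x + d)) -` X \<in> sets \<mu>" for d
        using measurable_sets [of "\<lambda>x. N (x + d)" borel borel X] X by simp
      moreover have "(\<lambda>x. indicator X (N (x + d))) = (indicator ((\<lambda>x. N (x + d)) -` X) :: 'a \<Rightarrow> real)" for d
        by (auto simp: indicator_def fun_eq_iff)
      ultimately have *: "(LINT x|\<mu>. indicator X (N (x + d))) = measure \<mu> ((\<lambda>x. N (x + d)) -` X)" for d
        by simp
      have "(LINT x|transfer \<mu>. indicator X x) = (1 / real (card D)) *\<^sub>R (\<Sum>d\<in>D. LINT x|\<mu>. indicator X (N (x + d)) :: real)"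
        using X by (intro integral_transfer [OF \<mu>, where B = 1]) (auto simp: indicator_def)
      then show ?thesis using X by (simp add: *)
    qed
    show ?thesis
    proof
      assume L: "\<forall>X \<in> sets borel. measure \<mu> X = 1 / real (card D) * (\<Sum>d\<in>D. measure \<mu> ((\<lambda>x. N (x + d)) -` X))"
      show "transfer \<mu> = \<mu>"
      proof (rule measure_eqI)
        fix X assume "X \<in> sets (transfer \<mu>)"
        then show "emeasure (transfer \<mu>) X = emeasure \<mu> X"
          using L meas by (simp add: emeasure_eq_measure T.emeasure_eq_measure)
      qed simp
    qed (use meas in metis)
  qed
  then show ?thesis
    unfolding invariant_def borel_prob_def borel_prob_axioms_def by blast
qed

section \<open>Existence: the law of the random address series\<close>

definition digit_bound :: real where
  "digit_bound = Max (norm ` D)"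

text \<open>Streams may contain values outside \<open>D\<close> (with probability 0); clipping makes the address series converge everywhere.\<close>

definition clip :: "'a \<Rightarrow> 'a" where
  "clip d = (if d \<in> D then d else (SOME d. d \<in> D))"

definition address :: "'a stream \<Rightarrow> 'a" where
  "address \<omega> = (\<Sum>j. (N ^^ Suc j) (clip (\<omega> !! j)))"

lemma clip_in_D: "clip d \<in> D"
  using D_nonempty by (simp add: clip_def some_in_eq)

lemma norm_le_digit_bound: "d \<in> D \<Longrightarrow> norm d \<le> digit_bound"
  using finite_D by (simp add: digit_bound_def)

lemma address_term_bound: "norm ((N ^^ Suc j) (clip d)) \<le> C * r * digit_bound * r ^ j"
proof -
  have "norm ((N ^^ Suc j) (clip d)) \<le> C * r ^ Suc j * norm (clip d)"
    by (rule decay)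
  also have "\<dots> \<le> C * r ^ Suc j * digit_bound"
    using C_pos r_pos norm_le_digit_bound [OF clip_in_D] by (intro mult_left_mono) auto
  finally show ?thesis by (simp add: mult_ac)
qed

lemma summable_address_bound: "summable (\<lambda>j. C * r * digit_bound * r ^ j)"
  using r_pos r_less_1 by (intro summable_mult summable_geometric) simp

lemma summable_address: "summable (\<lambda>j. (N ^^ Suc j) (clip (\<omega> !! j)))"
  by (rule summable_comparison_test' [OF summable_address_bound, of 0]) (rule address_term_bound)

lemma norm_address_le: "norm (address \<omega>) \<le> (\<Sum>j. C * r * digit_bound * r ^ j)"
  unfolding address_def by (intro norm_suminf_le address_term_bound summable_address_bound)

lemma address_Stream: "address (d ## \<omega>) = N (address \<omega> + clip d)"
proof -
  have "address (d ## \<omega>) = (\<Sum>j. (N ^^ Suc (Suc j)) (clip (\<omega> !! j))) + N (clip d)"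
    using suminf_split_head [OF summable_address [of "d ## \<omega>"]] by (simp add: address_def)
  also have "(\<Sum>j. (N ^^ Suc (Suc j)) (clip (\<omega> !! j))) = N (address \<omega>)"
    unfolding address_def
    using bounded_linear.suminf [OF linear_conv_bounded_linear [THEN iffD1, OF linear_N] summable_address [of \<omega>]]
    by simp
  finally show ?thesis by (simp add: N_add)
qed

lemma measurable_address [measurable]: "address \<in> borel_measurable (stream_space (measure_pmf digit_pmf))"
proof -
  have "(\<lambda>\<omega>. (N ^^ Suc j) (clip (\<omega> !! j))) \<in> borel_measurable (stream_space (measure_pmf digit_pmf))" for j
    by (rule measurable_compose [OF measurable_snth]) simp
  then show ?thesis
    unfolding address_def by (rule borel_measurable_suminf)
qed

definition address_law :: "'a measure" where
  "address_law = distr (stream_space (measure_pmf digit_pmf)) borel address"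

lemma borel_prob_address_law: "borel_prob address_law"
proof -
  interpret S: prob_space "stream_space (measure_pmf digit_pmf)"
    by (rule prob_space.prob_space_stream_space [OF measure_pmf.prob_space_axioms])
  show ?thesis
    unfolding address_law_def
    by (intro borel_prob.intro S.prob_space_distr borel_prob_axioms.intro) simp_all
qed

text \<open>An independent digit put in front of a random digit stream gives a stream with the same
  law, and on addresses this is one application of a branch.\<close>

lemma transfer_address_law: "transfer address_law = address_law"
proof (rule measure_eqI)
  interpret S: prob_space "stream_space (measure_pmf digit_pmf)"
    by (rule prob_space.prob_space_stream_space [OF measure_pmf.prob_space_axioms])
  interpret L: borel_prob address_law by (rule borel_prob_address_law)
  show "sets (transfer address_law) = sets address_law"
    by (simp add: transfer_def)
  fix X assume "X \<in> sets (transfer address_law)"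
  then have X [measurable]: "X \<in> sets borel" by (simp add: transfer_def)
  note branch_measurable [OF L.sets_borel, measurable]
  have "emeasure (transfer address_law) X =
    (\<integral>\<^sup>+p. indicator X (N (snd p + fst p)) \<partial>(measure_pmf digit_pmf \<Otimes>\<^sub>M address_law))"
    unfolding transfer_def
    by (subst nn_integral_indicator [symmetric], simp, subst nn_integral_distr) simp_all
  also have "\<dots> = (\<integral>\<^sup>+d. \<integral>\<^sup>+x. indicator X (N (x + d)) \<partial>address_law \<partial>measure_pmf digit_pmf)"
    by (subst L.nn_integral_fst [symmetric]) simp_all
  also have "\<dots> = (\<integral>\<^sup>+d. \<integral>\<^sup>+\<omega>. indicator X (address (d ## \<omega>)) \<partial>stream_space (measure_pmf digit_pmf) \<partial>measure_pmf digit_pmf)"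
  proof (rule nn_integral_cong_AE, rule AE_pmfI)
    fix d assume "d \<in> set_pmf digit_pmf"
    then have "clip d = d" by (simp add: clip_def)
    then show "(\<integral>\<^sup>+x. indicator X (N (x + d)) \<partial>address_law) =
        (\<integral>\<^sup>+\<omega>. indicator X (address (d ## \<omega>)) \<partial>stream_space (measure_pmf digit_pmf))"
      unfolding address_law_def by (subst nn_integral_distr) (simp_all add: address_Stream)
  qed
  also have "\<dots> = (\<integral>\<^sup>+\<omega>. indicator X (address \<omega>) \<partial>stream_space (measure_pmf digit_pmf))"
    by (rule prob_space.nn_integral_stream_space [OF measure_pmf.prob_space_axioms, symmetric]) measurable
  also have "\<dots> = emeasure address_law X"
    unfolding address_law_def
    by (subst nn_integral_indicator [symmetric], simp, subst nn_integral_distr) simp_all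
  finally show "emeasure (transfer address_law) X = emeasure address_law X" .
qed

lemma invariant_address_law: "invariant address_law"
  by (simp add: invariant_iff_transfer borel_prob_address_law transfer_address_law)

lemma AE_address_law: "\<exists>K. compact K \<and> (AE x in address_law. x \<in> K)"
proof -
  let ?K = "cball 0 (\<Sum>j. C * r * digit_bound * r ^ j) :: 'a set"
  have "AE x in address_law. x \<in> ?K"
    unfolding address_law_def by (subst AE_distr_iff) (simp_all add: norm_address_le)
  then show ?thesis using compact_cball by blast
qed

section \<open>Uniqueness by iterated averaging\<close>

definition avg :: "('a \<Rightarrow> real) \<Rightarrow> 'a \<Rightarrow> real" where
  "avg f x = 1 / real (card D) * (\<Sum>d\<in>D. f (N (x + d)))"

lemma avg_bound:
  assumes "\<And>x. \<bar>f x\<bar> \<le> B"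
  shows "\<bar>avg f x\<bar> \<le> B"
proof -
  have "\<bar>\<Sum>d\<in>D. f (N (x + d))\<bar> \<le> (\<Sum>d\<in>D. B)"
    using assms by (intro order_trans [OF sum_abs] sum_mono)
  then show ?thesis
    using finite_D D_nonempty by (simp add: avg_def abs_mult card_gt_0_iff divide_le_eq mult.commute)
qed

text \<open>The modulus of continuity is an arbitrary function \<open>g\<close> of the difference.
  With a Lipschitz constant one step might enlarge it; with \<open>g\<close> composed with
  \<open>N\<close>, the decay of iterates can be used after n steps.\<close>

lemma avg_lipschitz:
  assumes "\<And>x y. \<bar>f x - f y\<bar> \<le> g (x - y)"
  shows "\<bar>avg f x - avg f y\<bar> \<le> g (N (x - y))"
proof -
  have "\<bar>\<Sum>d\<in>D. f (N (x + d)) - f (N (y + d))\<bar> \<le> (\<Sum>d\<in>D. g (N (x - y)))"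
  proof (intro order_trans [OF sum_abs] sum_mono)
    fix d
    show "\<bar>f (N (x + d)) - f (N (y + d))\<bar> \<le> g (N (x - y))"
      using assms [of "N (x + d)" "N (y + d)"] by (simp flip: N_diff)
  qed
  moreover have "avg f x - avg f y = 1 / real (card D) * (\<Sum>d\<in>D. f (N (x + d)) - f (N (y + d)))"
    by (simp add: avg_def sum_subtractf algebra_simps)
  ultimately show ?thesis
    using finite_D D_nonempty by (simp add: abs_mult card_gt_0_iff divide_le_eq mult.commute)
qed

lemma measurable_avg:
  assumes [measurable]: "f \<in> borel_measurable borel"
  shows "avg f \<in> borel_measurable borel"
  unfolding avg_def [abs_def] by measurable

text \<open>Averaging preserves the integral against an invariant measure, while the averaged
  functions become constant. The sequence on the left does not mention the measure, which is the
  source of uniqueness.\<close>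

lemma invariant_integral_limit:
  assumes "invariant \<mu>" and lip: "\<And>x y. \<bar>f x - f y\<bar> \<le> L * norm (x - y)" and B: "\<And>x. \<bar>f x\<bar> \<le> B"
    and f: "f \<in> borel_measurable borel"
  shows "(\<lambda>n. (avg ^^ n) f 0) \<longlonglongrightarrow> (LINT x|\<mu>. f x)"
proof -
  interpret borel_prob \<mu> using assms(1) by (simp add: invariant_iff_transfer)
  have tr: "transfer \<mu> = \<mu>" using assms(1) by (simp add: invariant_iff_transfer)
  have bd: "\<bar>(avg ^^ n) f x\<bar> \<le> B" for n x
    by (induction n arbitrary: x) (auto simp: B intro: avg_bound)
  have ms: "(avg ^^ n) f \<in> borel_measurable borel" for n
    by (induction n) (auto simp: f intro: measurable_avg)
  have lipn: "\<bar>(avg ^^ n) f x - (avg ^^ n) f y\<bar> \<le> L * norm ((N ^^ n) (x - y))" for n x y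
  proof (induction n arbitrary: x y)
    case (Suc n)
    have "\<bar>avg ((avg ^^ n) f) x - avg ((avg ^^ n) f) y\<bar> \<le> L * norm ((N ^^ n) (N (x - y)))"
      by (rule avg_lipschitz [where g = "\<lambda>z. L * norm ((N ^^ n) z)"]) (rule Suc)
    then show ?case by (simp add: funpow_swap1)
  qed (simp add: lip)
  have int: "integrable \<mu> ((avg ^^ n) f)" for n
    using ms bd by (intro integrable_const_bound [where B = B]) (auto cong: measurable_cong_sets)
  have "(LINT x|\<mu>. avg g x) = (LINT x|\<mu>. g x)"
    if g: "g \<in> borel_measurable borel" "\<And>x. \<bar>g x\<bar> \<le> B" for g
  proof -
    have "integrable \<mu> (\<lambda>x. g (N (x + d)))" for d
      using g by (intro integrable_const_bound [where B = B]) (auto cong: measurable_cong_sets)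
    then have "(LINT x|\<mu>. avg g x) = 1 / real (card D) * (\<Sum>d\<in>D. LINT x|\<mu>. g (N (x + d)))"
      unfolding avg_def by (simp add: Bochner_Integration.integral_sum)
    also have "\<dots> = (LINT x|transfer \<mu>. g x)"
      using integral_transfer [OF borel_prob_axioms g(1), of B] g(2) by simp
    finally show ?thesis by (simp add: tr)
  qed
  then have eq: "(LINT x|\<mu>. (avg ^^ n) f x) = (LINT x|\<mu>. f x)" for n
    by (induction n) (simp_all add: ms bd)
  have "(\<lambda>n. LINT x|\<mu>. (avg ^^ n) f x - (avg ^^ n) f 0) \<longlonglongrightarrow> (LINT x|\<mu>. 0)"
  proof (rule integral_dominated_convergence [where w = "\<lambda>_. 2 * B"])
    show "(\<lambda>x. (avg ^^ n) f x - (avg ^^ n) f 0) \<in> borel_measurable \<mu>" for n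
      using ms by (simp cong: measurable_cong_sets)
    show "AE x in \<mu>. norm ((avg ^^ n) f x - (avg ^^ n) f 0) \<le> 2 * B" for n
    proof (rule AE_I2)
      fix x
      show "norm ((avg ^^ n) f x - (avg ^^ n) f 0) \<le> 2 * B"
        using bd [of n x] bd [of n 0] by (simp add: abs_le_iff)
    qed
    show "AE x in \<mu>. (\<lambda>n. (avg ^^ n) f x - (avg ^^ n) f 0) \<longlonglongrightarrow> 0"
    proof (rule AE_I2)
      fix x
      have "(\<lambda>n. L * norm ((N ^^ n) (x - 0))) \<longlonglongrightarrow> L * norm (0 :: 'a)"
        by (rule tendsto_mult_left [OF tendsto_norm [OF funpow_tendsto_0]])
      then show "(\<lambda>n. (avg ^^ n) f x - (avg ^^ n) f 0) \<longlonglongrightarrow> 0"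
        using lipn [of _ x 0] Lim_null_comparison [of "\<lambda>n. (avg ^^ n) f x - (avg ^^ n) f 0" "\<lambda>n. L * norm ((N ^^ n) (x - 0))"]
        by simp
    qed
  qed auto
  moreover have "(LINT x|\<mu>. (avg ^^ n) f x - (avg ^^ n) f 0) = (LINT x|\<mu>. f x) - (avg ^^ n) f 0" for n
    by (simp add: int eq prob_UNIV)
  ultimately have "(\<lambda>n. (LINT x|\<mu>. f x) - (avg ^^ n) f 0) \<longlonglongrightarrow> 0" by simp
  then have "(\<lambda>n. (LINT x|\<mu>. f x) - ((LINT x|\<mu>. f x) - (avg ^^ n) f 0)) \<longlonglongrightarrow> (LINT x|\<mu>. f x) - 0"
    by (intro tendsto_intros)
  then show ?thesis by simp
qed

text \<open>Lipschitz cutoffs of closed sets have the same integrals under both measures; closed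
  sets are stable under intersection and generate the Borel sets.\<close>

lemma invariant_unique:
  assumes "invariant \<mu>" "invariant \<nu>"
  shows "\<mu> = \<nu>"
proof -
  interpret m: borel_prob \<mu> using assms(1) by (simp add: invariant_iff_transfer)
  interpret n: borel_prob \<nu> using assms(2) by (simp add: invariant_iff_transfer)
  have closed: "measure \<mu> S = measure \<nu> S" if S: "closed S" for S
  proof (cases "S = {}")
    case False
    define g where "g n x = max 0 (1 - real n * infdist x S)" for n x
    have gm [measurable]: "g n \<in> borel_measurable borel" for n
      unfolding g_def by (intro borel_measurable_continuous_onI continuous_intros)
    have g01: "\<bar>g n x\<bar> \<le> 1" for n x by (auto simp: g_def infdist_nonneg)
    have "\<bar>g n x - g n y\<bar> \<le> real n * norm (x - y)" for n x y
    proof -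
      have "\<bar>g n x - g n y\<bar> \<le> \<bar>real n * infdist x S - real n * infdist y S\<bar>"
        by (auto simp: g_def max_def)
      also have "\<dots> = real n * \<bar>infdist x S - infdist y S\<bar>"
        by (simp add: abs_mult flip: right_diff_distrib)
      also have "\<dots> \<le> real n * norm (x - y)"
        using infdist_triangle_abs [of x S y] by (intro mult_left_mono) (auto simp: dist_norm)
      finally show ?thesis .
    qed
    then have eq: "(LINT x|\<mu>. g n x) = (LINT x|\<nu>. g n x)" for n
      using invariant_integral_limit [OF assms(1) _ g01 gm] invariant_integral_limit [OF assms(2) _ g01 gm]
      by (meson LIMSEQ_unique)
    have lim: "(\<lambda>n. LINT x|\<rho>. g n x) \<longlonglongrightarrow> measure \<rho> S" if "borel_prob \<rho>" for \<rho>
    proof -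
      interpret borel_prob \<rho> by fact
      have "(\<lambda>n. LINT x|\<rho>. g n x) \<longlonglongrightarrow> (LINT x|\<rho>. indicator S x)"
      proof (rule integral_dominated_convergence [where w = "\<lambda>_. 1"])
        show "AE x in \<rho>. (\<lambda>n. g n x) \<longlonglongrightarrow> indicator S x"
          unfolding g_def by (intro AE_I2 cutoff_tendsto_indicator S False)
      qed (use g01 S in \<open>auto intro!: borel_measurable_indicator\<close>)
      then show ?thesis using S by simp
    qed
    show ?thesis
      using lim [OF m.borel_prob_axioms] lim [OF n.borel_prob_axioms] unfolding eq by (rule LIMSEQ_unique)
  qed simp
  show ?thesis
  proof (rule measure_eqI_generator_eq [where E = "Collect closed" and \<Omega> = UNIV and A = "\<lambda>_. UNIV"])
    show "emeasure \<mu> X = emeasure \<nu> X" if "X \<in> Collect closed" for X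
      using closed that by (simp add: m.emeasure_eq_measure n.emeasure_eq_measure)
    show "sets \<mu> = sigma_sets UNIV (Collect closed)" "sets \<nu> = sigma_sets UNIV (Collect closed)"
      by (simp_all add: borel_eq_closed)
  qed (auto simp: Int_stable_def)
qed

section \<open>The Fourier transform as an infinite product of masks\<close>

definition dual :: "'a \<Rightarrow> 'a" where
  "dual = adjoint N"

lemma linear_dual: "linear dual"
  unfolding dual_def by (rule adjoint_linear [OF linear_N])

lemma inner_funpow_dual: "x \<bullet> (dual ^^ n) y = (N ^^ n) x \<bullet> y"
proof (induction n arbitrary: x)
  case (Suc n)
  have "x \<bullet> dual ((dual ^^ n) y) = N x \<bullet> (dual ^^ n) y"
    unfolding dual_def by (rule adjoint_works [OF linear_N])
  then show ?case
    using Suc [of "N x"] by (simp add: funpow_swap1 [of N])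
qed simp

text \<open>Pairing the vector with itself moves the iterates from the adjoint back to
  \<open>N\<close>, so the constants are the same.\<close>

lemma dual_decay: "norm ((dual ^^ n) y) \<le> C * r ^ n * norm y"
proof -
  let ?z = "(dual ^^ n) y"
  have "norm ?z * norm ?z = (N ^^ n) ?z \<bullet> y"
    using inner_funpow_dual [of ?z n y] by (simp add: power2_norm_eq_inner flip: power2_eq_square)
  also have "\<dots> \<le> norm ((N ^^ n) ?z) * norm y" by (rule norm_cauchy_schwarz)
  also have "\<dots> \<le> (C * r ^ n * norm ?z) * norm y" by (intro mult_right_mono decay) simp
  finally have "norm ?z * norm ?z \<le> (C * r ^ n * norm y) * norm ?z" by (simp add: mult_ac)
  then show ?thesis
    using C_pos r_pos by (cases "norm ?z = 0") (auto simp: mult_le_cancel_right)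
qed

lemma dual_tendsto_0: "(\<lambda>n. (dual ^^ n) x) \<longlonglongrightarrow> 0"
proof (rule Lim_null_comparison)
  have "(\<lambda>n. C * r ^ n * norm x) \<longlonglongrightarrow> C * 0 * norm x"
    using r_pos r_less_1 by (intro tendsto_intros LIMSEQ_realpow_zero) auto
  then show "(\<lambda>n. C * r ^ n * norm x) \<longlonglongrightarrow> 0" by simp
qed (simp add: dual_decay)

lemma char_fun_invariant:
  assumes "invariant \<mu>"
  shows "char_fun \<mu> x = mask D (dual x) * char_fun \<mu> (dual x)"
proof -
  interpret borel_prob \<mu> using assms(1) by (simp add: invariant_iff_transfer)
  have tr: "transfer \<mu> = \<mu>" using assms(1) by (simp add: invariant_iff_transfer)
  have "char_fun \<mu> x = (LINT y|transfer \<mu>. ee (x \<bullet> y))"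
    by (simp add: tr char_fun_def)
  also have "\<dots> = (1 / real (card D)) *\<^sub>R (\<Sum>d\<in>D. LINT y|\<mu>. ee (x \<bullet> N (y + d)))"
    by (rule integral_transfer [OF borel_prob_axioms, where B = 1])
       (auto intro!: measurable_compose [OF _ measurable_ee])
  also have "\<dots> = (1 / real (card D)) *\<^sub>R (\<Sum>d\<in>D. ee (d \<bullet> dual x) * char_fun \<mu> (dual x))"
  proof -
    have "x \<bullet> N (y + d) = d \<bullet> dual x + dual x \<bullet> y" for y d
    proof -
      have "x \<bullet> N (y + d) = (y + d) \<bullet> dual x"
        using inner_funpow_dual [of "y + d" 1 x] by (simp add: inner_commute [of x])
      then show ?thesis
        by (simp add: inner_add_left inner_commute [of y])
    qed
    then show ?thesis by (simp add: ee_add char_fun_def)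
  qed
  finally show ?thesis
    by (simp add: mask_def sum_distrib_right scaleR_conv_of_real)
qed

lemma char_fun_invariant_funpow:
  assumes "invariant \<mu>"
  shows "char_fun \<mu> x = (\<Prod>i=1..n. mask D ((dual ^^ i) x)) * char_fun \<mu> ((dual ^^ n) x)"
proof (induction n)
  case (Suc n)
  then show ?case
    using char_fun_invariant [OF assms, of "(dual ^^ n) x"] by (simp add: mult_ac)
qed simp

lemma char_fun_dual_tendsto_1:
  assumes "invariant \<mu>"
  shows "(\<lambda>n. char_fun \<mu> ((dual ^^ n) x)) \<longlonglongrightarrow> 1"
proof -
  interpret borel_prob \<mu> using assms(1) by (simp add: invariant_iff_transfer)
  have "isCont (char_fun \<mu>) 0"
    using continuous_on_char_fun [of UNIV] by (simp add: continuous_on_eq_continuous_at)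
  from isCont_tendsto_compose [OF this dual_tendsto_0] show ?thesis by simp
qed

text \<open>The tails of the product tend to 1 and are eventually nonzero, so a zero must come from
  one of finitely many factors.\<close>

lemma char_fun_eq_0_iff:
  assumes "invariant \<mu>"
  shows "char_fun \<mu> x = 0 \<longleftrightarrow> (\<exists>i\<ge>1. mask D ((dual ^^ i) x) = 0)"
proof
  assume 0: "char_fun \<mu> x = 0"
  have "\<forall>\<^sub>F n in sequentially. char_fun \<mu> ((dual ^^ n) x) \<noteq> 0"
    by (rule tendsto_imp_eventually_ne [OF char_fun_dual_tendsto_1 [OF assms]]) simp
  then obtain n where "char_fun \<mu> ((dual ^^ n) x) \<noteq> 0"
    by (auto simp: eventually_sequentially)
  then have "(\<Prod>i=1..n. mask D ((dual ^^ i) x)) = 0"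
    using 0 char_fun_invariant_funpow [OF assms, of x n] by simp
  then show "\<exists>i\<ge>1. mask D ((dual ^^ i) x) = 0" by auto
next
  assume "\<exists>i\<ge>1. mask D ((dual ^^ i) x) = 0"
  then obtain i where "i \<ge> 1" "mask D ((dual ^^ i) x) = 0" by blast
  then have "(\<Prod>i=1..i. mask D ((dual ^^ i) x)) = 0" by (auto simp: prod_zero_iff)
  then show "char_fun \<mu> x = 0"
    using char_fun_invariant_funpow [OF assms, of x i] by simp
qed

end

section \<open>Three planar digits\<close>

definition modvec3 :: "int ^ 'n \<Rightarrow> 3 ^ 'n" where
  "modvec3 v = (\<chi> i. of_int (v $ i))"

declare transpose_matrix_vector [simp del]

lemma modvec3_eq_0_iff: "modvec3 v = 0 \<longleftrightarrow> (\<forall>i. 3 dvd v $ i)"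
  by (simp add: modvec3_def vec_eq_iff of_int_mod3_eq_0_iff)

lemma modvec3_mult: "modvec3 (A *v v) = mod3 A *v modvec3 v"
  by (simp add: modvec3_def mod3_def map_matrix_def matrix_vector_mult_def vec_eq_iff)

lemma mod3_transpose: "mod3 (transpose A) = transpose (mod3 A)"
  by (simp add: mod3_def map_matrix_def transpose_def vec_eq_iff)

lemma not_dvd3_square: "\<not> 3 dvd b \<Longrightarrow> 3 dvd b * b - (1 :: int)"
proof -
  assume "\<not> 3 dvd b"
  then have "\<exists>k. b = 3 * k + 1 \<or> b = 3 * k + 2" by presburger
  then obtain k where "b = 3 * k + 1 \<or> b = 3 * k + 2" by blast
  then have "b * b - 1 = 3 * (3 * k * k + 2 * k) \<or> b * b - 1 = 3 * (3 * k * k + 4 * k + 1)"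
    by (auto simp: algebra_simps)
  then show "3 dvd b * b - 1" by (metis dvd_triv_left)
qed

lemma dvd3_cancel: "3 dvd b * c \<Longrightarrow> \<not> 3 dvd b \<Longrightarrow> 3 dvd (c :: int)"
  using prime_dvd_mult_iff [of "3 :: int" b c] by simp

text \<open>The vector \<open>u = (\<alpha>\<^sub>2 + \<beta>\<^sub>2, -\<alpha>\<^sub>1 - \<beta>\<^sub>1)\<close> satisfies \<open>B\<^sup>* u = det B (1, -1)\<close>,
  so modulo 3 it is a multiple of \<open>A\<^sup>* (1, -1)\<close>.\<close>

lemma kernel_condition_iff:
  fixes M B :: "int ^ 2 ^ 2"
  assumes B: "B = vector [vector [\<alpha>1, \<beta>1], vector [\<alpha>2, \<beta>2]]"
    and nd: "\<not> 3 dvd \<alpha>1 * \<beta>2 - \<alpha>2 * \<beta>1"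
  shows "(\<exists>A \<in> GL2_3. mod3 (A ** B) = mat 1 \<and>
            (\<forall>i. 3 dvd (transpose (A ** M ** B) *v vector [1, -1]) $ i))
     \<longleftrightarrow> (\<forall>i. 3 dvd (transpose M *v vector [\<alpha>2 + \<beta>2, - \<alpha>1 - \<beta>1]) $ i)"
    (is "?L \<longleftrightarrow> ?R")
proof -
  define e :: "int ^ 2" where "e = vector [1, -1]"
  define u :: "int ^ 2" where "u = vector [\<alpha>2 + \<beta>2, - \<alpha>1 - \<beta>1]"
  have det: "det B = \<alpha>1 * \<beta>2 - \<alpha>2 * \<beta>1"
    by (simp add: B det_2)
  then have nd': "\<not> 3 dvd det B" using nd by simp
  have Bu: "transpose B *v u = det B *s e"
    unfolding det by (simp add: vec_eq_iff forall_2 matrix_vector_mult_def sum_2 transpose_def B u_def e_def algebra_simps)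
  have iff: "(\<forall>i. 3 dvd (transpose (A ** M ** B) *v e) $ i) \<longleftrightarrow> (\<forall>i. 3 dvd (transpose M *v u) $ i)"
    if A: "mod3 (A ** B) = mat 1" for A
  proof -
    obtain A' where A': "mod3 (A' ** B) = mat 1" "mod3 (B ** A') = mat 1"
      using ex_inverse_mod3 [OF nd'] by blast
    have "mod3 A = mod3 A'"
      using inverse_mod3_unique [OF nd' A A'(1)] .
    then have BA: "mod3 (B ** A) = mat 1"
      using A'(2) by (simp add: mod3_mult)
    have tAB: "mod3 (transpose A) ** mod3 (transpose B) = mat 1"
      using arg_cong [OF BA, of transpose]
      by (simp add: mod3_mult mod3_transpose matrix_transpose_mul)
    have "modvec3 u = modvec3 (transpose A *v (transpose B *v u))"
      unfolding modvec3_mult unfolding matrix_vector_mul_assoc tAB by simp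
    also have "transpose A *v (transpose B *v u) = det B *s (transpose A *v e)"
      unfolding Bu by (simp add: vec_eq_iff matrix_vector_mult_def sum_distrib_left mult_ac)
    finally have "modvec3 (transpose M *v u) = modvec3 (transpose M *v (det B *s (transpose A *v e)))"
      by (simp add: modvec3_mult)
    also have "transpose M *v (det B *s (transpose A *v e)) = det B *s (transpose M *v (transpose A *v e))"
      by (simp add: vec_eq_iff matrix_vector_mult_def sum_distrib_left mult_ac)
    finally have "modvec3 (transpose M *v u) = 0 \<longleftrightarrow> (\<forall>i. 3 dvd det B * (transpose M *v (transpose A *v e)) $ i)"
      by (simp add: modvec3_eq_0_iff)
    also have "\<dots> \<longleftrightarrow> modvec3 (transpose M *v (transpose A *v e)) = 0"
      unfolding modvec3_eq_0_iff using dvd3_cancel [OF _ nd'] dvd_mult by blast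
    also have "\<dots> \<longleftrightarrow> modvec3 (transpose B *v (transpose M *v (transpose A *v e))) = 0"
    proof
      assume "modvec3 (transpose B *v (transpose M *v (transpose A *v e))) = 0"
      then have "mod3 (transpose A) *v (mod3 (transpose B) *v modvec3 (transpose M *v (transpose A *v e))) = 0"
        by (simp add: modvec3_mult)
      then show "modvec3 (transpose M *v (transpose A *v e)) = 0"
        by (simp add: matrix_vector_mul_assoc [of "mod3 (transpose A)"] tAB)
    qed (simp add: modvec3_mult)
    finally show ?thesis
      by (simp add: modvec3_eq_0_iff matrix_transpose_mul matrix_vector_mul_assoc matrix_mul_assoc)
  qed
  obtain A where A: "A \<in> GL2_3" "mod3 (A ** B) = mat 1"
    using ex_inverse_mod3 [OF nd'] by blast
  show ?thesis
    unfolding e_def [symmetric] u_def [symmetric] using iff A by blast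
qed

section \<open>Extreme values of a sum of three complex numbers of modulus 1\<close>

lemma sum_unit_eq_0:
  assumes "cmod z = 1" "cmod w = 1" "1 + z + w = 0"
  shows "z = ee (1/3) \<and> w = ee (- 1/3) \<or> z = ee (- 1/3) \<and> w = ee (1/3)"
proof -
  have z: "(Re z)\<^sup>2 + (Im z)\<^sup>2 = 1" and w: "(Re w)\<^sup>2 + (Im w)\<^sup>2 = 1"
    using assms(1,2) by (simp_all add: cmod_def)
  have re: "Re w = - 1 - Re z" and im: "Im w = - Im z"
    using assms(3) by (simp_all add: complex_eq_iff)
  have rz: "Re z = - 1/2"
    using z w unfolding re im by (simp add: power2_eq_square algebra_simps)
  then have "(Im z)\<^sup>2 = (sqrt 3 / 2)\<^sup>2"
    using z by (simp add: power_divide)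
  then have "Im z = sqrt 3 / 2 \<or> Im z = - (sqrt 3 / 2)"
    by (simp add: power2_eq_iff)
  moreover have "ee (1/3) = Complex (- 1/2) (sqrt 3 / 2)"
    using cos_120 sin_120 by (simp add: ee_eq_cis complex_eq_iff)
  moreover have "ee (- 1/3) = cnj (ee (1/3))"
    using ee_minus [of "1/3"] by simp
  ultimately show ?thesis
    using rz re im by (auto simp: complex_eq_iff)
qed

lemma ee_eq_iff: "ee s = ee t \<longleftrightarrow> s - t \<in> \<int>"
proof -
  have "ee s = ee t \<longleftrightarrow> ee (s - t) = 1"
  proof
    assume "ee (s - t) = 1"
    then have "ee (s - t) * ee t = ee t" by simp
    then show "ee s = ee t" by (simp flip: ee_add)
  qed (simp add: ee_diff)
  then show ?thesis by (simp add: ee_eq_1_iff)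
qed

lemma ee_sum_eq_0:
  assumes "1 + ee s + ee t = 0"
  shows "s - 1/3 \<in> \<int> \<and> t + 1/3 \<in> \<int> \<or> s + 1/3 \<in> \<int> \<and> t - 1/3 \<in> \<int>"
  using sum_unit_eq_0 [OF norm_ee norm_ee assms] by (simp add: ee_eq_iff)

text \<open>The equality case of the triangle inequality. It identifies points where the mask has
  modulus 1 as periods of the mask.\<close>

lemma norm_ee_sum_eq_3:
  assumes "cmod (1 + ee s + ee t) = 3"
  shows "s \<in> \<int> \<and> t \<in> \<int>"
proof -
  have one: "z = 1" if "cmod z = 1" "cmod w = 1" "cmod (1 + z + w) = 3" for z w
  proof -
    have "3 \<le> cmod (1 + z) + cmod w"
      using that(3) norm_triangle_ineq [of "1 + z" w] by simp
    then have "2\<^sup>2 \<le> (cmod (1 + z))\<^sup>2"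
      using that(2) by (intro power_mono) auto
    moreover have n: "(Re z)\<^sup>2 + (Im z)\<^sup>2 = 1"
      using that(1) by (simp add: cmod_def)
    moreover have "(cmod (1 + z))\<^sup>2 = 1 + 2 * Re z + ((Re z)\<^sup>2 + (Im z)\<^sup>2)"
      by (simp add: cmod_def) (simp add: power2_eq_square algebra_simps)
    ultimately have "1 \<le> Re z" by simp
    moreover have "Re z \<le> 1" using that(1) complex_Re_le_cmod [of z] by simp
    ultimately have "Re z = 1" by simp
    then show ?thesis using n by (simp add: complex_eq_iff)
  qed
  have "ee s = 1" "ee t = 1"
    using one [of "ee s" "ee t"] one [of "ee t" "ee s"] assms by (simp_all add: add_ac)
  then show ?thesis by (simp add: ee_eq_1_iff)
qed

locale three_digits =
  contractive_ifs "(*v) (matrix_inv (map_matrix real_of_int M))"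
    "real_vec ` {vector [0, 0], vector [\<alpha>1, \<alpha>2], vector [\<beta>1, \<beta>2]}" C r
  for M :: "int ^ 2 ^ 2" and \<alpha>1 \<alpha>2 \<beta>1 \<beta>2 :: int and C r :: real +
  assumes invertible_M: "invertible (map_matrix real_of_int M)"
    and not_dvd: "\<not> 3 dvd \<alpha>1 * \<beta>2 - \<alpha>2 * \<beta>1"
begin

definition b :: int where "b = \<alpha>1 * \<beta>2 - \<alpha>2 * \<beta>1"

definition u :: "int ^ 2" where "u = vector [\<alpha>2 + \<beta>2, - \<alpha>1 - \<beta>1]"

definition R :: "real ^ 2 \<Rightarrow> real ^ 2" where
  "R x = transpose (map_matrix real_of_int M) *v x"

abbreviation digits :: "(int ^ 2) set" where
  "digits \<equiv> {vector [0, 0], vector [\<alpha>1, \<alpha>2], vector [\<beta>1, \<beta>2]}"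

definition m :: "real ^ 2 \<Rightarrow> complex" where
  "m = mask (real_vec ` digits)"

text \<open>With \<open>lb\<close>, the coordinates of B^* x: zeros and periods of the mask are
  described by these two numbers modulo 1.\<close>

definition la :: "real ^ 2 \<Rightarrow> real" where "la x = \<alpha>1 * x$1 + \<alpha>2 * x$2"
definition lb :: "real ^ 2 \<Rightarrow> real" where "lb x = \<beta>1 * x$1 + \<beta>2 * x$2"

lemma la_add: "la (x + y) = la x + la y" and lb_add: "lb (x + y) = lb x + lb y"
  and la_minus: "la (- x) = - la x" and lb_minus: "lb (- x) = - lb x"
  and la_0 [simp]: "la 0 = 0" and lb_0 [simp]: "lb 0 = 0"
  by (simp_all add: la_def lb_def algebra_simps)

lemma b_nz: "b \<noteq> 0" using not_dvd by (auto simp: b_def)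

lemma digits_distinct:
  "vector [0, 0] \<noteq> (vector [\<alpha>1, \<alpha>2] :: int ^ 2)" "vector [0, 0] \<noteq> (vector [\<beta>1, \<beta>2] :: int ^ 2)"
  "vector [\<alpha>1, \<alpha>2] \<noteq> (vector [\<beta>1, \<beta>2] :: int ^ 2)"
  using b_nz by (auto simp: vec_eq_iff forall_2 b_def)

lemma inj_real_vec: "inj real_vec"
  by (auto simp: inj_def real_vec_def vec_eq_iff)

lemma sum_digits:
  "(\<Sum>d\<in>digits. f d) = f (vector [0, 0]) + f (vector [\<alpha>1, \<alpha>2]) + f (vector [\<beta>1, \<beta>2])"
  for f :: "int ^ 2 \<Rightarrow> 'b::comm_monoid_add"
  using digits_distinct by (simp add: add_ac)

lemma card_digits: "card digits = 3"
  using digits_distinct by simp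

lemma real_vec_digit_inner:
  "real_vec (vector [0, 0] :: int ^ 2) \<bullet> x = 0"
  "real_vec (vector [\<alpha>1, \<alpha>2] :: int ^ 2) \<bullet> x = la x"
  "real_vec (vector [\<beta>1, \<beta>2] :: int ^ 2) \<bullet> x = lb x"
  by (simp_all add: real_vec_def inner_vec_def sum_2 la_def lb_def)

lemma mask_digits: "m x = (\<Sum>d\<in>digits. ee (real_vec d \<bullet> x)) / 3"
proof -
  have "inj_on real_vec digits" by (rule inj_on_subset [OF inj_real_vec]) simp
  then show ?thesis
    unfolding m_def mask_def by (simp only: sum.reindex card_image card_digits o_def of_nat_numeral)
qed

lemma mask_eq: "m x = (1 + ee (la x) + ee (lb x)) / 3"
  unfolding mask_digits sum_digits real_vec_digit_inner by simp

lemma mask_0 [simp]: "m 0 = 1" by (simp add: mask_eq)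

lemma mask_periodic:
  assumes "la y \<in> \<int>" "lb y \<in> \<int>"
  shows "m (x + y) = m x"
  using assms by (simp add: mask_eq la_add lb_add ee_add flip: ee_eq_1_iff)

lemma norm_mask_eq_1: "cmod (m x) = 1 \<Longrightarrow> la x \<in> \<int> \<and> lb x \<in> \<int>"
  using norm_ee_sum_eq_3 [of "la x" "lb x"] by (simp add: mask_eq norm_divide)

lemma norm_mask_le_1: "cmod (m x) \<le> 1"
proof -
  have "cmod (1 + ee (la x) + ee (lb x)) \<le> 3"
    using norm_triangle_ineq [of "1 + ee (la x)" "ee (lb x)"] norm_triangle_ineq [of 1 "ee (la x)"] by simp
  then show ?thesis by (simp add: mask_eq norm_divide)
qed

section \<open>Zeros of the mask and their residues modulo 3\<close>

definition zero_pos :: "real ^ 2 \<Rightarrow> bool" where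
  "zero_pos x \<longleftrightarrow> la x - 1/3 \<in> \<int> \<and> lb x + 1/3 \<in> \<int>"

lemma mask_eq_0: "m x = 0 \<Longrightarrow> zero_pos x \<or> zero_pos (- x)"
proof -
  assume "m x = 0"
  then have "la x - 1/3 \<in> \<int> \<and> lb x + 1/3 \<in> \<int> \<or> la x + 1/3 \<in> \<int> \<and> lb x - 1/3 \<in> \<int>"
    by (intro ee_sum_eq_0) (simp add: mask_eq)
  moreover have "- (la x + 1/3) = la (- x) - 1/3" "- (lb x - 1/3) = lb (- x) + 1/3"
    by (simp_all add: la_minus lb_minus)
  ultimately show ?thesis
    unfolding zero_pos_def by (metis Ints_minus)
qed

text \<open>\<open>in_class v x\<close> means \<open>3 b x \<in> v + 3 \<int>\<^sup>2\<close>; it records the residue modulo 3 of \<open>3 b x\<close>.\<close>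

definition in_class :: "int ^ 2 \<Rightarrow> real ^ 2 \<Rightarrow> bool" where
  "in_class v x \<longleftrightarrow> (\<exists>n :: int ^ 2. \<forall>i. 3 * of_int b * x$i = of_int (v$i + 3 * n$i))"

lemma in_class_add: "in_class v x \<Longrightarrow> in_class w y \<Longrightarrow> in_class (v + w) (x + y)"
  unfolding in_class_def
proof (elim exE)
  fix n k :: "int ^ 2"
  assume "\<forall>i. 3 * of_int b * x$i = of_int (v$i + 3 * n$i)" "\<forall>i. 3 * of_int b * y$i = of_int (w$i + 3 * k$i)"
  then show "\<exists>n :: int ^ 2. \<forall>i. 3 * of_int b * (x + y)$i = of_int ((v + w)$i + 3 * n$i)"
    by (intro exI [of _ "n + k"]) (simp add: algebra_simps)
qed

lemma in_class_minus: "in_class v x \<Longrightarrow> in_class (- v) (- x)"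
  unfolding in_class_def
proof (elim exE)
  fix n :: "int ^ 2"
  assume "\<forall>i. 3 * of_int b * x$i = of_int (v$i + 3 * n$i)"
  then show "\<exists>n :: int ^ 2. \<forall>i. 3 * of_int b * (- x)$i = of_int ((- v)$i + 3 * n$i)"
    by (intro exI [of _ "- n"]) simp
qed

lemma in_class_diff: "in_class v x \<Longrightarrow> in_class w y \<Longrightarrow> in_class (v - w) (x - y)"
  using in_class_add [OF _ in_class_minus] by fastforce

lemma in_class_unique:
  assumes "in_class v x" "in_class w x"
  shows "3 dvd v$i - w$i"
proof -
  obtain n k :: "int ^ 2" where "3 * of_int b * x$i = real_of_int (v$i + 3 * n$i)"
    "3 * of_int b * x$i = real_of_int (w$i + 3 * k$i)"
    using assms unfolding in_class_def by blast
  then have "real_of_int (v$i + 3 * n$i) = real_of_int (w$i + 3 * k$i)" by simp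
  then have "v$i - w$i = 3 * (k$i - n$i)" by (simp only: of_int_eq_iff) simp
  then show ?thesis by simp
qed

lemma in_class_cong:
  assumes "in_class v x" "\<And>i. 3 dvd v$i - w$i"
  shows "in_class w x"
proof -
  obtain n :: "int ^ 2" where n: "\<And>i. 3 * of_int b * x$i = real_of_int (v$i + 3 * n$i)"
    using assms(1) unfolding in_class_def by blast
  have "v$i + 3 * n$i = w$i + 3 * (n + (\<chi> i. (v$i - w$i) div 3))$i" for i
    using assms(2) [of i] by simp
  then show ?thesis
    unfolding in_class_def n by (intro exI [of _ "n + (\<chi> i. (v$i - w$i) div 3)"]) metis
qed

lemma in_class_R:
  assumes "in_class v x"
  shows "in_class (transpose M *v v) (R x)"
proof -
  obtain n :: "int ^ 2" where n: "\<And>i. 3 * of_int b * x$i = real_of_int (v$i + 3 * n$i)"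
    using assms unfolding in_class_def by blast
  have "3 * of_int b * (R x)$i = of_int ((transpose M *v v)$i + 3 * (transpose M *v n)$i)" for i
  proof -
    have "3 * of_int b * (R x)$i = (\<Sum>j\<in>UNIV. real_of_int (M$j$i) * (3 * of_int b * x$j))"
      by (simp add: R_def matrix_vector_mult_def transpose_def map_matrix_def sum_distrib_left mult_ac)
    also have "\<dots> = of_int ((transpose M *v v)$i + 3 * (transpose M *v n)$i)"
      unfolding n
      by (simp add: matrix_vector_mult_def transpose_def sum_distrib_left sum.distrib [symmetric] algebra_simps)
    finally show ?thesis .
  qed
  then show ?thesis unfolding in_class_def by blast
qed

text \<open>Cramer's rule; this is where the denominator \<open>b\<close> of the zeros comes
  from.\<close>

lemma b_times_component:
  "of_int b * x$1 = of_int \<beta>2 * la x - of_int \<alpha>2 * lb x"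
  "of_int b * x$2 = of_int \<alpha>1 * lb x - of_int \<beta>1 * la x"
  by (simp_all add: b_def la_def lb_def algebra_simps)

lemma zero_pos_in_class: "zero_pos x \<Longrightarrow> in_class u x"
proof -
  assume "zero_pos x"
  then obtain k l :: int where "la x - 1/3 = of_int k" "lb x + 1/3 = of_int l"
    unfolding zero_pos_def by (auto elim!: Ints_cases)
  then have k: "la x = 1/3 + of_int k" "lb x = - 1/3 + of_int l" by auto
  have "3 * of_int b * x$1 = real_of_int (u$1 + 3 * (\<beta>2 * k - \<alpha>2 * l))"
    "3 * of_int b * x$2 = real_of_int (u$2 + 3 * (\<alpha>1 * l - \<beta>1 * k))"
    using b_times_component [of x] by (simp_all add: k u_def algebra_simps)
  then show ?thesis
    unfolding in_class_def by (intro exI [of _ "vector [\<beta>2 * k - \<alpha>2 * l, \<alpha>1 * l - \<beta>1 * k]"]) (simp add: forall_2)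
qed

lemma mask_eq_0_in_class: "m x = 0 \<Longrightarrow> in_class u x \<or> in_class (- u) x"
  using mask_eq_0 [of x] zero_pos_in_class [of x] in_class_minus [OF zero_pos_in_class, of "- x"] by auto

lemma period_in_class_0: "la x \<in> \<int> \<Longrightarrow> lb x \<in> \<int> \<Longrightarrow> in_class 0 x"
proof -
  assume "la x \<in> \<int>" "lb x \<in> \<int>"
  then obtain k l :: int where k: "la x = of_int k" "lb x = of_int l"
    by (auto elim!: Ints_cases)
  have "3 * of_int b * x$1 = real_of_int (0 + 3 * (\<beta>2 * k - \<alpha>2 * l))"
    "3 * of_int b * x$2 = real_of_int (0 + 3 * (\<alpha>1 * l - \<beta>1 * k))"
    using b_times_component [of x] by (simp_all add: k algebra_simps)
  then show ?thesis
    unfolding in_class_def by (intro exI [of _ "vector [\<beta>2 * k - \<alpha>2 * l, \<alpha>1 * l - \<beta>1 * k]"]) (simp add: forall_2)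
qed

lemma R_dual [simp]: "R (dual x) = x" and dual_R [simp]: "dual (R x) = x"
proof -
  have d: "dual x = transpose (matrix_inv (map_matrix real_of_int M)) *v x" for x
    unfolding dual_def by (simp add: adjoint_matrix)
  show "R (dual x) = x" "dual (R x) = x"
    unfolding R_def d matrix_vector_mul_assoc matrix_transpose_mul [symmetric] matrix_inv [OF invertible_M]
    by (simp_all add: transpose_mat)
qed

lemma R_add: "R (x + y) = R x + R y" and R_diff: "R (x - y) = R x - R y"
  and R_minus: "R (- x) = - R x" and R_0 [simp]: "R 0 = 0"
  by (simp_all add: R_def matrix_vector_right_distrib matrix_vector_mult_diff_distrib
      linear_neg [OF matrix_vector_mul_linear])

lemma dual_add: "dual (x + y) = dual x + dual y" and dual_diff: "dual (x - y) = dual x - dual y"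
  and dual_minus: "dual (- x) = - dual x" and dual_0 [simp]: "dual 0 = 0"
  using linear_dual by (simp_all add: linear_add linear_diff linear_neg linear_0)

lemma R_real_vec: "R (real_vec v) = real_vec (transpose M *v v)"
  by (simp add: R_def real_vec_def vec_eq_iff matrix_vector_mult_def map_matrix_def transpose_def)

lemma la_lb_real_vec: "la (real_vec v) \<in> \<int>" "lb (real_vec v) \<in> \<int>"
  by (simp_all add: la_def lb_def real_vec_def)

lemma inner_digit_dual: "(matrix_inv (map_matrix real_of_int M) *v x) \<bullet> y = x \<bullet> dual y"
  using inner_funpow_dual [of x 1 y] by simp

lemma kernel_imp_integer_zero:
  assumes "\<forall>i. 3 dvd (transpose M *v u) $ i"
  obtains s where "zero_pos (dual (real_vec s))"
proof -
  \<comment> \<open>Then \<open>dual (real_vec s)\<close> is (b/3) u, and the pairings of u with the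
    two digits are b and -b. The extra factor \<open>b\<close> turns the numerators into squares,
    which are 1 modulo 3 whatever the sign of b modulo 3.\<close>
  define s :: "int ^ 2" where "s = (\<chi> i. b * ((transpose M *v u) $ i div 3))"
  have "real_vec s = R ((of_int b / 3) *\<^sub>R real_vec u)"
  proof -
    have "real_of_int (c div 3) = of_int c / 3" if "3 dvd c" for c :: int
      using that by (auto elim!: dvdE)
    then have "real_vec s = (of_int b / 3) *\<^sub>R real_vec (transpose M *v u)"
      using assms by (simp add: s_def real_vec_def vec_eq_iff)
    then show ?thesis
      by (simp add: R_def matrix_vector_mult_scaleR flip: R_real_vec)
  qed
  then have s: "dual (real_vec s) = (of_int b / 3) *\<^sub>R real_vec u" by simp
  have "la (dual (real_vec s)) = of_int (b * b) / 3" "lb (dual (real_vec s)) = - of_int (b * b) / 3"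
  proof -
    have "la (real_vec u) = of_int b" "lb (real_vec u) = - of_int b"
      by (simp_all add: la_def lb_def real_vec_def u_def b_def algebra_simps)
    moreover have "la (c *\<^sub>R x) = c * la x" "lb (c *\<^sub>R x) = c * lb x" for c x
      by (simp_all add: la_def lb_def algebra_simps)
    ultimately show "la (dual (real_vec s)) = of_int (b * b) / 3" "lb (dual (real_vec s)) = - of_int (b * b) / 3"
      by (simp_all add: s)
  qed
  moreover obtain k where "b * b - 1 = 3 * k"
    using not_dvd3_square [of b] not_dvd by (auto simp: b_def elim: dvdE)
  then have "b * b = 1 + 3 * k" by simp
  ultimately have "la (dual (real_vec s)) - 1/3 = of_int k" "lb (dual (real_vec s)) + 1/3 = of_int (- k)"
    by simp_all
  then have "zero_pos (dual (real_vec s))"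
    unfolding zero_pos_def by (metis Ints_of_int)
  then show thesis by (rule that)
qed

text \<open>Two columns of the unitary matrix already give an integer vector whose preimage under R
  is a zero of the mask: its residue is 0 by integrality and also \<plusminus>R u. Conversely the
  frequencies 0, s, -s produce the Fourier matrix of order 3.\<close>

lemma admissible_iff: "admissible M digits \<longleftrightarrow> (\<forall>i. 3 dvd (transpose M *v u) $ i)"
proof
  assume "admissible M digits"
  then obtain S where S: "finite S" "card S = 3"
    and un: "unitary_on digits S (\<lambda>d s. 1 / complex_of_real (sqrt (real (card S))) *
             exp (2 * complex_of_real pi * \<i> * complex_of_real
               ((matrix_inv (map_matrix real_of_int M) *v real_vec d) \<bullet> real_vec s)))"
    unfolding admissible_def card_digits by blast
  define H where "H d s = 1 / complex_of_real (sqrt 3) * ee (real_vec d \<bullet> dual (real_vec s))" for d s :: "int ^ 2"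
  have un: "unitary_on digits S H"
    using un unfolding S(2) inner_digit_dual H_def ee_def by simp
  obtain s s' where s: "s \<in> S" "s' \<in> S" "s \<noteq> s'"
    using S(2) by (metis One_nat_def card_le_Suc0_iff_eq S(1) Suc_1 numeral_3_eq_3 not_less_eq_eq lessI less_imp_le_nat order_refl)
  have "(\<Sum>d\<in>digits. cnj (H d s) * H d s') = 0"
    using un s unfolding unitary_on_def by auto
  moreover have "cnj (H d s) * H d s' = ee (real_vec d \<bullet> dual (real_vec s' - real_vec s)) / 3" for d
    by (simp add: H_def dual_diff inner_diff_right ee_diff mult_ac flip: of_real_mult)
  ultimately have 0: "m (dual (real_vec s' - real_vec s)) = 0"
    by (simp add: mask_digits sum_divide_distrib)
  define y where "y = real_vec s' - real_vec s"
  have "in_class (transpose M *v u) y \<or> in_class (transpose M *v (- u)) y"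
    using mask_eq_0_in_class [OF 0] in_class_R [of _ "dual y"] unfolding y_def [symmetric] by auto
  moreover have "in_class 0 y"
    using la_lb_real_vec by (auto intro!: period_in_class_0 simp: y_def la_add lb_add la_minus lb_minus
        diff_conv_add_uminus simp del: add_uminus_conv_diff)
  ultimately have "(\<forall>i. 3 dvd (transpose M *v u)$i - 0$i) \<or> (\<forall>i. 3 dvd (transpose M *v (- u))$i - 0$i)"
    using in_class_unique by blast
  moreover have "(transpose M *v (- u))$i = - (transpose M *v u)$i" for i
    by (simp add: matrix_vector_mult_def sum_negf)
  ultimately show "\<forall>i. 3 dvd (transpose M *v u) $ i" by simp
next
  assume "\<forall>i. 3 dvd (transpose M *v u) $ i"
  then obtain s where s: "zero_pos (dual (real_vec s))" by (rule kernel_imp_integer_zero)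
  define \<omega> where "\<omega> = ee (1/3)"
  define e where "e d t = ee (real_vec d \<bullet> dual (real_vec t))" for d t :: "int ^ 2"
  have e1: "e (vector [\<alpha>1, \<alpha>2]) s = \<omega>" "e (vector [\<beta>1, \<beta>2]) s = cnj \<omega>"
    using s ee_minus [of "1/3"]
    by (auto simp: e_def real_vec_digit_inner \<omega>_def ee_eq_iff zero_pos_def simp flip: ee_minus)
  have rv: "real_vec (- s) = - real_vec s" "real_vec (0 :: int ^ 2) = 0"
    by (simp_all add: real_vec_def vec_eq_iff)
  have e2: "e (vector [\<alpha>1, \<alpha>2]) (- s) = cnj \<omega>" "e (vector [\<beta>1, \<beta>2]) (- s) = \<omega>"
    using e1 by (simp_all add: e_def rv dual_minus ee_minus)
  have e3: "e (vector [0, 0]) t = 1" "e d 0 = 1" for t d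
    by (simp_all add: e_def real_vec_digit_inner rv)
  have ri: "Re \<omega> = - 1/2" "Im \<omega> = sqrt 3 / 2"
    using cos_120 sin_120 by (simp_all add: \<omega>_def ee_eq_cis)
  then have "Re \<omega> = - 1/2" "Im \<omega> * Im \<omega> = 3 / 4" "Im \<omega> \<noteq> 0"
    unfolding ri by simp_all
  then have w: "1 + \<omega> + cnj \<omega> = 0" "\<omega> * \<omega> = cnj \<omega>" "cnj \<omega> * cnj \<omega> = \<omega>" "\<omega> * cnj \<omega> = 1" "cnj \<omega> * \<omega> = 1" "\<omega> \<noteq> cnj \<omega>" "\<omega> \<noteq> 1" "cnj \<omega> \<noteq> 1"
    by (auto simp: complex_eq_iff)
  have w0: "1 + cnj \<omega> + \<omega> = 0" "\<omega> + cnj \<omega> + 1 = 0" "cnj \<omega> + \<omega> + 1 = 0"  "\<omega> + 1 + cnj \<omega> = 0" "cnj \<omega> + 1 + \<omega> = 0"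
    using w(1) by (simp_all add: add_ac)
  define S where "S = {0, s, - s}"
  have ds: "0 \<noteq> s" "0 \<noteq> - s" "s \<noteq> - s"
    using e1 e2 e3 w by metis+
  have cS: "finite S" "card S = 3"
    using ds by (simp_all add: S_def)
  have sumS: "(\<Sum>t\<in>S. f t) = f 0 + f s + f (- s)" for f :: "int ^ 2 \<Rightarrow> complex"
    using ds by (simp add: S_def add_ac)
  have "unitary_on digits S (\<lambda>d t. 1 / complex_of_real (sqrt 3) * e d t)"
  proof -
    have nrm: "1 / complex_of_real (sqrt 3) * x * cnj (1 / complex_of_real (sqrt 3) * y) = x * cnj y / 3"
      "cnj (1 / complex_of_real (sqrt 3) * y) * (1 / complex_of_real (sqrt 3) * x) = cnj y * x / 3" for x y
      by (simp_all add: mult_ac flip: of_real_mult)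
    show ?thesis
      unfolding unitary_on_def nrm sumS sum_digits
      unfolding S_def
      using digits_distinct ds
      by (simp add: e1 e2 e3 w w0 flip: add_divide_distrib)
  qed
  then show "admissible M digits"
    unfolding admissible_def card_digits inner_digit_dual
    using cS by (intro exI [of _ S]) (simp add: e_def ee_def)
qed

end

section \<open>Finite spectra of the partial products\<close>

context borel_prob
begin

lemma orthonormal_basis_if_complete:
  assumes orth: "orthogonal_under (char_fun \<mu>) \<Lambda>"
    and complete: "\<And>\<xi> \<eta>. \<eta> > 0 \<Longrightarrow> \<exists>F. finite F \<and> F \<subseteq> \<Lambda> \<and> 1 - \<eta> < (\<Sum>l\<in>F. (cmod (char_fun \<mu> (\<xi> - l)))\<^sup>2)"
    and K: "compact K" "AE x in \<mu>. x \<in> K"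
  shows "L2_orthonormal_basis \<mu> \<Lambda> (\<lambda>l x. ee (l \<bullet> x))"
  unfolding L2_orthonormal_basis_def
proof (intro conjI ballI allI impI)
  fix k l assume "k \<in> \<Lambda>" "l \<in> \<Lambda>"
  then show "L2_inner \<mu> (\<lambda>x. ee (k \<bullet> x)) (\<lambda>x. ee (l \<bullet> x)) = (if k = l then 1 else 0)"
    using orth by (auto simp: L2_inner_ee orthogonal_under_def)
next
  show "square_integrable \<mu> (\<lambda>x. ee (l \<bullet> x))" for l by (rule square_integrable_ee)
next
  fix f and \<epsilon> :: real assume f: "square_integrable \<mu> f" and "\<epsilon> > 0"
  have "L2_approximable \<Lambda> (\<lambda>y. ee (\<xi> \<bullet> y))" for \<xi>
    unfolding L2_approximable_def
  proof (intro conjI square_integrable_ee allI impI)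
    fix \<eta> :: real assume "\<eta> > 0"
    show "\<exists>F c. finite F \<and> F \<subseteq> \<Lambda> \<and> (LINT y|\<mu>. (cmod (ee (\<xi> \<bullet> y) - (\<Sum>l\<in>F. c l * ee (l \<bullet> y))))\<^sup>2) < \<eta>"
    proof (cases "\<xi> \<in> \<Lambda>")
      case True
      then show ?thesis
        using \<open>\<eta> > 0\<close> by (intro exI [of _ "{\<xi>}"] exI [of _ "\<lambda>_. 1"]) simp
    next
      case False
      obtain F where F: "finite F" "F \<subseteq> \<Lambda>" "1 - \<eta> < (\<Sum>l\<in>F. (cmod (char_fun \<mu> (\<xi> - l)))\<^sup>2)"
        using complete [OF \<open>\<eta> > 0\<close>] by blast
      have "orthogonal_under (char_fun \<mu>) F"
        using orth F(2) by (auto simp: orthogonal_under_def)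
      moreover have "\<xi> \<notin> F" using F(2) False by blast
      ultimately
      have "(L2_norm \<mu> (\<lambda>y. ee (\<xi> \<bullet> y) - (\<Sum>l\<in>F. char_fun \<mu> (\<xi> - l) * ee (l \<bullet> y))))\<^sup>2 < \<eta>"
        using L2_norm_ee_diff [OF F(1), of \<xi> "\<lambda>l. char_fun \<mu> (\<xi> - l)"] F(3) by simp
      then show ?thesis
        using F by (intro exI [of _ F] exI [of _ "\<lambda>l. char_fun \<mu> (\<xi> - l)"]) (simp add: L2_norm_def)
    qed
  qed
  then have "L2_approximable \<Lambda> f"
    by (rule L2_approximable_all [OF _ K f])
  moreover have "\<epsilon>\<^sup>2 > 0" using \<open>\<epsilon> > 0\<close> by simp
  ultimately obtain F c where F: "finite F" "F \<subseteq> \<Lambda>"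
    "(LINT y|\<mu>. (cmod (f y - (\<Sum>l\<in>F. c l * ee (l \<bullet> y))))\<^sup>2) < \<epsilon>\<^sup>2"
    by (rule L2_approximableE)
  then have "L2_norm \<mu> (\<lambda>x. f x - (\<Sum>l\<in>F. c l * ee (l \<bullet> x))) < \<epsilon>"
    using \<open>\<epsilon> > 0\<close> unfolding L2_norm_def by (intro real_less_lsqrt) auto
  then show "\<exists>F c. finite F \<and> F \<subseteq> \<Lambda> \<and> L2_norm \<mu> (\<lambda>x. f x - (\<Sum>i\<in>F. c i * ee (i \<bullet> x))) < \<epsilon>"
    using F by blast
qed

lemma orthonormal_basis_imp_complete:
  assumes basis: "L2_orthonormal_basis \<mu> \<Lambda> (\<lambda>l x. ee (l \<bullet> x))"
  shows "orthogonal_under (char_fun \<mu>) \<Lambda>"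
    and "\<eta> > 0 \<Longrightarrow> \<exists>F. finite F \<and> F \<subseteq> \<Lambda> \<and> 1 - \<eta> < (\<Sum>l\<in>F. (cmod (char_fun \<mu> (\<xi> - l)))\<^sup>2)"
proof -
  show orth: "orthogonal_under (char_fun \<mu>) \<Lambda>"
    using basis by (auto simp: L2_orthonormal_basis_def orthogonal_under_def L2_inner_ee)
  assume "\<eta> > 0"
  show "\<exists>F. finite F \<and> F \<subseteq> \<Lambda> \<and> 1 - \<eta> < (\<Sum>l\<in>F. (cmod (char_fun \<mu> (\<xi> - l)))\<^sup>2)"
  proof (cases "\<xi> \<in> \<Lambda>")
    case True
    then show ?thesis using \<open>\<eta> > 0\<close> by (intro exI [of _ "{\<xi>}"]) simp
  next
    case False
    have "sqrt \<eta> > 0" using \<open>\<eta> > 0\<close> by simp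
    then obtain F c where F: "finite F" "F \<subseteq> \<Lambda>"
      "L2_norm \<mu> (\<lambda>x. ee (\<xi> \<bullet> x) - (\<Sum>i\<in>F. c i * ee (i \<bullet> x))) < sqrt \<eta>"
      using basis square_integrable_ee unfolding L2_orthonormal_basis_def by blast
    have "(L2_norm \<mu> (\<lambda>x. ee (\<xi> \<bullet> x) - (\<Sum>i\<in>F. c i * ee (i \<bullet> x))))\<^sup>2 < (sqrt \<eta>)\<^sup>2"
      using F(3) by (intro power_strict_mono) (auto simp: L2_norm_def)
    moreover have "orthogonal_under (char_fun \<mu>) F"
      using orth F(2) by (auto simp: orthogonal_under_def)
    moreover have "\<xi> \<notin> F" using F False by blast
    moreover have "0 \<le> (\<Sum>x\<in>F. (cmod (c x - char_fun \<mu> (\<xi> - x)))\<^sup>2)" by (intro sum_nonneg) simp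
    ultimately have "1 - \<eta> < (\<Sum>l\<in>F. (cmod (char_fun \<mu> (\<xi> - l)))\<^sup>2)"
      using L2_norm_ee_diff [OF F(1), of \<xi> c] \<open>\<eta> > 0\<close> by simp
    then show ?thesis using F by blast
  qed
qed

end

text \<open>Parseval for the Fourier matrix of order 3 applied to (1, z, w): the squared norm 3 is
  multiplied by 3.\<close>

lemma hadamard_identity:
  fixes z w \<omega> :: complex
  assumes "cmod z = 1" "cmod w = 1" "1 + \<omega> + cnj \<omega> = 0" "\<omega> * \<omega> = cnj \<omega>"
  shows "(cmod (1 + z + w))\<^sup>2 + (cmod (1 + \<omega> * z + cnj \<omega> * w))\<^sup>2 + (cmod (1 + cnj \<omega> * z + \<omega> * w))\<^sup>2 = 9"
proof -
  have zw: "z * cnj z = 1" "w * cnj w = 1"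
    using assms(1,2) by (simp_all flip: complex_norm_square)
  have "complex_of_real ((cmod (1 + z + w))\<^sup>2 + (cmod (1 + \<omega> * z + cnj \<omega> * w))\<^sup>2 + (cmod (1 + cnj \<omega> * z + \<omega> * w))\<^sup>2) =
    (1 + z + w) * (1 + cnj z + cnj w) + (1 + \<omega> * z + cnj \<omega> * w) * (1 + cnj \<omega> * cnj z + \<omega> * cnj w) +
    (1 + cnj \<omega> * z + \<omega> * w) * (1 + \<omega> * cnj z + cnj \<omega> * cnj w)"
    unfolding of_real_add complex_norm_square by simp
  also have "\<dots> = 9"
    using zw assms(3,4) by algebra
  finally show ?thesis
    by (metis of_real_eq_iff of_real_numeral)
qed

section \<open>Partial products, common periods and spectra of finite level\<close>

context three_digits
begin

definition \<mu> :: "(real ^ 2) measure" where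
  "\<mu> = address_law"

definition \<phi> :: "real ^ 2 \<Rightarrow> complex" where
  "\<phi> = char_fun \<mu>"

text \<open>The Fourier transform of the law of the first n terms of the address series.\<close>

definition q :: "nat \<Rightarrow> real ^ 2 \<Rightarrow> complex" where
  "q n x = (\<Prod>i=1..n. m ((dual ^^ i) x))"

sublocale law: borel_prob \<mu>
  unfolding \<mu>_def by (rule borel_prob_address_law)

lemma phi_0 [simp]: "\<phi> 0 = 1"
  and phi_minus: "\<phi> (- x) = cnj (\<phi> x)"
  and continuous_on_phi: "continuous_on A \<phi>"
  and norm_phi_le_1: "cmod (\<phi> x) \<le> 1"
  and positive_definite_phi: "positive_definite \<phi>"
  unfolding \<phi>_def by (simp_all add: law.char_fun_minus law.continuous_on_char_fun law.norm_char_fun_le_1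
      law.positive_definite_char_fun)

lemma phi_dual: "\<phi> x = m (dual x) * \<phi> (dual x)"
  unfolding \<phi>_def \<mu>_def m_def by (rule char_fun_invariant [OF invariant_address_law])

lemma phi_funpow: "\<phi> x = q n x * \<phi> ((dual ^^ n) x)"
  unfolding \<phi>_def \<mu>_def m_def q_def by (rule char_fun_invariant_funpow [OF invariant_address_law])

lemma phi_eq_0_iff: "\<phi> x = 0 \<longleftrightarrow> (\<exists>i\<ge>1. m ((dual ^^ i) x) = 0)"
  unfolding \<phi>_def \<mu>_def m_def by (rule char_fun_eq_0_iff [OF invariant_address_law])

lemma phi_dual_tendsto_1: "(\<lambda>n. \<phi> ((dual ^^ n) x)) \<longlonglongrightarrow> 1"
  unfolding \<phi>_def \<mu>_def by (rule char_fun_dual_tendsto_1 [OF invariant_address_law])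

lemma funpow_dual_add: "(dual ^^ n) (x + y) = (dual ^^ n) x + (dual ^^ n) y"
  and funpow_dual_0 [simp]: "(dual ^^ n) 0 = 0"
  and funpow_R_add: "(R ^^ n) (x + y) = (R ^^ n) x + (R ^^ n) y"
  and funpow_R_diff: "(R ^^ n) (x - y) = (R ^^ n) x - (R ^^ n) y"
  and funpow_R_minus: "(R ^^ n) (- x) = - (R ^^ n) x"
  and funpow_R_0 [simp]: "(R ^^ n) 0 = 0"
  by (induction n) (simp_all add: dual_add dual_diff R_add R_diff R_minus)

lemma funpow_dual_funpow_R: "i \<le> n \<Longrightarrow> (dual ^^ i) ((R ^^ n) x) = (R ^^ (n - i)) x"
proof (induction i)
  case (Suc i)
  then have "n - i = Suc (n - Suc i)" by simp
  then show ?case using Suc by simp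
qed simp

lemma funpow_in_class:
  "in_class v ((dual ^^ i) x) \<Longrightarrow> in_class (((*v) (transpose M) ^^ i) v) x"
proof (induction i arbitrary: x)
  case (Suc i)
  then have "in_class (((*v) (transpose M) ^^ i) v) (dual x)"
    by (simp add: funpow_swap1)
  from in_class_R [OF this] show ?case by simp
qed simp

text \<open>Zeros of the mask lie in (1/(3b)) times the integer lattice, and R is integral, so zeros
  of all later factors are carried into the same lattice.\<close>

lemma phi_eq_0_in_class: "\<phi> x = 0 \<Longrightarrow> \<exists>v. in_class v x"
  using funpow_in_class mask_eq_0_in_class unfolding phi_eq_0_iff by blast

text \<open>The largest R-invariant set of periods of the mask. It contains the integer lattice and
  can be larger; the larger group is needed because a point whose orbit has |m| = 1 throughout is
  only known to lie in it.\<close>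

definition periods :: "(real ^ 2) set" where
  "periods = {x. \<forall>j. la ((R ^^ j) x) \<in> \<int> \<and> lb ((R ^^ j) x) \<in> \<int>}"

lemma periods_0: "0 \<in> periods"
  and periods_add: "x \<in> periods \<Longrightarrow> y \<in> periods \<Longrightarrow> x + y \<in> periods"
  and periods_minus: "x \<in> periods \<Longrightarrow> - x \<in> periods"
  by (auto simp: periods_def funpow_R_add funpow_R_minus la_add lb_add la_minus lb_minus)

lemma periods_diff: "x \<in> periods \<Longrightarrow> y \<in> periods \<Longrightarrow> x - y \<in> periods"
  using periods_add [OF _ periods_minus] by fastforce

lemma periods_R: "x \<in> periods \<Longrightarrow> R x \<in> periods"
proof -
  assume "x \<in> periods"
  then have "la ((R ^^ Suc j) x) \<in> \<int> \<and> lb ((R ^^ Suc j) x) \<in> \<int>" for j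
    unfolding periods_def by blast
  then show ?thesis by (simp add: periods_def funpow_swap1)
qed

lemma periods_funpow_R: "x \<in> periods \<Longrightarrow> (R ^^ n) x \<in> periods"
  by (induction n) (simp_all add: periods_R)

lemma periods_real_vec: "real_vec v \<in> periods"
proof -
  have "(R ^^ j) (real_vec v) = real_vec (((*v) (transpose M) ^^ j) v)" for j
    by (induction j) (simp_all add: R_real_vec)
  then show ?thesis
    by (simp add: periods_def la_lb_real_vec)
qed

lemma mask_periods: "y \<in> periods \<Longrightarrow> m (x + y) = m x"
proof -
  assume "y \<in> periods"
  then have "la ((R ^^ 0) y) \<in> \<int>" "lb ((R ^^ 0) y) \<in> \<int>" unfolding periods_def by blast+
  then show ?thesis by (intro mask_periodic) simp_all
qed

lemma q_0 [simp]: "q n 0 = 1" by (simp add: q_def)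

lemma q_periods: "y \<in> periods \<Longrightarrow> q n (x + (R ^^ n) y) = q n x"
  unfolding q_def
  by (intro prod.cong refl) (simp add: funpow_dual_add funpow_dual_funpow_R mask_periods periods_funpow_R)

lemma q_add: "q (n + k) x = q n x * q k ((dual ^^ n) x)"
proof (induction k)
  case (Suc k)
  have "(dual ^^ (n + Suc k)) x = (dual ^^ Suc k) ((dual ^^ n) x)"
    using fun_cong [OF funpow_add [of "Suc k" n dual], of x] by (simp add: add.commute)
  then show ?case using Suc by (simp add: q_def)
qed (simp add: q_def)

lemma q_tendsto_phi: "(\<lambda>n. q n x) \<longlonglongrightarrow> \<phi> x"
proof -
  have "\<forall>\<^sub>F n in sequentially. \<phi> ((dual ^^ n) x) \<noteq> 0"
    by (rule tendsto_imp_eventually_ne [OF phi_dual_tendsto_1]) simp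
  then have "\<forall>\<^sub>F n in sequentially. \<phi> x / \<phi> ((dual ^^ n) x) = q n x"
  proof eventually_elim
    case (elim n)
    then show ?case using phi_funpow [of x n] by simp
  qed
  moreover have "(\<lambda>n. \<phi> x / \<phi> ((dual ^^ n) x)) \<longlonglongrightarrow> \<phi> x / 1"
    by (intro tendsto_divide tendsto_const phi_dual_tendsto_1) simp
  ultimately show ?thesis
    by (simp add: tendsto_cong)
qed

text \<open>A tight set is a spectrum of the \<open>n\<close>-th partial product measure, contained in the periods.\<close>

definition tight :: "nat \<Rightarrow> (real ^ 2) set \<Rightarrow> bool" where
  "tight n A \<longleftrightarrow> finite A \<and> A \<subseteq> periods \<and> (\<forall>x. (\<Sum>l\<in>A. (cmod (q n (x + l)))\<^sup>2) = 1)"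

text \<open>At x = -l the term of l alone is already 1, so nothing is left for the others.\<close>

lemma tight_orthogonal:
  assumes "tight n A" "k \<in> A" "l \<in> A" "k \<noteq> l"
  shows "q n (k - l) = 0"
proof -
  have A: "finite A" using assms(1) by (simp add: tight_def)
  have "(\<Sum>j\<in>A. (cmod (q n (j - l)))\<^sup>2) = 1"
    using assms(1) unfolding tight_def by (metis (no_types, lifting) sum.cong uminus_add_conv_diff)
  then have "1 + (\<Sum>j\<in>A - {l}. (cmod (q n (j - l)))\<^sup>2) = 1"
    using assms(3) A by (simp add: sum.remove [of A l])
  then have "\<forall>j\<in>A - {l}. (cmod (q n (j - l)))\<^sup>2 = 0"
    using A by (subst sum_nonneg_eq_0_iff [symmetric]) auto
  then show ?thesis using assms by simp
qed

text \<open>The block R^n s is a period of the first n factors and is seen as s by the next k, so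
  the double sum factors. A collision of two words would give q n (l - l') = 1, against
  orthogonality.\<close>

lemma tight_extend:
  assumes A: "tight n A" and E: "tight k E"
  shows "tight (n + k) ((\<lambda>(l, s). l + (R ^^ n) s) ` (A \<times> E))"
proof -
  have inj: "inj_on (\<lambda>(l, s). l + (R ^^ n) s) (A \<times> E)"
  proof (rule inj_onI, clarsimp)
    fix l s l' s' assume *: "l \<in> A" "s \<in> E" "l' \<in> A" "s' \<in> E" "l + (R ^^ n) s = l' + (R ^^ n) s'"
    have "s' - s \<in> periods"
      using * E by (auto simp: tight_def intro: periods_diff)
    moreover have "l - l' = (R ^^ n) (s' - s)"
      using *(5) by (simp add: funpow_R_diff algebra_simps)
    ultimately have "q n (l - l') = 1"
      using q_periods [of "s' - s" n 0] by simp
    then have "l = l'" using tight_orthogonal [OF A *(1,3)] by auto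
    then have "(dual ^^ n) ((R ^^ n) s) = (dual ^^ n) ((R ^^ n) s')" using *(5) by simp
    then show "l = l' \<and> s = s'" using \<open>l = l'\<close> by (simp add: funpow_dual_funpow_R)
  qed
  have "(\<Sum>l\<in>(\<lambda>(l, s). l + (R ^^ n) s) ` (A \<times> E). (cmod (q (n + k) (x + l)))\<^sup>2) = 1" for x
  proof -
    have "q (n + k) (x + (l + (R ^^ n) s)) = q n (x + l) * q k ((dual ^^ n) (x + l) + s)" if "s \<in> E" for l s
    proof -
      have "s \<in> periods" using E that by (auto simp: tight_def)
      then have "q n (x + l + (R ^^ n) s) = q n (x + l)" by (rule q_periods)
      moreover have "(dual ^^ n) (x + l + (R ^^ n) s) = (dual ^^ n) (x + l) + s"
        by (simp add: funpow_dual_add funpow_dual_funpow_R)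
      ultimately show ?thesis by (simp add: q_add add.assoc)
    qed
    then have "(\<Sum>l\<in>(\<lambda>(l, s). l + (R ^^ n) s) ` (A \<times> E). (cmod (q (n + k) (x + l)))\<^sup>2) =
      (\<Sum>(l, s)\<in>A \<times> E. (cmod (q n (x + l)))\<^sup>2 * (cmod (q k ((dual ^^ n) (x + l) + s)))\<^sup>2)"
      unfolding sum.reindex [OF inj]
      by (intro sum.cong refl) (auto simp: norm_mult power_mult_distrib)
    also have "\<dots> = (\<Sum>l\<in>A. (cmod (q n (x + l)))\<^sup>2 * (\<Sum>s\<in>E. (cmod (q k ((dual ^^ n) (x + l) + s)))\<^sup>2))"
      by (simp add: sum.cartesian_product sum_distrib_left)
    also have "\<dots> = 1"
      using A E by (simp add: tight_def)
    finally show ?thesis .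
  qed
  then show ?thesis
    using A E by (auto simp: tight_def intro!: periods_add periods_funpow_R)
qed

text \<open>Shifts by R^n times a period do not change \<open>q n\<close>. This is the freedom used
  later to correct tails.\<close>

lemma tight_translate:
  assumes A: "tight n A" and g: "\<And>t. g t \<in> periods"
  shows "tight n ((\<lambda>t. t + (R ^^ n) (g t)) ` A)"
proof -
  have "inj_on (\<lambda>t. t + (R ^^ n) (g t)) A"
  proof (rule inj_onI)
    fix t t' assume *: "t \<in> A" "t' \<in> A" "t + (R ^^ n) (g t) = t' + (R ^^ n) (g t')"
    have "t - t' = (R ^^ n) (g t' - g t)"
      using *(3) by (simp add: funpow_R_diff algebra_simps)
    then have "q n (t - t') = 1"
      using q_periods [of "g t' - g t" n 0] periods_diff [OF g g] by simp
    then show "t = t'" using tight_orthogonal [OF A *(1,2)] by auto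
  qed
  then have "(\<Sum>l\<in>(\<lambda>t. t + (R ^^ n) (g t)) ` A. (cmod (q n (x + l)))\<^sup>2) = 1" for x
    using A by (simp add: sum.reindex tight_def q_periods [OF g] flip: add.assoc)
  then show ?thesis
    using A by (auto simp: tight_def intro: periods_add periods_funpow_R g)
qed

lemma kernel_imp_tight:
  assumes "\<forall>i. 3 dvd (transpose M *v u) $ i"
  obtains T where "tight 1 T" "0 \<in> T"
proof -
  obtain s where s: "zero_pos (dual (real_vec s))"
    using kernel_imp_integer_zero [OF assms] by blast
  define y where "y = dual (real_vec s)"
  define \<omega> where "\<omega> = ee (1/3)"
  have y: "ee (la y) = \<omega>" "ee (lb y) = cnj \<omega>"
    using s unfolding zero_pos_def y_def [symmetric] \<omega>_def ee_minus [symmetric] ee_eq_iff by simp_all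
  have ri: "Re \<omega> = - 1/2" "Im \<omega> = sqrt 3 / 2"
    using cos_120 sin_120 by (simp_all add: \<omega>_def ee_eq_cis)
  then have "Re \<omega> = - 1/2" "Im \<omega> * Im \<omega> = 3 / 4" "Im \<omega> \<noteq> 0"
    unfolding ri by simp_all
  then have w: "1 + \<omega> + cnj \<omega> = 0" "\<omega> * \<omega> = cnj \<omega>" "\<omega> \<noteq> 1" "cnj \<omega> \<noteq> \<omega>"
    by (auto simp: complex_eq_iff)
  have "y \<noteq> 0" using y w(3) by auto
  moreover have "- y \<noteq> y"
  proof
    assume "- y = y"
    then have "ee (la (- y)) = ee (la y)" by (simp only:)
    then show False using w(4) y by (simp add: la_minus ee_minus)
  qed
  ultimately have yy: "y \<noteq> 0" "- y \<noteq> y" .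
  define T where "T = {0, real_vec s, - real_vec s}"
  have ds: "0 \<noteq> real_vec s" "0 \<noteq> - real_vec s" "real_vec s \<noteq> - real_vec s"
  proof -
    show "0 \<noteq> real_vec s" "0 \<noteq> - real_vec s"
      using yy(1) by (auto simp: y_def)
    show "real_vec s \<noteq> - real_vec s"
      using yy(2) arg_cong [of "real_vec s" "- real_vec s" dual] unfolding y_def dual_minus by metis
  qed
  have "(\<Sum>l\<in>T. (cmod (q 1 (x + l)))\<^sup>2) = 1" for x
  proof -
    define z v where "z = ee (la (dual x))" and "v = ee (lb (dual x))"
    have zv: "cmod z = 1" "cmod v = 1" by (simp_all add: z_def v_def)
    have q1: "q 1 x = m (dual x)" for x by (simp add: q_def)
    have "(\<Sum>l\<in>T. (cmod (q 1 (x + l)))\<^sup>2) =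
      (cmod (m (dual x)))\<^sup>2 + (cmod (m (dual x + y)))\<^sup>2 + (cmod (m (dual x + - y)))\<^sup>2"
      unfolding T_def q1 using ds by (simp add: dual_add dual_minus dual_diff y_def)
    also have "\<dots> = ((cmod (1 + z + v))\<^sup>2 + (cmod (1 + \<omega> * z + cnj \<omega> * v))\<^sup>2 + (cmod (1 + cnj \<omega> * z + \<omega> * v))\<^sup>2) / 9"
    proof -
      have "(cmod (a / 3))\<^sup>2 = (cmod a)\<^sup>2 / 9" for a
        by (simp add: norm_divide power_divide)
      then show ?thesis
        unfolding mask_eq la_add lb_add ee_add la_minus lb_minus ee_minus y z_def v_def
        by (simp only: mult.commute [of _ \<omega>] mult.commute [of _ "cnj \<omega>"] complex_cnj_cnj) (simp add: add_divide_distrib)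
    qed
    finally show ?thesis
      using hadamard_identity [OF zv w(1,2)] by simp
  qed
  then have "tight 1 T"
    unfolding tight_def by (auto simp: T_def intro: periods_0 periods_real_vec periods_minus)
  then show thesis by (rule that) (simp add: T_def)
qed

end

section \<open>Construction of a spectrum\<close>

context three_digits
begin

section \<open>Cosets of the periods on which the Fourier transform vanishes\<close>

definition coset :: "real ^ 2 \<Rightarrow> (real ^ 2) set" where
  "coset x = {y. y - x \<in> periods}"

lemma coset_self: "x \<in> coset x"
  by (simp add: coset_def periods_0)

lemma coset_eq_iff: "coset x = coset y \<longleftrightarrow> x - y \<in> periods"
proof
  assume "coset x = coset y"
  then have "x \<in> coset y" using coset_self by blast
  then show "x - y \<in> periods" by (simp add: coset_def)
next
  assume *: "x - y \<in> periods"
  have "z - x \<in> periods \<longleftrightarrow> z - y \<in> periods" for z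
    using periods_add [of "z - x" "x - y"] periods_diff [of "z - y" "x - y"] * by auto
  then show "coset x = coset y" by (simp add: coset_def)
qed

text \<open>The periodic zero set of \<phi>. Off this set, and only there, a point can be moved by a
  period to a point where \<phi> is nonzero.\<close>

definition vanishing :: "(real ^ 2) set" where
  "vanishing = {x. \<forall>g\<in>periods. \<phi> (x + g) = 0}"

lemma vanishing_periods: "x \<in> vanishing \<Longrightarrow> g \<in> periods \<Longrightarrow> x + g \<in> vanishing"
  by (auto simp: vanishing_def add.assoc intro: periods_add)

lemma vanishing_dual:
  assumes x: "x \<in> vanishing" and nz: "m (dual x) \<noteq> 0"
  shows "dual x \<in> vanishing"
  unfolding vanishing_def
proof (intro CollectI ballI)
  fix g assume g: "g \<in> periods"
  have "\<phi> (x + R g) = 0"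
    using x periods_R [OF g] by (auto simp: vanishing_def)
  then show "\<phi> (dual x + g) = 0"
    using phi_dual [of "x + R g"] nz by (simp add: dual_add mask_periods [OF g])
qed

lemma finite_cosets_vanishing: "finite (coset ` vanishing)"
proof -
  define p where "p = \<bar>3 * b\<bar>"
  have p: "p > 0" using b_nz by (simp add: p_def)
  \<comment> \<open>Members of \<open>vanishing\<close> are zeros of \<phi>, so 3 b x is integral.
    Equal residues modulo 3b therefore make the difference of two points an integer vector, hence a
    period.\<close>
  define \<kappa> where "\<kappa> x = (\<lfloor>3 * of_int b * x$1\<rfloor> mod p, \<lfloor>3 * of_int b * x$2\<rfloor> mod p)" for x :: "real ^ 2"
  have "\<kappa> ` vanishing \<subseteq> {0..<p} \<times> {0..<p}"
    using p by (auto simp: \<kappa>_def)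
  then have fin: "finite (\<kappa> ` vanishing)"
    by (rule finite_subset) simp
  have "coset x = coset y" if xy: "x \<in> vanishing" "y \<in> vanishing" "\<kappa> x = \<kappa> y" for x y
  proof -
    have "\<phi> (x + 0) = 0" "\<phi> (y + 0) = 0"
      using xy periods_0 unfolding vanishing_def by blast+
    then obtain v w where vw: "in_class v x" "in_class w y"
      using phi_eq_0_in_class by fastforce
    obtain n k :: "int ^ 2" where n: "\<And>i. 3 * of_int b * x$i = real_of_int (v$i + 3 * n$i)"
      "\<And>i. 3 * of_int b * y$i = real_of_int (w$i + 3 * k$i)"
      using vw unfolding in_class_def by blast
    have "\<exists>j. x$i - y$i = of_int j" for i
    proof -
      have "(v$i + 3 * n$i) mod p = (w$i + 3 * k$i) mod p"
        using xy(3) exhaust_2 [of i] unfolding \<kappa>_def n floor_of_int by auto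
      then have "p dvd (v$i + 3 * n$i) - (w$i + 3 * k$i)"
        by (simp add: mod_eq_dvd_iff)
      then have "3 * b dvd (v$i + 3 * n$i) - (w$i + 3 * k$i)"
        by (simp add: p_def)
      then obtain j where j: "(v$i + 3 * n$i) - (w$i + 3 * k$i) = 3 * b * j" by (auto elim: dvdE)
      have "3 * of_int b * (x$i - y$i) = real_of_int ((v$i + 3 * n$i) - (w$i + 3 * k$i))"
        unfolding right_diff_distrib n of_int_diff ..
      also have "\<dots> = 3 * of_int b * real_of_int j" unfolding j by simp
      finally show ?thesis using b_nz by auto
    qed
    then obtain j where "\<And>i. x$i - y$i = of_int (j i)" by metis
    then have "x - y = real_vec (\<chi> i. j i)"
      by (simp add: real_vec_def vec_eq_iff)
    then show ?thesis
      by (simp add: coset_eq_iff periods_real_vec)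
  qed
  then have "coset x = coset (SOME y. y \<in> vanishing \<and> \<kappa> y = \<kappa> x)" if "x \<in> vanishing" for x
    using that someI [of "\<lambda>y. y \<in> vanishing \<and> \<kappa> y = \<kappa> x" x] by metis
  then have "coset ` vanishing \<subseteq> (\<lambda>k. coset (SOME y. y \<in> vanishing \<and> \<kappa> y = k)) ` (\<kappa> ` vanishing)"
    by blast
  then show ?thesis
    using fin finite_surj by blast
qed

text \<open>
  On the finite set of vanishing cosets, \<open>R\<close> induces a map from the cosets with \<open>m \<noteq> 0\<close> onto all of them.
  It is therefore injective and everywhere defined, so only one of the three terms in the tightness
  identity survives.
\<close>

lemma norm_mask_vanishing:
  assumes T: "tight 1 T" "0 \<in> T" and \<eta>: "\<eta> \<in> vanishing"
  shows "cmod (m \<eta>) = 1" and "R \<eta> \<in> vanishing"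
proof -
  have q1: "q 1 x = m (dual x)" for x by (simp add: q_def)
  have finT: "finite T" and Tper: "T \<subseteq> periods"
    and Tsum: "(\<Sum>t\<in>T. (cmod (m (dual x + dual t)))\<^sup>2) = 1" for x
    using T by (simp_all add: tight_def q1 dual_add del: One_nat_def)
  \<comment> \<open>Saturating by periods makes R a map of cosets without a choice of
    representatives.\<close>
  define \<sigma> where "\<sigma> c = {y. \<exists>x\<in>c. y - R x \<in> periods}" for c
  have \<sigma>: "\<sigma> (coset x) = coset (R x)" for x
  proof (intro equalityI subsetI)
    fix y assume "y \<in> \<sigma> (coset x)"
    then obtain z where z: "z - x \<in> periods" "y - R z \<in> periods"
      by (auto simp: \<sigma>_def coset_def)
    then have "(y - R z) + R (z - x) \<in> periods" by (intro periods_add periods_R)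
    then show "y \<in> coset (R x)" by (simp add: coset_def R_diff)
  next
    fix y assume "y \<in> coset (R x)"
    then show "y \<in> \<sigma> (coset x)"
      unfolding \<sigma>_def by (intro CollectI bexI [of _ x] coset_self) (simp add: coset_def)
  qed
  define G where "G = {x \<in> vanishing. m x \<noteq> 0 \<and> R x \<in> vanishing}"
  let ?C = "coset ` vanishing" and ?C' = "coset ` G"
  have sub: "?C' \<subseteq> ?C" by (auto simp: G_def)
  have fin: "finite ?C" by (rule finite_cosets_vanishing)
  have fin': "finite ?C'" by (rule finite_subset [OF sub fin])
  \<comment> \<open>As \<open>R (dual (x + t))\<close> is x + t, this gives a preimage of the coset
    of x under \<open>\<sigma>\<close>.\<close>
  have succ: "dual (x + t) \<in> G" if "x \<in> vanishing" "t \<in> T" "m (dual x + dual t) \<noteq> 0" for x t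
  proof -
    have "x + t \<in> vanishing" using that Tper by (auto intro: vanishing_periods)
    then show ?thesis using that vanishing_dual [of "x + t"] by (simp add: G_def dual_add) (simp add: R_add)
  qed
  have "?C \<subseteq> \<sigma> ` ?C'"
  proof
    fix c assume "c \<in> ?C"
    then obtain x where x: "x \<in> vanishing" "c = coset x" by blast
    have "\<exists>t\<in>T. m (dual x + dual t) \<noteq> 0"
    proof (rule ccontr)
      assume "\<not> ?thesis"
      then have "(\<Sum>t\<in>T. (cmod (m (dual x + dual t)))\<^sup>2) = 0" by (intro sum.neutral) auto
      then show False using Tsum [of x] by simp
    qed
    then obtain t where t: "t \<in> T" "m (dual x + dual t) \<noteq> 0" by blast
    have "coset (R (dual (x + t))) = c"
      using t(1) Tper by (auto simp: x(2) coset_eq_iff)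
    then show "c \<in> \<sigma> ` ?C'"
      using succ [OF x(1) t] \<sigma> by blast
  qed
  then have "card ?C \<le> card (\<sigma> ` ?C')"
    by (intro card_mono finite_imageI fin')
  moreover have "card (\<sigma> ` ?C') \<le> card ?C'" "card ?C' \<le> card ?C"
    by (intro card_image_le card_mono fin fin' sub)+
  ultimately have "card ?C' = card ?C" "card (\<sigma> ` ?C') = card ?C'" by simp_all
  then have C': "?C' = ?C" and inj: "inj_on \<sigma> ?C'"
    using card_subset_eq [OF fin sub] eq_card_imp_inj_on [OF fin'] by simp_all
  have G: "x \<in> G" if x: "x \<in> vanishing" for x
  proof -
    obtain x' where x': "x' \<in> G" "coset x = coset x'"
      using C' x by (metis (no_types, lifting) image_iff)
    then have p: "x - x' \<in> periods" by (simp add: coset_eq_iff)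
    have "m x = m x'" using mask_periods [OF p, of x'] by simp
    moreover have "R x \<in> vanishing"
      using x'(1) vanishing_periods [of "R x'", OF _ periods_R [OF p]] by (simp add: G_def R_diff)
    ultimately show ?thesis using x'(1) x by (simp add: G_def)
  qed
  then show R: "R \<eta> \<in> vanishing" using \<eta> by (simp add: G_def)
  \<comment> \<open>A second surviving term would give a second preimage of the coset of R \<eta>.
    Injectivity then makes \<open>dual t\<close> a period, where m = 1, although t and 0 are
    distinct elements of T and orthogonality gives m = 0.\<close>
  have "m (\<eta> + dual t) = 0" if t: "t \<in> T" "t \<noteq> 0" for t
  proof (rule ccontr)
    assume nz: "m (\<eta> + dual t) \<noteq> 0"
    have "dual (R \<eta> + t) \<in> G" using succ [OF R t(1)] nz by simp
    moreover have "\<sigma> (coset (dual (R \<eta> + t))) = \<sigma> (coset \<eta>)"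
      using t(1) Tper by (auto simp: \<sigma> coset_eq_iff)
    ultimately have "coset (dual (R \<eta> + t)) = coset \<eta>"
      using inj G [OF \<eta>] by (meson image_eqI inj_onD)
    then have "dual t \<in> periods" by (simp add: coset_eq_iff dual_add)
    then have "m (dual t) = 1" using mask_periods [of "dual t" 0] by simp
    moreover have "m (dual t) = 0"
      using tight_orthogonal [OF T(1) t(1) T(2) t(2)] by (simp only: q1 diff_zero)
    ultimately show False by simp
  qed
  then have "(\<Sum>t\<in>T - {0}. (cmod (m (\<eta> + dual t)))\<^sup>2) = 0" by (intro sum.neutral) auto
  moreover have "(\<Sum>t\<in>T. (cmod (m (\<eta> + dual t)))\<^sup>2) = 1"
    using Tsum [of "R \<eta>"] by simp
  ultimately have "(cmod (m \<eta>))\<^sup>2 = 1"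
    using finT T(2) by (simp add: sum.remove [of T 0])
  then show "cmod (m \<eta>) = 1" by (simp add: power2_eq_1_iff) (use norm_ge_zero [of "m \<eta>"] in linarith)
qed

lemma vanishing_empty:
  assumes T: "tight 1 T" "0 \<in> T"
  shows "vanishing = {}"
proof (rule ccontr)
  assume "vanishing \<noteq> {}"
  then obtain \<eta> where \<eta>: "\<eta> \<in> vanishing" by blast
  have "(R ^^ j) \<eta> \<in> vanishing" for j
    using \<eta> norm_mask_vanishing(2) [OF T] by (induction j) simp_all
  then have "\<eta> \<in> periods"
    using norm_mask_eq_1 norm_mask_vanishing(1) [OF T] by (simp add: periods_def)
  then have "\<phi> (\<eta> + - \<eta>) = 0"
    using \<eta> periods_minus unfolding vanishing_def by blast
  then show False by simp
qed

section \<open>Correcting digits by periods to keep the tails bounded below\<close>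

lemma uniform_lower_bound:
  assumes T: "tight 1 T" "0 \<in> T"
  obtains \<epsilon> \<delta> where "\<epsilon> > 0" "\<delta> > 0"
    "\<And>x. norm x \<le> \<rho> \<Longrightarrow> \<exists>g\<in>periods. (x = 0 \<longrightarrow> g = 0) \<and> (\<forall>y. norm y < \<delta> \<longrightarrow> \<epsilon> \<le> cmod (\<phi> (x + g + y)))"
proof -
  have "\<forall>x. \<exists>g\<in>periods. \<phi> (x + g) \<noteq> 0"
    using vanishing_empty [OF T] by (auto simp: vanishing_def)
  then obtain g where g: "\<And>x. g x \<in> periods" "\<And>x. \<phi> (x + g x) \<noteq> 0" by metis
  define U where "U x = {z. cmod (\<phi> (x + g x)) / 2 < cmod (\<phi> (z + g x))}" for x
  have cont: "continuous_on UNIV (\<lambda>z. cmod (\<phi> (z + a)))" for a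
    by (intro continuous_on_norm continuous_on_compose2 [OF continuous_on_phi [of UNIV]] continuous_intros) auto
  have openU: "open (U x)" for x
    unfolding U_def by (intro open_Collect_less continuous_intros cont)
  have xU: "x \<in> U x" for x using g(2) [of x] by (simp add: U_def)
  let ?K = "cball 0 \<rho> :: (real ^ 2) set"
  obtain F where F: "F \<subseteq> ?K" "finite F" "?K \<subseteq> \<Union> (U ` F)"
    by (rule compactE_image [of ?K ?K U]) (use openU xU in auto)
  \<comment> \<open>A Lebesgue number of the cover: one radius of perturbation serves all points of
    the ball.\<close>
  obtain e where e: "0 < e" "\<And>x. x \<in> ?K \<Longrightarrow> \<exists>G\<in>U ` F. ball x e \<subseteq> G"
    by (rule Heine_Borel_lemma [of ?K "U ` F"]) (use F openU in auto)
  have "open {z. 1/2 < cmod (\<phi> (z + 0))}"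
    by (intro open_Collect_less continuous_intros cont)
  then obtain e0 where e0: "0 < e0" "ball 0 e0 \<subseteq> {z. 1/2 < cmod (\<phi> (z + 0))}"
    by (rule openE [of _ 0]) auto
  define \<epsilon> where "\<epsilon> = Min (insert (1/2) ((\<lambda>x. cmod (\<phi> (x + g x)) / 2) ` F))"
  define \<delta> where "\<delta> = min e e0"
  have "\<epsilon> > 0" unfolding \<epsilon>_def using F(2) g(2) by (subst Min_gr_iff) auto
  moreover have "\<delta> > 0" using e e0 by (simp add: \<delta>_def)
  moreover have "\<exists>h\<in>periods. (x = 0 \<longrightarrow> h = 0) \<and> (\<forall>y. norm y < \<delta> \<longrightarrow> \<epsilon> \<le> cmod (\<phi> (x + h + y)))"
    if x: "norm x \<le> \<rho>" for x
  \<comment> \<open>The origin must receive the correction 0, so that the zero word survives and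
    successive spectra are nested. There \<phi> is 1, which explains the candidate 1/2 in the
    minimum.\<close>
  proof (cases "x = 0")
    case True
    have "\<epsilon> \<le> cmod (\<phi> (x + 0 + y))" if "norm y < \<delta>" for y
    proof -
      have "y \<in> ball 0 e0" using that by (simp add: \<delta>_def)
      then have "1/2 < cmod (\<phi> y)" using e0(2) by auto
      moreover have "\<epsilon> \<le> 1/2" unfolding \<epsilon>_def using F(2) by (intro Min_le) auto
      ultimately show ?thesis by (simp add: True)
    qed
    then show ?thesis using periods_0 by blast
  next
    case False
    have "x \<in> ?K" using x by simp
    then obtain x' where x': "x' \<in> F" "ball x e \<subseteq> U x'" using e(2) by blast
    have "\<epsilon> \<le> cmod (\<phi> (x + g x' + y))" if "norm y < \<delta>" for y
    proof -
      have "x + y \<in> ball x e" using that by (simp add: \<delta>_def dist_norm)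
      then have "cmod (\<phi> (x' + g x')) / 2 < cmod (\<phi> (x + y + g x'))"
        using x'(2) by (auto simp: U_def)
      moreover have "\<epsilon> \<le> cmod (\<phi> (x' + g x')) / 2"
        unfolding \<epsilon>_def using F(2) x'(1) by (intro Min_le) auto
      ultimately show ?thesis by (simp add: add_ac)
    qed
    then show ?thesis using g(1) False by blast
  qed
  ultimately show thesis by (rule that)
qed

primrec word_set :: "(real ^ 2) set \<Rightarrow> nat \<Rightarrow> (real ^ 2) set" where
  "word_set T 0 = {0}"
| "word_set T (Suc n) = (\<lambda>(l, s). l + (R ^^ n) s) ` (word_set T n \<times> T)"

lemma tight_0: "tight 0 {0}"
  by (simp add: tight_def periods_0 q_def)

lemma tight_word_set: "tight 1 T \<Longrightarrow> tight n (word_set T n)"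
  by (induction n) (use tight_0 tight_extend [of _ _ 1] in auto)

lemma zero_in_word_set: "0 \<in> T \<Longrightarrow> 0 \<in> word_set T n"
  by (induction n) (auto intro!: image_eqI [of _ _ "(0, 0)"])

text \<open>Rescaled words of every length stay in one ball. The exponent \<open>j\<close> is
  carried through the induction because one application of \<open>dual\<close> need not contract;
  only its powers are controlled.\<close>

lemma word_set_bound:
  assumes T: "\<And>t. t \<in> T \<Longrightarrow> norm t \<le> \<tau>" and "0 \<le> \<tau>" "t \<in> word_set T n"
  shows "norm ((dual ^^ j) ((dual ^^ n) t)) \<le> C * \<tau> * r ^ j / (1 - r)"
  using assms(3)
proof (induction n arbitrary: t j)
  case 0
  then show ?case using C_pos r_pos r_less_1 assms(2) by simp
next
  case (Suc n)
  then obtain l s where ls: "l \<in> word_set T n" "s \<in> T" "t = l + (R ^^ n) s" by auto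
  have "(dual ^^ j) ((dual ^^ Suc n) t) = (dual ^^ Suc j) ((dual ^^ n) t)"
    by (metis comp_apply funpow.simps(2) funpow_Suc_right)
  also have "\<dots> = (dual ^^ Suc j) ((dual ^^ n) l) + (dual ^^ Suc j) s"
    unfolding ls(3) by (simp add: funpow_dual_add funpow_dual_funpow_R dual_add)
  finally have "norm ((dual ^^ j) ((dual ^^ Suc n) t)) \<le> norm ((dual ^^ Suc j) ((dual ^^ n) l)) + norm ((dual ^^ Suc j) s)"
    by (simp only: norm_triangle_ineq)
  also have "\<dots> \<le> C * \<tau> * r ^ Suc j / (1 - r) + C * r ^ Suc j * \<tau>"
  proof (rule add_mono [OF Suc.IH [OF ls(1)]])
    have "C * r ^ Suc j * norm s \<le> C * r ^ Suc j * \<tau>"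
      using T [OF ls(2)] C_pos r_pos by (intro mult_left_mono) auto
    then show "norm ((dual ^^ Suc j) s) \<le> C * r ^ Suc j * \<tau>"
      using dual_decay [of "Suc j" s] by linarith
  qed
  also have "\<dots> = C * \<tau> * r ^ j / (1 - r) * (r * (2 - r))"
    using r_less_1 by (simp add: field_simps)
  also have "\<dots> \<le> C * \<tau> * r ^ j / (1 - r) * 1"
  proof (rule mult_left_mono)
    show "r * (2 - r) \<le> 1" using zero_le_power2 [of "1 - r"] by (simp add: power2_eq_square algebra_simps)
    show "0 \<le> C * \<tau> * r ^ j / (1 - r)" using C_pos r_pos r_less_1 assms(2) by simp
  qed
  finally show ?case by simp
qed

text \<open>The new block is chosen so long that an old word, rescaled to the new level, is shorter
  than \<delta>/2. The tail at a combined word is then governed by the corrected tail of its block,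
  and the other \<delta>/2 remains for the perturbation y.\<close>

lemma tight_step:
  assumes T: "tight 1 T" "0 \<in> T"
  obtains \<epsilon> \<delta> where "\<epsilon> > 0" "\<delta> > 0"
    "\<And>n A. tight n A \<Longrightarrow> \<exists>n' A'. n < n' \<and> A \<subseteq> A' \<and> tight n' A' \<and>
       (\<forall>l\<in>A'. \<forall>y. norm y < \<delta> \<longrightarrow> \<epsilon> \<le> cmod (\<phi> ((dual ^^ n') l + y)))"
proof -
  have finT: "finite T" using T by (simp add: tight_def)
  define \<tau> where "\<tau> = Max (norm ` T)"
  have \<tau>: "norm t \<le> \<tau>" if "t \<in> T" for t using finT that by (simp add: \<tau>_def)
  then have \<tau>0: "0 \<le> \<tau>" using T(2) by fastforce
  obtain \<epsilon> \<delta> where ed: "\<epsilon> > 0" "\<delta> > 0" and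
    lower: "\<And>x. norm x \<le> C * \<tau> / (1 - r) \<Longrightarrow>
      \<exists>g\<in>periods. (x = 0 \<longrightarrow> g = 0) \<and> (\<forall>y. norm y < \<delta> \<longrightarrow> \<epsilon> \<le> cmod (\<phi> (x + g + y)))"
    using uniform_lower_bound [OF T, of "C * \<tau> / (1 - r)"] by metis
  have "\<exists>n' A'. n < n' \<and> A \<subseteq> A' \<and> tight n' A' \<and>
       (\<forall>l\<in>A'. \<forall>y. norm y < \<delta> / 2 \<longrightarrow> \<epsilon> \<le> cmod (\<phi> ((dual ^^ n') l + y)))" if A: "tight n A" for n A
  proof -
    have finA: "finite A" using A by (simp add: tight_def)
    have "\<forall>\<^sub>F k in sequentially. \<forall>l\<in>A. norm ((dual ^^ k) ((dual ^^ n) l)) < \<delta> / 2"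
      unfolding eventually_ball_finite_distrib [OF finA]
      using ed tendstoD [OF dual_tendsto_0, of "\<delta> / 2"] by (simp add: dist_norm)
    then have "\<forall>\<^sub>F k in sequentially. 1 \<le> k \<and> (\<forall>l\<in>A. norm ((dual ^^ k) ((dual ^^ n) l)) < \<delta> / 2)"
      using eventually_ge_at_top [of "1::nat"] by eventually_elim simp
    then obtain k where k: "1 \<le> k" "\<And>l. l \<in> A \<Longrightarrow> norm ((dual ^^ k) ((dual ^^ n) l)) < \<delta> / 2"
      by (auto simp: eventually_sequentially)
    define good where "good t g \<longleftrightarrow> g \<in> periods \<and> ((dual ^^ k) t = 0 \<longrightarrow> g = 0) \<and>
       (\<forall>y. norm y < \<delta> \<longrightarrow> \<epsilon> \<le> cmod (\<phi> ((dual ^^ k) t + g + y)))" for t g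
    define g where "g t = (if t \<in> word_set T k then SOME g. good t g else 0)" for t
    have good: "good t (g t)" if t: "t \<in> word_set T k" for t
    proof -
      have "norm ((dual ^^ k) t) \<le> C * \<tau> / (1 - r)"
        using word_set_bound [OF \<tau> \<tau>0 t, of 0] by simp
      from lower [OF this] have "\<exists>g. good t g" unfolding good_def by blast
      then show ?thesis using t by (simp add: g_def someI_ex)
    qed
    have gp: "g t \<in> periods" for t
      using good [of t] periods_0 by (cases "t \<in> word_set T k") (auto simp: good_def g_def)
    \<comment> \<open>The factor R^k hides the correction from \<open>q k\<close>, while the tail
      sees it as exactly \<open>g t\<close>.\<close>
    define E where "E = (\<lambda>t. t + (R ^^ k) (g t)) ` word_set T k"
    have E: "tight k E" unfolding E_def by (rule tight_translate [OF tight_word_set [OF T(1)] gp])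
    have "0 \<in> word_set T k" using zero_in_word_set [OF T(2)] .
    moreover from good [OF this] have "g 0 = 0" by (simp add: good_def)
    ultimately have E0: "0 \<in> E" unfolding E_def by (auto intro!: image_eqI [of _ _ 0])
    define A' where "A' = (\<lambda>(l, s). l + (R ^^ n) s) ` (A \<times> E)"
    have "tight (n + k) A'" unfolding A'_def by (rule tight_extend [OF A E])
    moreover have "A \<subseteq> A'"
    proof
      fix l assume "l \<in> A"
      then show "l \<in> A'" using E0 unfolding A'_def by (intro image_eqI [of _ _ "(l, 0)"]) auto
    qed
    moreover have "\<epsilon> \<le> cmod (\<phi> ((dual ^^ (n + k)) l + y))" if l: "l \<in> A'" and y: "norm y < \<delta> / 2" for l y
    proof -
      obtain a t where at: "a \<in> A" "t \<in> word_set T k" "l = a + (R ^^ n) (t + (R ^^ k) (g t))"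
        using l by (auto simp: A'_def E_def)
      have "(dual ^^ (n + k)) l = (dual ^^ k) ((dual ^^ n) l)"
        using fun_cong [OF funpow_add [of k n dual], of l] by (simp add: add.commute)
      also have "\<dots> = (dual ^^ k) t + g t + (dual ^^ k) ((dual ^^ n) a)"
        unfolding at(3) by (simp add: funpow_dual_add funpow_dual_funpow_R)
      finally have eq: "(dual ^^ (n + k)) l + y = (dual ^^ k) t + g t + ((dual ^^ k) ((dual ^^ n) a) + y)" by simp
      have "norm ((dual ^^ k) ((dual ^^ n) a) + y) < \<delta>"
        using k(2) [OF at(1)] y norm_triangle_ineq [of "(dual ^^ k) ((dual ^^ n) a)" y] by linarith
      then show ?thesis
        using good [OF at(2)] unfolding eq good_def by blast
    qed
    moreover have "n < n + k" using k(1) by simp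
    ultimately show ?thesis by blast
  qed
  then show thesis using that [of \<epsilon> "\<delta> / 2"] ed by auto
qed

lemma tight_chain:
  assumes T: "tight 1 T" "0 \<in> T"
  shows "\<exists>\<epsilon> \<delta> N A. \<epsilon> > 0 \<and> \<delta> > 0 \<and> strict_mono N \<and> (\<forall>k. A k \<subseteq> A (Suc k)) \<and> (\<forall>k. tight (N k) (A k)) \<and>
    (\<forall>k. \<forall>l\<in>A k. \<forall>y. norm y < \<delta> \<longrightarrow> \<epsilon> \<le> cmod (\<phi> ((dual ^^ N k) l + y)))"
proof -
  obtain \<epsilon> \<delta> where ed: "\<epsilon> > 0" "\<delta> > 0" and step:
    "\<And>n A. tight n A \<Longrightarrow> \<exists>n' A'. n < n' \<and> A \<subseteq> A' \<and> tight n' A' \<and>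
       (\<forall>l\<in>A'. \<forall>y. norm y < \<delta> \<longrightarrow> \<epsilon> \<le> cmod (\<phi> ((dual ^^ n') l + y)))"
    using tight_step [OF T] by blast
  define P where "P = (\<lambda>(n, A). tight n A \<and> (\<forall>l\<in>A. \<forall>y. norm y < \<delta> \<longrightarrow> \<epsilon> \<le> cmod (\<phi> ((dual ^^ n) l + y))))"
  define Q where "Q = (\<lambda>(n :: nat, A :: (real ^ 2) set) (n', A'). n < n' \<and> A \<subseteq> A')"
  have "\<exists>f. \<forall>k. P (f k) \<and> Q (f k) (f (Suc k))"
  proof (rule dependent_nat_choice [of "\<lambda>_. P" "\<lambda>_. Q"])
    show "\<exists>x. P x" using step [OF tight_0] unfolding P_def by fast
    show "\<exists>y. P y \<and> Q x y" if "P x" for x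
    proof -
      obtain n A where x: "x = (n, A)" by (cases x)
      then have "tight n A" using that by (simp add: P_def)
      from step [OF this] obtain n' A' where "P (n', A')" "Q x (n', A')"
        unfolding P_def Q_def x by auto
      then show ?thesis by blast
    qed
  qed
  then obtain f where f: "\<And>k. P (f k)" "\<And>k. Q (f k) (f (Suc k))" by blast
  show ?thesis
  proof (intro exI conjI)
    show "strict_mono (\<lambda>k. fst (f k))"
      using f(2) by (auto simp: strict_mono_Suc_iff Q_def case_prod_unfold)
    show "\<forall>k. snd (f k) \<subseteq> snd (f (Suc k))"
      using f(2) by (auto simp: Q_def case_prod_unfold)
    show "\<forall>k. tight (fst (f k)) (snd (f k))"
      "\<forall>k. \<forall>l\<in>snd (f k). \<forall>y. norm y < \<delta> \<longrightarrow> \<epsilon> \<le> cmod (\<phi> ((dual ^^ fst (f k)) l + y))"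
      using f(1) by (auto simp: P_def case_prod_unfold)
  qed (rule ed)+
qed

section \<open>Completeness of the union of the nested spectra\<close>

lemma spectral_if_tight:
  assumes T: "tight 1 T" "0 \<in> T"
  shows "spectral_measure \<mu>"
proof -
  obtain \<epsilon> \<delta> N A where ed: "\<epsilon> > 0" "\<delta> > 0" and N: "strict_mono N"
    and mono: "\<And>k. A k \<subseteq> A (Suc k)" and tight: "\<And>k. tight (N k) (A k)"
    and lower: "\<And>k l y. l \<in> A k \<Longrightarrow> norm y < \<delta> \<Longrightarrow> \<epsilon> \<le> cmod (\<phi> ((dual ^^ N k) l + y))"
    using tight_chain [OF T] by blast
  have mono': "A j \<subseteq> A k" if "j \<le> k" for j k
    using lift_Suc_mono_le [of A, OF mono that] .
  have finA: "finite (A k)" for k using tight [of k] by (simp add: tight_def)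
  define \<Lambda> where "\<Lambda> = (\<Union>k. A k)"
  have ex: "\<exists>k. F \<subseteq> A k" if F: "finite F" "F \<subseteq> \<Lambda>" for F
    using F
  proof (induction F rule: finite_induct)
    case (insert x F)
    then obtain j k where "x \<in> A j" "F \<subseteq> A k" by (auto simp: \<Lambda>_def)
    then have "insert x F \<subseteq> A (max j k)"
      using mono' [of j "max j k"] mono' [of k "max j k"] by auto
    then show ?case by blast
  qed simp
  have orth: "orthogonal_under \<phi> \<Lambda>"
    unfolding orthogonal_under_def
  proof (intro ballI impI)
    fix x y assume xy: "x \<in> \<Lambda>" "y \<in> \<Lambda>" "x \<noteq> y"
    then obtain k where "{x, y} \<subseteq> A k" using ex [of "{x, y}"] by auto
    then have "q (N k) (x - y) = 0"
      using tight_orthogonal [OF tight] xy(3) by simp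
    then show "\<phi> (x - y) = 0" using phi_funpow [of "x - y" "N k"] by simp
  qed
  have complete: "\<exists>F. finite F \<and> F \<subseteq> \<Lambda> \<and> 1 - \<eta> < (\<Sum>l\<in>F. (cmod (\<phi> (\<xi> - l)))\<^sup>2)" if "\<eta> > 0" for \<xi> \<eta>
  proof -
    define x where "x = - \<xi>"
    define f where "f l = (cmod (\<phi> (x + l)))\<^sup>2" for l
    have f: "f l = (cmod (\<phi> (\<xi> - l)))\<^sup>2" for l
      using phi_minus [of "x + l"] by (simp add: f_def x_def)
    have f0: "0 \<le> f l" for l by (simp add: f_def)
    define S where "S = (\<lambda>k. sum f (A k))"
    have S_le: "S k \<le> 1" for k
    proof -
      have "orthogonal_under \<phi> (A k)"
        using orth by (auto simp: orthogonal_under_def \<Lambda>_def)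
      from bessel [OF positive_definite_phi finA this] show ?thesis by (simp add: S_def f)
    qed
    have "incseq S"
      unfolding S_def by (intro incseq_SucI sum_mono2 finA mono f0)
    then have "Cauchy S"
    proof -
      obtain L where "S \<longlonglongrightarrow> L"
        using incseq_convergent [OF \<open>incseq S\<close>, of 1] S_le by blast
      then show ?thesis by (rule LIMSEQ_imp_Cauchy)
    qed
    \<comment> \<open>Replacing |q|^2 by |\<phi>|^2 costs at most 1/\<epsilon>^2, so a gap below
      \<theta> between partial sums lets the words outside \<open>A j\<close> contribute less than
      \<eta>/2 at every later level. The other \<eta>/2 pays for the limit on the finite set
      \<open>A j\<close>.\<close>
    moreover define \<theta> where "\<theta> = \<eta> * \<epsilon>\<^sup>2 / 2"
    have "\<theta> > 0" using ed \<open>\<eta> > 0\<close> by (simp add: \<theta>_def)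
    ultimately obtain j where "\<And>k i. k \<ge> j \<Longrightarrow> i \<ge> j \<Longrightarrow> norm (S k - S i) < \<theta>"
      using CauchyD by blast
    then have j: "S k - S j < \<theta>" if "k \<ge> j" for k
      using that by (force simp: abs_less_iff)
    have qlim: "(\<lambda>k. \<Sum>l\<in>A j. (cmod (q (N k) (x + l)))\<^sup>2) \<longlonglongrightarrow> S j"
      unfolding S_def f_def
      by (intro tendsto_sum tendsto_power tendsto_norm filterlim_compose [OF q_tendsto_phi] filterlim_subseq N)
    have "\<forall>\<^sub>F k in sequentially. (\<Sum>l\<in>A j. (cmod (q (N k) (x + l)))\<^sup>2) < S j + \<eta> / 2"
      using order_tendstoD(2) [OF qlim, of "S j + \<eta> / 2"] \<open>\<eta> > 0\<close> by simp
    moreover have "\<forall>\<^sub>F k in sequentially. norm ((dual ^^ N k) x) < \<delta>"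
    proof -
      have "(\<lambda>k. (dual ^^ N k) x) \<longlonglongrightarrow> 0"
        by (rule filterlim_compose [OF dual_tendsto_0 filterlim_subseq [OF N]])
      from tendstoD [OF this ed(2)] show ?thesis by (simp add: dist_norm)
    qed
    ultimately have "\<forall>\<^sub>F k in sequentially. j \<le> k \<and> (\<Sum>l\<in>A j. (cmod (q (N k) (x + l)))\<^sup>2) < S j + \<eta> / 2 \<and> norm ((dual ^^ N k) x) < \<delta>"
      using eventually_ge_at_top [of j] by eventually_elim simp
    then obtain k where k: "j \<le> k" "(\<Sum>l\<in>A j. (cmod (q (N k) (x + l)))\<^sup>2) < S j + \<eta> / 2" "norm ((dual ^^ N k) x) < \<delta>"
      by (auto simp: eventually_sequentially)
    have tail: "(cmod (q (N k) (x + l)))\<^sup>2 \<le> f l / \<epsilon>\<^sup>2" if "l \<in> A k" for l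
    proof -
      have "\<epsilon> \<le> cmod (\<phi> ((dual ^^ N k) (x + l)))"
        using lower [OF that k(3)] by (simp add: funpow_dual_add add.commute)
      then have "\<epsilon>\<^sup>2 \<le> (cmod (\<phi> ((dual ^^ N k) (x + l))))\<^sup>2"
        using ed by (intro power_mono) auto
      then have "(cmod (q (N k) (x + l)))\<^sup>2 * \<epsilon>\<^sup>2 \<le> (cmod (q (N k) (x + l)))\<^sup>2 * (cmod (\<phi> ((dual ^^ N k) (x + l))))\<^sup>2"
        by (intro mult_left_mono) auto
      also have "\<dots> = f l"
        unfolding f_def by (subst phi_funpow [of _ "N k"]) (simp add: norm_mult power_mult_distrib)
      finally show ?thesis using ed by (simp add: pos_le_divide_eq)
    qed
    have "1 = (\<Sum>l\<in>A k. (cmod (q (N k) (x + l)))\<^sup>2)"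
      using tight [of k] by (simp add: tight_def)
    also have "\<dots> = (\<Sum>l\<in>A k - A j. (cmod (q (N k) (x + l)))\<^sup>2) + (\<Sum>l\<in>A j. (cmod (q (N k) (x + l)))\<^sup>2)"
      using mono' [OF k(1)] by (intro sum.subset_diff finA)
    also have "(\<Sum>l\<in>A k - A j. (cmod (q (N k) (x + l)))\<^sup>2) \<le> (\<Sum>l\<in>A k - A j. f l / \<epsilon>\<^sup>2)"
      using tail by (intro sum_mono) auto
    also have "\<dots> = (S k - S j) / \<epsilon>\<^sup>2"
      using mono' [OF k(1)] finA by (simp add: S_def sum_diff flip: sum_divide_distrib)
    also have "\<dots> < \<eta> / 2"
      using j [OF k(1)] ed by (simp add: \<theta>_def pos_divide_less_eq)
    finally have "1 - \<eta> < S j" using k(2) by linarith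
    then show ?thesis
      using finA by (intro exI [of _ "A j"]) (auto simp: S_def f \<Lambda>_def)
  qed
  obtain K where K: "compact K" "AE x in \<mu>. x \<in> K"
    using AE_address_law unfolding \<mu>_def by blast
  have "L2_orthonormal_basis \<mu> \<Lambda> (\<lambda>l x. ee (l \<bullet> x))"
    using orth complete K unfolding \<phi>_def by (intro law.orthonormal_basis_if_complete)
  moreover have "countable \<Lambda>"
    unfolding \<Lambda>_def using finA by (intro countable_UN) (auto intro: countable_finite)
  ultimately show ?thesis
    unfolding spectral_measure_def ee_def
    using K law.prob_space_axioms law.sets_borel by blast
qed

end

section \<open>Necessity of the kernel condition\<close>

text \<open>At \<xi> = l0 + y the sum for \<psi> is bounded term by term by that for g, which is at
  most 1 by Bessel. The term of l0 loses |g(y)|^2 (1 - |h(y)|^2), and completeness allows no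
  loss.\<close>

lemma bessel_equality_factor:
  fixes \<psi> g h :: "'a::ab_group_add \<Rightarrow> complex"
  assumes complete: "\<And>\<xi> \<eta>. \<eta> > 0 \<Longrightarrow> \<exists>F. finite F \<and> F \<subseteq> \<Lambda> \<and> 1 - \<eta> < (\<Sum>l\<in>F. (cmod (\<psi> (\<xi> - l)))\<^sup>2)"
    and l0: "l0 \<in> \<Lambda>" and g: "positive_definite g" "orthogonal_under g \<Lambda>"
    and \<psi>: "\<And>x. \<psi> x = g x * h x" and h: "\<And>x. cmod (h x) \<le> 1"
  shows "g y = 0 \<or> cmod (h y) = 1"
proof -
  have "(cmod (g y))\<^sup>2 * (1 - (cmod (h y))\<^sup>2) \<le> 0"
  proof (rule field_le_epsilon)
    fix \<eta> :: real assume "\<eta> > 0"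
    let ?\<xi> = "l0 + y"
    obtain F where F: "finite F" "F \<subseteq> \<Lambda>" "1 - \<eta> < (\<Sum>l\<in>F. (cmod (\<psi> (?\<xi> - l)))\<^sup>2)"
      using complete [OF \<open>\<eta> > 0\<close>] by blast
    \<comment> \<open>The finite set supplied by completeness may omit l0, the term in which the
      loss occurs.\<close>
    define F' where "F' = insert l0 F"
    have F': "finite F'" "F' \<subseteq> \<Lambda>" "l0 \<in> F'" using F l0 by (auto simp: F'_def)
    have "(\<Sum>l\<in>F. (cmod (\<psi> (?\<xi> - l)))\<^sup>2) \<le> (\<Sum>l\<in>F'. (cmod (\<psi> (?\<xi> - l)))\<^sup>2)"
      using F' by (intro sum_mono2) (auto simp: F'_def)
    also have "\<dots> = (cmod (g y))\<^sup>2 * (cmod (h y))\<^sup>2 + (\<Sum>l\<in>F' - {l0}. (cmod (\<psi> (?\<xi> - l)))\<^sup>2)"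
      using F' by (simp add: sum.remove [of F' l0] \<psi> norm_mult power_mult_distrib)
    also have "(\<Sum>l\<in>F' - {l0}. (cmod (\<psi> (?\<xi> - l)))\<^sup>2) \<le> (\<Sum>l\<in>F' - {l0}. (cmod (g (?\<xi> - l)))\<^sup>2)"
    proof (rule sum_mono)
      fix l
      have "(cmod (g (?\<xi> - l)))\<^sup>2 * (cmod (h (?\<xi> - l)))\<^sup>2 \<le> (cmod (g (?\<xi> - l)))\<^sup>2 * 1"
        using h by (intro mult_left_mono power_le_one) auto
      then show "(cmod (\<psi> (?\<xi> - l)))\<^sup>2 \<le> (cmod (g (?\<xi> - l)))\<^sup>2"
        by (simp add: \<psi> norm_mult power_mult_distrib)
    qed
    also have "(\<Sum>l\<in>F' - {l0}. (cmod (g (?\<xi> - l)))\<^sup>2) = (\<Sum>l\<in>F'. (cmod (g (?\<xi> - l)))\<^sup>2) - (cmod (g y))\<^sup>2"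
      using F' by (simp add: sum.remove [of F' l0])
    also have "(\<Sum>l\<in>F'. (cmod (g (?\<xi> - l)))\<^sup>2) \<le> 1"
    proof (rule bessel [OF g(1) F'(1)])
      show "orthogonal_under g F'" using g(2) F'(2) by (auto simp: orthogonal_under_def)
    qed
    finally show "(cmod (g y))\<^sup>2 * (1 - (cmod (h y))\<^sup>2) \<le> 0 + \<eta>"
      using F(3) by (simp add: algebra_simps)
  qed
  moreover have "(cmod (h y))\<^sup>2 \<le> 1" using h by (intro power_le_one) auto
  ultimately have "g y = 0 \<or> (cmod (h y))\<^sup>2 = 1"
    by (auto simp: mult_le_0_iff)
  then show ?thesis
    using norm_ge_zero [of "h y"] by (auto simp: power2_eq_1_iff)
qed

section \<open>Nilpotency modulo 3 and reduced products\<close>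

context three_digits
begin

definition Mt :: "int ^ 2 \<Rightarrow> int ^ 2" where
  "Mt v = transpose M *v v"

definition zero3 :: "int ^ 2 \<Rightarrow> bool" where
  "zero3 v \<longleftrightarrow> (\<forall>i. 3 dvd v $ i)"

lemma zero3_add: "zero3 v \<Longrightarrow> zero3 w \<Longrightarrow> zero3 (v + w)"
  and zero3_diff: "zero3 v \<Longrightarrow> zero3 w \<Longrightarrow> zero3 (v - w)"
  and zero3_minus: "zero3 (- v) \<longleftrightarrow> zero3 v"
  and zero3_smult: "zero3 v \<Longrightarrow> zero3 (c *s v)"
  and zero3_smult_dvd: "3 dvd c \<Longrightarrow> zero3 (c *s v)"
  and zero3_cancel: "zero3 (c *s v) \<Longrightarrow> \<not> 3 dvd c \<Longrightarrow> zero3 v"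
  by (auto simp: zero3_def dest: dvd3_cancel)

lemma zero3_Mt: "zero3 v \<Longrightarrow> zero3 (Mt v)"
  by (simp add: zero3_def Mt_def matrix_vector_mult_def sum_2)

lemma Mt_minus: "Mt (- v) = - Mt v" and Mt_add: "Mt (v + w) = Mt v + Mt w"
  by (simp_all add: Mt_def vec_eq_iff matrix_vector_mult_def sum_2 algebra_simps)

lemma funpow_Mt_minus: "(Mt ^^ n) (- v) = - (Mt ^^ n) v"
  by (induction n) (simp_all add: Mt_minus)

lemma Mt_Mt: "Mt (Mt v) = (M$1$1 + M$2$2) *s Mt v - det M *s v"
  by (simp add: Mt_def vec_eq_iff forall_2 matrix_vector_mult_def sum_2 transpose_def det_2 algebra_simps)

text \<open>Take the last iterate w for which Mt w is nonzero modulo 3 and Mt (Mt w) is zero.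
  Cayley-Hamilton at Mt w shows that 3 divides the determinant, then at w that 3 divides the trace,
  so the square of Mt vanishes on every vector.\<close>

lemma zero3_Mt_Mt:
  assumes nil: "zero3 ((Mt ^^ j) v)" and v: "\<not> zero3 (Mt v)"
  shows "zero3 (Mt (Mt v))"
proof -
  define k where "k = (LEAST j. zero3 ((Mt ^^ j) v))"
  have k: "zero3 ((Mt ^^ k) v)" unfolding k_def by (rule LeastI [of "\<lambda>j. zero3 ((Mt ^^ j) v)", OF nil])
  have less: "\<not> zero3 ((Mt ^^ i) v)" if "i < k" for i using not_less_Least that unfolding k_def by blast
  have "\<not> zero3 v" using v zero3_Mt by blast
  have "k \<noteq> 0"
    using k \<open>\<not> zero3 v\<close> by (metis eq_id_iff funpow_0)
  moreover have "k \<noteq> 1" using k v by auto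
  ultimately obtain i where i: "k = Suc (Suc i)"
    by (metis One_nat_def not0_implies_Suc)
  define w where "w = (Mt ^^ i) v"
  have w: "zero3 (Mt (Mt w))" "\<not> zero3 (Mt w)"
    using k less [of "Suc i"] by (simp_all add: i w_def)
  have "3 dvd det M"
  proof (rule ccontr)
    assume nd: "\<not> 3 dvd det M"
    have "det M *s Mt w = (M$1$1 + M$2$2) *s Mt (Mt w) - Mt (Mt (Mt w))"
      unfolding Mt_Mt [of "Mt w"] by simp
    then have "zero3 (det M *s Mt w)"
      using w(1) by (simp add: zero3_diff zero3_add zero3_smult zero3_Mt)
    then show False using zero3_cancel nd w(2) by blast
  qed
  moreover have "3 dvd M$1$1 + M$2$2"
  proof (rule ccontr)
    assume nd: "\<not> 3 dvd M$1$1 + M$2$2"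
    have "(M$1$1 + M$2$2) *s Mt w = Mt (Mt w) + det M *s w"
      unfolding Mt_Mt [of w] by simp
    then have "zero3 ((M$1$1 + M$2$2) *s Mt w)"
      using w(1) \<open>3 dvd det M\<close> by (simp add: zero3_add zero3_smult_dvd)
    then show False using zero3_cancel nd w(2) by blast
  qed
  ultimately show ?thesis
    unfolding Mt_Mt by (intro zero3_diff zero3_smult_dvd)
qed

lemma in_class_zero3: "in_class v x \<Longrightarrow> zero3 v \<longleftrightarrow> in_class 0 x"
  using in_class_cong [of v x 0] in_class_unique [of v x 0] by (auto simp: zero3_def)

lemma mask_eq_0_funpow_in_class:
  "m ((dual ^^ i) x) = 0 \<Longrightarrow> in_class ((Mt ^^ i) u) x \<or> in_class (- (Mt ^^ i) u) x"
proof -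
  assume "m ((dual ^^ i) x) = 0"
  then have "in_class u ((dual ^^ i) x) \<or> in_class (- u) ((dual ^^ i) x)" by (rule mask_eq_0_in_class)
  moreover have "(*v) (transpose M) = Mt" by (simp add: Mt_def fun_eq_iff)
  ultimately show ?thesis
    using funpow_in_class [of _ i x] by (auto simp flip: funpow_Mt_minus)
qed

lemma inj_dual: "inj dual"
  by (rule inj_on_inverseI [of _ R]) simp

lemma positive_definite_dual: "positive_definite \<psi> \<Longrightarrow> positive_definite (\<lambda>x. \<psi> (dual x))"
  by (rule positive_definite_compose [OF _ inj_dual dual_diff])

lemma positive_definite_m_mult: "positive_definite \<psi> \<Longrightarrow> positive_definite (\<lambda>x. m x * \<psi> x)"
  unfolding m_def by (intro positive_definite_mask_mult) simp_all

lemma positive_definite_q: "positive_definite (q n)"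
proof (induction n)
  case 0
  then show ?case using positive_definite_1 by (simp add: q_def [abs_def])
next
  case (Suc n)
  have "q (Suc n) = (\<lambda>x. m (dual x) * q n (dual x))"
    using q_add [of 1 n] by (simp add: q_def [of "Suc 0"] fun_eq_iff)
  then show ?case
    using positive_definite_dual [OF positive_definite_m_mult [OF Suc]] by simp
qed

text \<open>The coordinates 1/(6b) make 3 b y half-integral, so y has no residue. A residue of an
  iterate under \<open>dual\<close> would be carried to y by R.\<close>

lemma ex_generic: "\<exists>y. \<forall>i v. \<not> in_class v ((dual ^^ i) y)"
proof -
  define y :: "real ^ 2" where "y = (\<chi> i. 1 / (6 * of_int b))"
  have "\<not> in_class v y" for v
  proof
    assume "in_class v y"
    then obtain n :: "int ^ 2" where "3 * of_int b * y$1 = real_of_int (v$1 + 3 * n$1)"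
      unfolding in_class_def by blast
    then have "real_of_int 1 = real_of_int (2 * (v$1 + 3 * n$1))"
      using b_nz by (simp add: y_def)
    then have "1 = 2 * (v$1 + 3 * n$1)" by (simp only: of_int_eq_iff)
    then show False by presburger
  qed
  then show ?thesis using funpow_in_class by blast
qed

text \<open>Each case writes \<phi> = g h with \<Lambda> orthogonal for g. At the generic y, g is
  nonzero and |h| < 1, contrary to \<open>bessel_equality_factor\<close>; the cases differ only in
  which factors form h.\<close>

lemma spectral_imp_kernel:
  assumes "spectral_measure \<mu>"
  shows "zero3 (Mt u)"
proof (rule ccontr)
  assume nz: "\<not> zero3 (Mt u)"
  obtain \<Lambda> where basis: "L2_orthonormal_basis \<mu> \<Lambda> (\<lambda>l x. ee (l \<bullet> x))"
    using assms unfolding spectral_measure_def ee_def by blast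
  have orth: "orthogonal_under \<phi> \<Lambda>"
    using law.orthonormal_basis_imp_complete(1) [OF basis] unfolding \<phi>_def .
  have complete: "\<exists>F. finite F \<and> F \<subseteq> \<Lambda> \<and> 1 - \<eta> < (\<Sum>l\<in>F. (cmod (\<phi> (\<xi> - l)))\<^sup>2)" if "\<eta> > 0" for \<xi> \<eta>
    using law.orthonormal_basis_imp_complete(2) [OF basis that] unfolding \<phi>_def .
  have "\<Lambda> \<noteq> {}" using complete [of 1 0] by auto
  then obtain l0 where l0: "l0 \<in> \<Lambda>" by blast
  obtain y where y: "\<And>i v. \<not> in_class v ((dual ^^ i) y)" using ex_generic by blast
  have y_m: "m ((dual ^^ i) y) \<noteq> 0" "cmod (m ((dual ^^ i) y)) \<noteq> 1" for i
    using y [of _ i] mask_eq_0_in_class norm_mask_eq_1 period_in_class_0 by blast+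
  have y_phi: "\<phi> ((dual ^^ i) y) \<noteq> 0" for i
    using y [of _ i] phi_eq_0_in_class by blast
  have y_phi1: "cmod (\<phi> ((dual ^^ i) y)) \<noteq> 1" for i
  proof
    assume 1: "cmod (\<phi> ((dual ^^ i) y)) = 1"
    have "cmod (\<phi> ((dual ^^ i) y)) = cmod (m ((dual ^^ Suc i) y)) * cmod (\<phi> ((dual ^^ Suc i) y))"
      by (subst phi_dual) (simp add: norm_mult)
    also have "\<dots> \<le> cmod (m ((dual ^^ Suc i) y)) * 1"
      by (intro mult_left_mono norm_phi_le_1) simp
    finally show False
      using 1 y_m(2) [of "Suc i"] norm_mask_le_1 [of "(dual ^^ Suc i) y"] by linarith
  qed
  have zero: "\<phi> (k - l) = 0" if "k \<in> \<Lambda>" "l \<in> \<Lambda>" "k \<noteq> l" for k l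
    using orth that by (simp add: orthogonal_under_def)
  show False
  proof (cases "\<exists>j. zero3 ((Mt ^^ j) u)")
    case False
    \<comment> \<open>If two points had equal residues relative to l0, their difference would have
      residue 0 and also some \<plusminus>R^i u, which is never 0 here. Finiteness then lets one
      partial product annihilate all differences, and h is its tail.\<close>
    have finite: "finite \<Lambda>"
    proof -
      have "\<exists>v. in_class v (l - l0)" if "l \<in> \<Lambda>" for l
        using phi_eq_0_in_class zero [OF that l0] period_in_class_0 [of 0] by (cases "l = l0") auto
      then obtain v where v: "\<And>l. l \<in> \<Lambda> \<Longrightarrow> in_class (v l) (l - l0)" by metis
      define \<kappa> where "\<kappa> l = (v l $ 1 mod 3, v l $ 2 mod 3)" for l
      have "inj_on \<kappa> \<Lambda>"
      proof (rule inj_onI, rule ccontr)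
        fix k l assume kl: "k \<in> \<Lambda>" "l \<in> \<Lambda>" "\<kappa> k = \<kappa> l" "k \<noteq> l"
        have "3 dvd (v k - v l) $ i" for i
          using kl(3) exhaust_2 [of i] by (auto simp: \<kappa>_def mod_eq_dvd_iff)
        then have "zero3 (v k - v l)" by (simp add: zero3_def)
        moreover have "in_class (v k - v l) (k - l)"
          using in_class_diff [OF v [OF kl(1)] v [OF kl(2)]] by simp
        ultimately have 0: "in_class 0 (k - l)" using in_class_zero3 by blast
        obtain i where "m ((dual ^^ i) (k - l)) = 0"
          using zero [OF kl(1,2,4)] unfolding phi_eq_0_iff by blast
        from mask_eq_0_funpow_in_class [OF this] 0 have "zero3 ((Mt ^^ i) u)"
          using in_class_zero3 zero3_minus by blast
        then show False using False by blast
      qed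
      moreover have "\<kappa> ` \<Lambda> \<subseteq> {0..<3} \<times> {0..<3}" by (auto simp: \<kappa>_def)
      ultimately show ?thesis
        by (meson finite_SigmaI finite_atLeastLessThan_int inj_on_finite)
    qed
    have "\<forall>\<^sub>F n in sequentially. q n (k - l) = 0" if kl: "k \<in> \<Lambda>" "l \<in> \<Lambda>" "k \<noteq> l" for k l
    proof -
      obtain i where i: "i \<ge> 1" "m ((dual ^^ i) (k - l)) = 0"
        using zero [OF kl] unfolding phi_eq_0_iff by blast
      have "q n (k - l) = 0" if "n \<ge> i" for n
        unfolding q_def using i that by (intro prod_zero) auto
      then show ?thesis by (auto simp: eventually_sequentially)
    qed
    then have "\<forall>\<^sub>F n in sequentially. \<forall>k\<in>\<Lambda>. \<forall>l\<in>\<Lambda>. k \<noteq> l \<longrightarrow> q n (k - l) = 0"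
      by (intro eventually_ball_finite finite ballI) (auto simp: eventually_mono)
    then obtain n where n: "orthogonal_under (q n) \<Lambda>"
      unfolding orthogonal_under_def by (auto simp: eventually_sequentially)
    have "q n y = 0 \<or> cmod (\<phi> ((dual ^^ n) y)) = 1"
      by (rule bessel_equality_factor [OF complete l0 positive_definite_q n phi_funpow norm_phi_le_1])
    moreover have "q n y \<noteq> 0" using y_m(1) by (simp add: q_def)
    ultimately show False using y_phi1 by blast
  next
    case True
    then have "zero3 (Mt (Mt u))" using zero3_Mt_Mt nz by blast
    then have nil: "zero3 ((Mt ^^ Suc (Suc i)) u)" for i
      by (induction i) (simp_all add: zero3_Mt)
    \<comment> \<open>A difference is annihilated either by the first factor, or by a later one; residues modulo 3 tell which.\<close>
    have far: "in_class 0 x" if phi: "\<phi> (dual x) = 0" for x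
    proof -
      obtain i where i: "i \<ge> 1" "m ((dual ^^ i) (dual x)) = 0"
        using phi unfolding phi_eq_0_iff by blast
      then obtain k where "i = Suc k" by (metis One_nat_def Suc_le_D)
      then have "m ((dual ^^ Suc (Suc k)) x) = 0" using i(2) by (simp add: funpow_swap1)
      from mask_eq_0_funpow_in_class [OF this] nil [of k] show ?thesis
        using in_class_zero3 zero3_minus by blast
    qed
    have near: "\<not> in_class 0 x" if "m (dual x) = 0" for x
      using mask_eq_0_funpow_in_class [of 1 x] that nz in_class_zero3 [of _ x] zero3_minus [of "Mt u"] by auto
    have split: "m (dual (k - l)) = 0 \<or> \<phi> (dual (k - l)) = 0" if "k \<in> \<Lambda>" "l \<in> \<Lambda>" "k \<noteq> l" for k l
      using zero [OF that] phi_dual [of "k - l"] by simp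
    show False
    proof (cases "\<exists>l1\<in>\<Lambda>. \<exists>l2\<in>\<Lambda>. l1 \<noteq> l2 \<and> \<phi> (dual (l1 - l2)) \<noteq> 0")
      \<comment> \<open>Every difference is annihilated beyond the first factor, so the first factor
        can be deleted.\<close>
      case False
      then have "orthogonal_under (\<lambda>x. \<phi> (dual x)) \<Lambda>"
        by (auto simp: orthogonal_under_def)
      moreover have "\<phi> x = \<phi> (dual x) * m (dual x)" for x
        using phi_dual [of x] by (simp only: mult.commute)
      ultimately have "\<phi> (dual y) = 0 \<or> cmod (m (dual y)) = 1"
        using complete l0 positive_definite_dual [OF positive_definite_phi] norm_mask_le_1
        by (intro bessel_equality_factor [where \<psi> = \<phi> and g = "\<lambda>x. \<phi> (dual x)" and h = "\<lambda>x. m (dual x)"])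
      then show False using y_m(2) [of 1] y_phi [of 1] by simp
    next
      case True
      then obtain l1 l2 where l: "l1 \<in> \<Lambda>" "l2 \<in> \<Lambda>" "l1 \<noteq> l2" "\<phi> (dual (l1 - l2)) \<noteq> 0"
        by blast
      then have "m (dual (l1 - l2)) = 0" using split [OF l(1-3)] by simp
      then have l12: "l1 \<in> \<Lambda>" "l2 \<in> \<Lambda>" "\<not> in_class 0 (l1 - l2)"
        using l(1,2) near by simp_all
      \<comment> \<open>Now the second factor is deleted. Differences of nonzero residue are killed
        by the first one. For a difference k - l of residue 0, a third point p with k - p and l - p
        of nonzero residue is used; l1 and l2 guarantee that it exists.\<close>
      have "orthogonal_under (\<lambda>x. m (dual x) * \<phi> (dual (dual x))) \<Lambda>"
        unfolding orthogonal_under_def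
      proof (intro ballI impI)
        fix k l assume kl: "k \<in> \<Lambda>" "l \<in> \<Lambda>" "k \<noteq> l"
        show "m (dual (k - l)) * \<phi> (dual (dual (k - l))) = 0"
        proof (cases "in_class 0 (k - l)")
          case False
          then show ?thesis using split [OF kl] far by auto
        next
          case same: True
          have "\<exists>p\<in>\<Lambda>. \<not> in_class 0 (k - p)"
          proof (rule ccontr)
            assume "\<not> ?thesis"
            then have "in_class (0 - 0) ((k - l2) - (k - l1))"
              using l12 by (intro in_class_diff) auto
            then show False using l12(3) by simp
          qed
          then obtain p where p: "p \<in> \<Lambda>" "\<not> in_class 0 (k - p)" by blast
          have p': "\<not> in_class 0 (l - p)"
            using p(2) in_class_add [OF same, of 0 "l - p"] by auto
          have z0: "in_class 0 0" using period_in_class_0 [of 0] by simp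
          have ne: "k \<noteq> p" "l \<noteq> p" using p p' z0 by auto
          define s t where "s = dual (k - p)" and "t = dual (l - p)"
          have "m s = 0" "m t = 0"
            using split [OF kl(1) p(1) ne(1)] split [OF kl(2) p(1) ne(2)] far p p' unfolding s_def t_def by blast+
          then have st: "zero_pos s \<or> zero_pos (- s)" "zero_pos t \<or> zero_pos (- t)"
            using mask_eq_0 by blast+
          have x: "dual (k - l) = s - t" by (simp add: s_def t_def dual_diff)
          \<comment> \<open>Zeros s and t of opposite sign would give s - t the residue
            \<plusminus>2u, and k - l the residue \<plusminus>2 R u, which is nonzero modulo
            3.\<close>
          have opp: "\<not> (in_class u a \<and> in_class u (- c))" if ac: "a - c = s - t \<or> a - c = t - s" for a c
          proof
            assume "in_class u a \<and> in_class u (- c)"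
            then have "in_class (u + u) (a - c)" using in_class_add [of u a u "- c"] by simp
            then have "in_class (Mt (u + u)) (R (a - c))" unfolding Mt_def by (rule in_class_R)
            moreover have "in_class 0 (R (a - c))"
              using ac same in_class_minus [OF same] by (auto simp: s_def t_def simp flip: dual_diff)
            ultimately have "zero3 (Mt (u + u))" using in_class_zero3 by blast
            moreover have "Mt (u + u) = 2 *s Mt u" by (simp only: Mt_add vec_eq_iff vector_add_component vector_smult_component mult_2 simp_thms)
            ultimately show False using zero3_cancel [of 2 "Mt u"] nz by simp
          qed
          have "zero_pos s \<and> zero_pos t \<or> zero_pos (- s) \<and> zero_pos (- t)"
            using st opp [of s t] opp [of t s] zero_pos_in_class by blast
          then have per: "la (s - t) \<in> \<int>" "lb (s - t) \<in> \<int>"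
            unfolding zero_pos_def
            using Ints_diff [of "la s - 1/3" "la t - 1/3"] Ints_diff [of "lb s + 1/3" "lb t + 1/3"]
              Ints_diff [of "la (- t) - 1/3" "la (- s) - 1/3"] Ints_diff [of "lb (- t) + 1/3" "lb (- s) + 1/3"]
              la_add [of s "- t"] lb_add [of s "- t"] by (auto simp: la_minus lb_minus)
          \<comment> \<open>So R^-1 (k - l) is a period of m and has residue 0. The first factor
            equals 1 there, and by \<open>near\<close> the second is nonzero: the zero of \<phi>
            lies in a factor that has been kept.\<close>
          have c0: "in_class 0 (dual (k - l))" unfolding x by (rule period_in_class_0 [OF per])
          have "m (dual (k - l)) = 1"
            using mask_periodic [OF per, of 0] by (simp add: x)
          then have "\<phi> (dual (k - l)) = 0" using zero [OF kl] phi_dual [of "k - l"] by simp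
          then have "m (dual (dual (k - l))) = 0 \<or> \<phi> (dual (dual (k - l))) = 0"
            using phi_dual [of "dual (k - l)"] by simp
          then show ?thesis using near c0 by auto
        qed
      qed
      moreover have "positive_definite (\<lambda>x. m (dual x) * \<phi> (dual (dual x)))"
        by (rule positive_definite_dual [OF positive_definite_m_mult [OF positive_definite_dual [OF positive_definite_phi]]])
      moreover have "\<phi> x = (m (dual x) * \<phi> (dual (dual x))) * m (dual (dual x))" for x
        using phi_dual [of x] phi_dual [of "dual x"] by (simp only: mult_ac)
      ultimately have "m (dual y) * \<phi> (dual (dual y)) = 0 \<or> cmod (m (dual (dual y))) = 1"
        using complete l0 norm_mask_le_1
        by (intro bessel_equality_factor [where \<psi> = \<phi> and h = "\<lambda>x. m (dual (dual x))"
              and g = "\<lambda>x. m (dual x) * \<phi> (dual (dual x))"])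
      then show False
        using y_m(1) [of 1] y_m(2) [of 2] y_phi [of 2] by (simp add: numeral_2_eq_2)
    qed
  qed
qed

lemma spectral_iff: "spectral_measure \<mu> \<longleftrightarrow> (\<forall>i. 3 dvd (transpose M *v u) $ i)"
proof
  assume "spectral_measure \<mu>"
  from spectral_imp_kernel [OF this] show "\<forall>i. 3 dvd (transpose M *v u) $ i"
    by (simp add: zero3_def Mt_def)
next
  assume "\<forall>i. 3 dvd (transpose M *v u) $ i"
  then show "spectral_measure \<mu>"
    using kernel_imp_tight spectral_if_tight by metis
qed

lemma self_affine_measure_eq: "self_affine_measure (map_matrix real_of_int M) (real_vec ` digits) = \<mu>"
proof -
  have iff: "is_self_affine_measure (map_matrix real_of_int M) (real_vec ` digits) \<nu> \<longleftrightarrow> invariant \<nu>" for \<nu>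
    unfolding is_self_affine_measure_def invariant_def affine_branch_def [abs_def] ..
  show ?thesis
    unfolding self_affine_measure_def iff \<mu>_def
    by (rule the_equality) (rule invariant_address_law, rule invariant_unique [OF _ invariant_address_law])
qed

end

theorem theorem1p10:
  fixes M B :: "int ^ 2 ^ 2" and D :: "(int ^ 2) set" and \<alpha>1 \<alpha>2 \<beta>1 \<beta>2 :: int
  assumes "expanding (map_matrix real_of_int M)"
    and "D = {vector [0, 0], vector [\<alpha>1, \<alpha>2], vector [\<beta>1, \<beta>2]}"
    and "B = vector [vector [\<alpha>1, \<beta>1], vector [\<alpha>2, \<beta>2]]"
    and "\<not> 3 dvd \<alpha>1 * \<beta>2 - \<alpha>2 * \<beta>1"
  shows "(spectral_measure (self_affine_measure (map_matrix real_of_int M) (real_vec ` D))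
            \<longleftrightarrow> admissible M D) \<and>
         (admissible M D \<longleftrightarrow>
            (\<exists>A \<in> GL2_3. mod3 (A ** B) = mat 1 \<and>
               (\<forall>i. 3 dvd (transpose (A ** M ** B) *v vector [1, -1]) $ i)))"
proof -
  obtain C r where "0 < C" "0 < r" "r < 1"
    "\<And>n x. norm (((*v) (matrix_inv (map_matrix real_of_int M)) ^^ n) x) \<le> C * r ^ n * norm x"
    using expanding_inverse_decay(2) [OF assms(1)] by blast
  then interpret three_digits M \<alpha>1 \<alpha>2 \<beta>1 \<beta>2 C r
    using expanding_inverse_decay(1) [OF assms(1)] assms(4) by unfold_locales (simp_all add: matrix_vector_right_distrib matrix_vector_mult_scaleR)
  show ?thesis
    unfolding kernel_condition_iff [OF assms(3,4)] assms(2) self_affine_measure_eq spectral_iff admissible_iff u_def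
    by blast
qed

end
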